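(* Let $n\ge 2$ and $1\le d<n$ be integers and let $A\in \mathrm{Mat}_{d+1,n-d}(\mathbb{R})$. Let $\mathrm{Sing}_A$ denote the set of $\mathbf{s}\in\mathbb{R}^d$ such that the vector $(\mathbf{s},\widetilde{\mathbf{s}}A)\in\mathbb{R}^n$ is singular. Then the Hausdorff dimension of $\mathrm{Sing}_A$ satisfies $$\dim_H(\mathrm{Sing}_A)\le \begin{cases} \dfrac{d^2}{d+1}+\dfrac{nd\left(\omega(A)-\frac{n-d}{d+1}\right)}{\left(1+(d+1)\omega(A)-(n-d)\right)(n+1)}, & \text{if } \frac{n-d}{d+1}\le \omega(A)<n-1,\\[2mm] \dfrac{d^2}{d+1}+\dfrac{1}{n+1}\left(\omega(A)-\dfrac{n-d}{d+1}\right), & \text{if } n-1\le \omega(A)<n,\\[2mm] d, & \text{if } \omega(A)\ge n.\end{cases}$$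
   Context: For a row vector $\mathbf{s}=(s_1,\dots,s_d)\in\mathbb{R}^d$, $\widetilde{\mathbf{s}}=(1,s_1,\dots,s_d)\in\mathbb{R}^{d+1}$, so $\widetilde{\mathbf{s}}A\in\mathbb{R}^{n-d}$. Norms are sup-norms. A vector $\mathbf{x}\in\mathbb{R}^n$ is called singular if for every $\varepsilon>0$ there exists $N_\varepsilon$ such that for all $N\ge N_\varepsilon$ there exist $\mathbf{q}\in\mathbb{Z}^n\setminus\{0\}$ and $p\in\mathbb{Z}$ with $|\mathbf{q}\cdot\mathbf{x}-p|\le \varepsilon N^{-n}$ and $\|\mathbf{q}\|\le N$. The Diophantine exponent $\omega(A)\in[0,+\infty]$ of $A\in\mathrm{Mat}_{d+1,n-d}(\mathbb{R})$ is the supremum of the real numbers $\omega$ such that the inequality $\|A\mathbf{q}-\mathbf{p}\|\le\|\mathbf{q}\|^{-\omega}$ has infinitely many solutions $\mathbf{q}\in\mathbb{Z}^{n-d}\setminus\{0\}$, $\mathbf{p}\in\mathbb{Z}^{d+1}$. (By Dirichlet's theorem $\omega(A)\ge\frac{n-d}{d+1}$ always.) *)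

theory Defs
  imports "HOL-Analysis.Analysis"
begin

text \<open>
  The dimensions are carried by index types: \<open>'d\<close> has \<open>d\<close> elements, \<open>'m\<close> has \<open>n - d\<close> elements,
  \<open>'d option\<close> has \<open>d + 1\<close> elements and \<open>'d + 'm\<close> has \<open>n\<close> elements.
  The sup-norm is the library's \<^const>\<open>infnorm\<close>, as \<^const>\<open>norm\<close> on \<open>real ^ 'n\<close> is Euclidean.
\<close>

subsection \<open>Hausdorff dimension\<close>

text \<open>
  The cases keep the usual conventions \<open>diam {} ^ s = 0\<close> and, for nonempty sets, \<open>diam U ^ 0 = 1\<close>,
  whereas \<open>0 powr 0 = 0\<close> in the library.
\<close>

definition diam_powr :: "real \<Rightarrow> 'a::metric_space set \<Rightarrow> real" where
  "diam_powr s U = (if U = {} then 0 else if s = 0 then 1 else diameter U powr s)"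

text \<open>Boundedness is required explicitly, since \<^const>\<open>diameter\<close> is unspecified on unbounded sets.\<close>

definition hausdorff_premeasure :: "real \<Rightarrow> real \<Rightarrow> 'a::metric_space set \<Rightarrow> ennreal" where
  "hausdorff_premeasure s \<delta> E =
     (INF U \<in> {U :: nat \<Rightarrow> 'a set. (\<forall>i. bounded (U i) \<and> diameter (U i) \<le> \<delta>) \<and> E \<subseteq> (\<Union>i. U i)}.
        \<Sum>i. ennreal (diam_powr s (U i)))"

definition hausdorff_measure :: "real \<Rightarrow> 'a::metric_space set \<Rightarrow> ennreal" where
  "hausdorff_measure s E = (SUP \<delta> \<in> {0<..}. hausdorff_premeasure s \<delta> E)"

definition hausdorff_dim :: "'a::metric_space set \<Rightarrow> ereal" where
  "hausdorff_dim E = (INF s \<in> {s. 0 \<le> s \<and> hausdorff_measure s E = 0}. ereal s)"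

subsection \<open>Singular vectors and Diophantine exponents\<close>

definition of_int_vec :: "int ^ 'n \<Rightarrow> real ^ 'n" where
  "of_int_vec q = (\<chi> i. real_of_int (q $ i))"

definition singular_vec :: "real ^ 'n \<Rightarrow> bool" where
  "singular_vec x \<longleftrightarrow>
     (\<forall>\<epsilon>>0. \<exists>N\<^sub>0::nat. \<forall>N\<ge>N\<^sub>0. \<exists>(q :: int ^ 'n) (p :: int).
        q \<noteq> 0 \<and>
        \<bar>of_int_vec q \<bullet> x - real_of_int p\<bar> \<le> \<epsilon> * real N powr (- real CARD('n)) \<and>
        infnorm (of_int_vec q) \<le> real N)"

definition dioph_exponent :: "real ^ 'c ^ 'r \<Rightarrow> ereal" where
  "dioph_exponent A =
     Sup {ereal \<omega> | \<omega>. infinite {(q :: int ^ 'c, p :: int ^ 'r). q \<noteq> 0 \<and>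
        infnorm (A *v of_int_vec q - of_int_vec p) \<le> infnorm (of_int_vec q) powr (- \<omega>)}}"

subsection \<open>The affine subspace parametrised by a matrix\<close>

text \<open>The row and coordinate with index \<^const>\<open>None\<close> belong to the leading entry \<open>1\<close>.\<close>

definition tilde :: "real ^ 'd \<Rightarrow> real ^ 'd option" where
  "tilde s = (\<chi> i. case i of None \<Rightarrow> 1 | Some j \<Rightarrow> s $ j)"

definition vec_append :: "real ^ 'd \<Rightarrow> real ^ 'm \<Rightarrow> real ^ ('d + 'm)" where
  "vec_append u v = (\<chi> i. case i of Inl j \<Rightarrow> u $ j | Inr k \<Rightarrow> v $ k)"

definition Sing :: "real ^ 'm ^ 'd option \<Rightarrow> (real ^ 'd) set" where
  "Sing A = {s. singular_vec (vec_append s (tilde s v* A))}"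

end

theory Submission
  imports Defs
begin

text \<open>
  By Dani's correspondence, \<open>s \<in> Sing A\<close> forces the images of the lattice of all \<open>(A y - P, y)\<close> under a
  diagonal flow, after a shear by \<open>s\<close>, to contain arbitrarily short vectors from some time on.
  The proportion of a cube of parameters \<open>s\<close> on which this can happen is measured by a height function
  in the manner of Margulis: a supremum, over the sublattices of all ranks, of negative powers of their
  covolumes. One step of the flow expands \<open>s\<close> by \<open>M\<close>; averaged over the \<open>M ^ d\<close> subcubes the height is
  bounded by \<open>log M * M powr (d - (d - p) / (d + 1))\<close> times its largest value along the one-parameter group
  that dilates the \<open>d + 1\<close> coordinates \<open>A y - P\<close>, discounted at rate \<open>p\<close>, up to an additive constant.
  Since this group commutes with the shears and the flow, summing the heights along it with a rate \<open>q < p\<close>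
  gives a function satisfying a genuine contraction inequality. Counting subcubes on which it stays large
  bounds the dimension by \<open>(d\<^sup>2 + p) / (d + 1)\<close>. The sum is finite for the lattice at hand as soon as \<open>p\<close>
  exceeds two thresholds given by \<open>\<omega>(A)\<close>, and the larger one yields each of the first two bounds.
\<close>

subsection \<open>Determinants as functions of the rows\<close>

text \<open>The obstacle is that \<open>s\<close> has only d parameters and enters through the d + 1
  coordinates \<open>A y - P\<close> alone. A minor using none of these rows is untouched by every
  shear and shrinks under the normalised flow, so averaging over \<open>s\<close> cannot bring down
  the height of a sublattice that such minors dominate. Dilating the block \<open>A y - P\<close> by
  2^l multiplies a minor by 2^(l J), with J the number of its rows in the block, and so shifts the
  weight to minors with large J. The count over the grid is favourable at the first l where such a
  minor dominates, and the discount 2^(-l p) is the price of comparing with that l. If there is no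
  such l, the discounted supremum is infinite and the inequality is trivial. The order of choices is
  p, q < p, the step M, and last the weight K inside the heights. The exponent of M depends on d and
  p only, so log M and all constant factors are absorbed by taking M large.\<close>

definition upd :: "('a \<Rightarrow> 'b) \<Rightarrow> 'a \<Rightarrow> 'b \<Rightarrow> 'a \<Rightarrow> 'b" where
  "upd v k x = (\<lambda>i. if i = k then x else v i)"

lemma upd_apply: "upd v k x i = (if i = k then x else v i)"
  by (simp add: upd_def)

lemma upd_triv [simp]: "upd v k (v k) = v"
  by (auto simp: upd_def)

lemma upd_upd [simp]: "upd (upd v k x) k y = upd v k y"
  by (auto simp: upd_def)

definition rowdet :: "('r \<Rightarrow> real ^ 'r) \<Rightarrow> real" where
  "rowdet v = det (\<chi> k. v k)"

lemma rowdet_upd: "rowdet (upd v k x) = det (\<chi> i. if i = k then x else v i)"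
  by (simp add: rowdet_def upd_def)

lemma rowdet_add: "rowdet (upd v k (x + y)) = rowdet (upd v k x) + rowdet (upd v k y)"
  unfolding rowdet_upd by (rule det_row_add)

lemma rowdet_scale: "rowdet (upd v k (c *\<^sub>R x)) = c * rowdet (upd v k x)"
  unfolding rowdet_upd using det_row_mul[of k c "\<lambda>_. x" v] unfolding scalar_mult_eq_scaleR .

lemma rowdet_zero: "rowdet (upd v k 0) = 0"
  using rowdet_scale[of v k 0 0] by simp

lemma rowdet_sum: "rowdet (upd v k (\<Sum>a\<in>S. g a)) = (\<Sum>a\<in>S. rowdet (upd v k (g a)))"
  by (induction S rule: infinite_finite_induct) (simp_all add: rowdet_zero rowdet_add)

lemma rowdet_eq_0:
  assumes "k \<noteq> l" "v k = v l"
  shows "rowdet v = 0"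
  unfolding rowdet_def by (rule det_identical_rows[OF assms(1)]) (simp add: row_def assms(2))

lemma rowdet_span:
  assumes "x \<in> span (v ` (- {k}))"
  shows "rowdet (upd v k (v k + x)) = rowdet v"
proof -
  have "rowdet (upd v k x) = 0"
    using assms
  proof (induction rule: span_induct_alt)
    case base
    then show ?case by (rule rowdet_zero)
  next
    case (step c z y)
    then obtain l where l: "z = v l" "l \<noteq> k" by blast
    have "rowdet (upd v k z) = 0"
      by (rule rowdet_eq_0[OF l(2)]) (use l in \<open>auto simp: upd_apply\<close>)
    then show ?case using step by (simp add: rowdet_add rowdet_scale)
  qed
  then show ?thesis by (simp add: rowdet_add)
qed

lemma rowdet_add_row:
  assumes "k \<noteq> l"
  shows "rowdet (upd v k (v k + c *\<^sub>R v l)) = rowdet v"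
  by (rule rowdet_span, rule span_scale, rule span_base) (use assms in auto)

lemma rowdet_span_set:
  fixes v :: "'r::finite \<Rightarrow> real ^ 'r"
  assumes "\<And>k. k \<in> S \<Longrightarrow> x k \<in> span (v ` (- S))"
  shows "rowdet (\<lambda>k. if k \<in> S then v k + x k else v k) = rowdet v"
proof -
  have "rowdet (\<lambda>k. if k \<in> S' then v k + x k else v k) = rowdet v" if "finite S'" "S' \<subseteq> S" for S'
    using that
  proof (induction S' rule: finite_induct)
    case (insert a F)
    let ?w = "\<lambda>k. if k \<in> F then v k + x k else v k"
    have eq: "(\<lambda>k. if k \<in> insert a F then v k + x k else v k) = upd ?w a (?w a + x a)"
      using insert.hyps by (intro ext) (auto simp: upd_apply)
    have sub: "v ` (- S) \<subseteq> ?w ` (- {a})"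
    proof
      fix z assume "z \<in> v ` (- S)"
      then obtain k where "k \<notin> S" "z = v k" by blast
      then show "z \<in> ?w ` (- {a})" using insert.prems by (intro image_eqI[of _ _ k]) auto
    qed
    have "x a \<in> span (?w ` (- {a}))"
      using assms[of a] insert.prems span_mono[OF sub] by blast
    then have "rowdet (upd ?w a (?w a + x a)) = rowdet ?w" by (rule rowdet_span)
    then show ?case unfolding eq using insert by simp
  qed simp
  then show ?thesis by simp
qed

text \<open>Two rows equal to \<open>w\<close> make the determinant vanish, so the expansion stops
  at first order in \<open>t\<close>. This is why minors will be affine functions of the shear
  parameter.\<close>

lemma rowdet_common:
  fixes v :: "'r::finite \<Rightarrow> real ^ 'r"
  shows "rowdet (\<lambda>k. if k \<in> K then v k + t k *\<^sub>R w else v k)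
    = rowdet v + (\<Sum>k\<in>K. t k * rowdet (upd v k w))"
proof -
  have "finite K" by simp
  then show ?thesis
  proof (induction K rule: finite_induct)
    case (insert a F)
    let ?u = "\<lambda>k. if k \<in> F then v k + t k *\<^sub>R w else v k"
    have eq: "(\<lambda>k. if k \<in> insert a F then v k + t k *\<^sub>R w else v k) = upd ?u a (v a + t a *\<^sub>R w)"
      using insert.hyps by (intro ext) (auto simp: upd_apply)
    have ua: "upd ?u a (v a) = ?u" using insert.hyps by (intro ext) (auto simp: upd_apply)
    have "rowdet (upd ?u a w) = rowdet (upd v a w)"
    proof -
      have eq': "upd ?u a w = (\<lambda>k. if k \<in> F then (upd v a w) k + t k *\<^sub>R w else (upd v a w) k)"
        using insert.hyps by (intro ext) (auto simp: upd_apply)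
      have "rowdet (\<lambda>k. if k \<in> F then upd v a w k + t k *\<^sub>R w else upd v a w k) = rowdet (upd v a w)"
      proof (rule rowdet_span_set)
        fix k assume "k \<in> F"
        have "w \<in> (upd v a w) ` (- F)" using insert.hyps by (intro image_eqI[of _ _ a]) (auto simp: upd_apply)
        then show "t k *\<^sub>R w \<in> span (((upd v a w)) ` (- F))" by (intro span_scale span_base)
      qed
      then show "rowdet (upd ?u a w) = rowdet (upd v a w)" unfolding eq' .
    qed
    then show ?case
      unfolding eq rowdet_add rowdet_scale ua using insert by simp
  qed simp
qed

text \<open>Cramer's rule for the basis \<open>v\<close>. Applied to padded families it turns the
  coefficients of a vector into quotients of minors.\<close>

lemma rowdet_expand:
  assumes "rowdet v \<noteq> 0"
  shows "z = (\<Sum>k\<in>UNIV. (rowdet (upd v k z) / rowdet v) *\<^sub>R v k)"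
proof -
  let ?A = "\<chi> k. v k"
  have "invertible (transpose ?A)" using assms by (simp add: rowdet_def invertible_det_nz)
  then obtain B where "transpose ?A ** B = mat 1" by (auto simp: invertible_def)
  then have "transpose ?A *v (B *v z) = z" by (simp add: matrix_vector_mul_assoc)
  moreover define x where "x = B *v z"
  ultimately have z: "z = (\<Sum>k\<in>UNIV. x $ k *\<^sub>R v k)"
    by (simp add: matrix_mult_sum column_def transpose_def vec_eq_iff scalar_mult_eq_scaleR)
  have "rowdet (upd v k z) = x $ k * rowdet v" for k
  proof -
    have r: "row i ?A = v i" for i by (simp add: row_def)
    show ?thesis
      using cramer_lemma_transpose[of k x ?A] unfolding rowdet_upd rowdet_def
      unfolding scalar_mult_eq_scaleR r z[symmetric] upd_def by simp
  qed
  then show ?thesis using z assms by simp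
qed

lemma rowdet_comb:
  "rowdet (\<lambda>k. \<Sum>c\<in>UNIV. Q k c *\<^sub>R v c) = det (\<chi> k c. Q k c) * rowdet v"
  unfolding rowdet_def det_mul[symmetric] matrix_mul_sum_alt by (simp add: scalar_mult_eq_scaleR)

lemma rowdet_linear:
  assumes "linear h"
  shows "rowdet (\<lambda>k. h (v k)) = rowdet v * rowdet (\<lambda>r. h (axis r 1))"
proof -
  have "h (v k) = (\<Sum>c\<in>UNIV. (v k $ c) *\<^sub>R h (axis c 1))" for k
  proof -
    have "v k = (\<Sum>c\<in>UNIV. (v k $ c) *\<^sub>R axis c 1)"
      using basis_expansion[of "v k"] by (simp add: scalar_mult_eq_scaleR)
    then have "h (v k) = h (\<Sum>c\<in>UNIV. (v k $ c) *\<^sub>R axis c 1)" by simp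
    then show ?thesis using assms by (simp add: linear_sum linear_scale)
  qed
  then have "rowdet (\<lambda>k. h (v k)) = rowdet (\<lambda>k. \<Sum>c\<in>UNIV. (v k $ c) *\<^sub>R h (axis c 1))" by simp
  then show ?thesis unfolding rowdet_comb by (simp add: rowdet_def)
qed

lemma rowdet_axis: "rowdet (\<lambda>r. axis r 1) = 1"
proof -
  have "(\<chi> r. axis r 1) = (mat 1 :: real ^ 'a ^ 'a)"
    by (auto simp: vec_eq_iff mat_def axis_def)
  then show ?thesis by (simp add: rowdet_def)
qed

lemma rowdet_scale_all: "rowdet (\<lambda>k. c k *\<^sub>R v k) = (\<Prod>k\<in>UNIV. c k) * rowdet v"
  using det_rows_mul[of c v] by (simp add: rowdet_def scalar_mult_eq_scaleR)

lemma rowdet_permute: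
  assumes "\<sigma> permutes UNIV"
  shows "\<bar>rowdet (v \<circ> \<sigma>)\<bar> = \<bar>rowdet v\<bar>"
proof -
  have "rowdet (v \<circ> \<sigma>) = of_int (sign \<sigma>) * rowdet v"
    using det_permute_rows[OF assms, of "\<chi> k. v k"] by (simp add: rowdet_def)
  then show ?thesis by (simp add: abs_mult sign_def)
qed

lemma rowdet_zero_column:
  assumes "\<And>k. v k $ r = 0"
  shows "rowdet v = 0"
  unfolding rowdet_def by (rule det_zero_column(1)[of r]) (simp add: column_def assms vec_eq_iff)

lemma rowdet_Ints:
  assumes "\<And>k r. v k $ r \<in> \<int>"
  shows "rowdet v \<in> \<int>"
  unfolding rowdet_def det_def using assms
  by (intro Ints_sum Ints_mult Ints_prod) auto

section \<open>The sup-norm and a Hadamard-type bound\<close>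

lemma infnorm_le_iff: "infnorm (x :: real ^ 'r) \<le> c \<longleftrightarrow> (\<forall>i. \<bar>x $ i\<bar> \<le> c)"
proof -
  have eq: "{\<bar>x $ i\<bar> | i. i \<in> UNIV} = range (\<lambda>i. \<bar>x $ i\<bar>)" by auto
  have "bdd_above (range (\<lambda>i. \<bar>x $ i\<bar>))" by (intro bdd_above_finite) simp
  then show ?thesis unfolding infnorm_cart eq by (subst cSup_le_iff) auto
qed

lemma infnorm_attained:
  fixes x :: "real ^ 'r"
  obtains r where "\<bar>x $ r\<bar> = infnorm x"
proof -
  obtain r where "Max (range (\<lambda>i. \<bar>x $ i\<bar>)) = \<bar>x $ r\<bar>"
  proof -
    have "Max (range (\<lambda>i. \<bar>x $ i\<bar>)) \<in> range (\<lambda>i. \<bar>x $ i\<bar>)" by (rule Max_in) auto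
    then show ?thesis by (elim rangeE) (rule that)
  qed
  then have "\<bar>x $ i\<bar> \<le> \<bar>x $ r\<bar>" for i
    by (metis Max_ge finite finite_imageI rangeI)
  then have "infnorm x \<le> \<bar>x $ r\<bar>" by (simp add: infnorm_le_iff)
  then show ?thesis using that component_le_infnorm_cart[of x r] by fastforce
qed

lemma infnorm_axis: "infnorm (axis r (1::real) :: real ^ 'r) \<le> 1"
  by (auto simp: infnorm_le_iff axis_def)

text \<open>Each term of the Leibniz formula is bounded by the product of the sup-norms. The factor
  \<open>fact CARD('r)\<close> in all later comparisons of minors with products of norms comes from
  here.\<close>

lemma rowdet_le: "\<bar>rowdet v\<bar> \<le> fact CARD('r) * (\<Prod>k\<in>UNIV. infnorm (v k))" for v :: "'r::finite \<Rightarrow> real ^ 'r"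
proof -
  let ?P = "{p. p permutes (UNIV::'r set)}"
  have "\<bar>rowdet v\<bar> \<le> (\<Sum>p\<in>?P. \<bar>of_int (sign p) * (\<Prod>i\<in>UNIV. v i $ p i)\<bar>)"
    unfolding rowdet_def det_def by (rule order_trans[OF sum_abs]) simp
  also have "\<dots> \<le> (\<Sum>p\<in>?P. (\<Prod>k\<in>UNIV. infnorm (v k)))"
  proof (rule sum_mono)
    fix p
    have "\<bar>\<Prod>i\<in>UNIV. v i $ p i\<bar> \<le> (\<Prod>k\<in>UNIV. infnorm (v k))"
      unfolding abs_prod by (intro prod_mono) (auto simp: component_le_infnorm_cart)
    then show "\<bar>of_int (sign p) * (\<Prod>i\<in>UNIV. v i $ p i)\<bar> \<le> (\<Prod>k\<in>UNIV. infnorm (v k))"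
      by (simp add: abs_mult sign_def)
  qed
  also have "\<dots> = fact CARD('r) * (\<Prod>k\<in>UNIV. infnorm (v k))"
    by (simp add: card_permutations)
  finally show ?thesis .
qed

subsection \<open>Minors of a family of vectors\<close>

text \<open>The rows outside \<open>I\<close> are unit vectors; \<open>minor I v f\<close> is up to sign the minor of \<open>(v k)\<^sub>k\<^sub>\<in>\<^sub>I\<close> on
  the coordinates that \<open>f\<close> does not hit.\<close>

definition padded :: "'r set \<Rightarrow> ('r \<Rightarrow> real ^ 'r) \<Rightarrow> ('r \<Rightarrow> 'r) \<Rightarrow> 'r \<Rightarrow> real ^ 'r" where
  "padded I v f k = (if k \<in> I then v k else axis (f k) 1)"

definition minor :: "'r::finite set \<Rightarrow> ('r \<Rightarrow> real ^ 'r) \<Rightarrow> ('r \<Rightarrow> 'r) \<Rightarrow> real" where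
  "minor I v f = rowdet (padded I v f)"

definition wnorm :: "'r::finite set \<Rightarrow> ('r \<Rightarrow> real ^ 'r) \<Rightarrow> real" where
  "wnorm I v = Max (range (\<lambda>f. \<bar>minor I v f\<bar>))"

lemma finite_range_minor: "finite (range (\<lambda>f. \<bar>minor I v f\<bar>))"
  by simp

lemma minor_le_wnorm: "\<bar>minor I v f\<bar> \<le> wnorm I v"
  unfolding wnorm_def by (rule Max_ge) auto

lemma wnorm_le_iff: "wnorm I v \<le> c \<longleftrightarrow> (\<forall>f. \<bar>minor I v f\<bar> \<le> c)"
  unfolding wnorm_def by (subst Max_le_iff) auto

lemma wnorm_attained: obtains f where "wnorm I v = \<bar>minor I v f\<bar>"
  using Max_in[OF finite_range_minor[of I v]] unfolding wnorm_def by (metis (no_types, lifting) UNIV_not_empty image_iff image_is_empty)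

lemma wnorm_nonneg: "0 \<le> wnorm I v"
  using minor_le_wnorm[of I v id] by linarith

lemma wnorm_pos_iff: "0 < wnorm I v \<longleftrightarrow> (\<exists>f. minor I v f \<noteq> 0)"
  by (metis abs_le_zero_iff linorder_not_less wnorm_le_iff)

lemma wnorm_cong: "(\<And>k. k \<in> I \<Longrightarrow> v k = w k) \<Longrightarrow> wnorm I v = wnorm I w"
proof -
  assume "\<And>k. k \<in> I \<Longrightarrow> v k = w k"
  then have "padded I v f = padded I w f" for f by (auto simp: padded_def fun_eq_iff)
  then show ?thesis by (simp add: wnorm_def minor_def)
qed

lemma wnorm_le_prod:
  fixes v :: "'r::finite \<Rightarrow> real ^ 'r"
  shows "wnorm I v \<le> fact CARD('r) * (\<Prod>k\<in>I. infnorm (v k))"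
proof -
  have "\<bar>minor I v f\<bar> \<le> fact CARD('r) * (\<Prod>k\<in>I. infnorm (v k))" for f
  proof -
    have "(\<Prod>k\<in>UNIV. infnorm (padded I v f k)) = (\<Prod>k\<in>I. infnorm (padded I v f k)) * (\<Prod>k\<in>-I. infnorm (padded I v f k))"
      by (metis Compl_partition finite_class.finite_UNIV finite_subset inf_compl_bot prod.union_disjoint subset_UNIV)
    also have "\<dots> \<le> (\<Prod>k\<in>I. infnorm (padded I v f k)) * 1"
      by (intro mult_left_mono prod_le_1 prod_nonneg) (auto simp: padded_def infnorm_pos_le infnorm_axis)
    also have "\<dots> = (\<Prod>k\<in>I. infnorm (v k))" by (simp add: padded_def)
    finally show ?thesis
      unfolding minor_def using rowdet_le[of "padded I v f"]
      by (meson fact_ge_zero mult_left_mono order_trans)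
  qed
  then show ?thesis by (simp add: wnorm_le_iff)
qed

text \<open>The coefficient matrix is extended by the identity outside \<open>I\<close>, and
  \<open>\<rho>\<close> is its determinant. It depends neither on \<open>h\<close> nor on
  \<open>f\<close>, so the two wedges stay proportional under every linear map.\<close>

lemma minor_comb:
  fixes v :: "'r::finite \<Rightarrow> real ^ 'r"
  assumes "\<And>k. k \<in> I \<Longrightarrow> w k = (\<Sum>c\<in>I. Q k c *\<^sub>R v c)"
  shows "\<exists>\<rho>. \<forall>h f. linear h \<longrightarrow> minor I (h \<circ> w) f = \<rho> * minor I (h \<circ> v) f"
proof -
  define P where "P k c = (if k \<in> I then (if c \<in> I then Q k c else 0) else (if c = k then 1 else 0))" for k c
  have "minor I (h \<circ> w) f = det (\<chi> k c. P k c) * minor I (h \<circ> v) f" if h: "linear h" for h f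
  proof -
    have "padded I (h \<circ> w) f = (\<lambda>k. \<Sum>c\<in>UNIV. P k c *\<^sub>R padded I (h \<circ> v) f c)"
    proof
      fix k
      show "padded I (h \<circ> w) f k = (\<Sum>c\<in>UNIV. P k c *\<^sub>R padded I (h \<circ> v) f c)"
      proof (cases "k \<in> I")
        case True
        have "(\<Sum>c\<in>UNIV. P k c *\<^sub>R padded I (h \<circ> v) f c) = (\<Sum>c\<in>I. Q k c *\<^sub>R h (v c))"
          using True by (intro sum.mono_neutral_cong_right) (auto simp: P_def padded_def)
        also have "\<dots> = h (w k)" using h assms[OF True] by (simp add: linear_sum linear_scale)
        finally show ?thesis using True by (simp add: padded_def)
      next
        case False
        have "(\<Sum>c\<in>UNIV. P k c *\<^sub>R padded I (h \<circ> v) f c) = (\<Sum>c\<in>{k}. padded I (h \<circ> v) f c)"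
          using False by (intro sum.mono_neutral_cong_right) (auto simp: P_def)
        then show ?thesis using False by (simp add: padded_def)
      qed
    qed
    then show ?thesis by (simp add: minor_def rowdet_comb)
  qed
  then show ?thesis by blast
qed

text \<open>Expand \<open>u\<close> in the basis formed by \<open>w\<close> on \<open>I\<close> and
  the unit rows of a nonzero minor: the coefficient of a unit row is a quotient of minors whose
  numerator belongs to the tuple enlarged by \<open>u\<close>.\<close>

lemma span_of_no_extension:
  fixes w :: "'r::finite \<Rightarrow> real ^ 'r"
  assumes "0 < wnorm I w" and "\<And>k. k \<notin> I \<Longrightarrow> wnorm (insert k I) (upd w k u) = 0"
  shows "\<exists>c. u = (\<Sum>b\<in>I. c b *\<^sub>R w b)"
proof -
  obtain f where f: "rowdet (padded I w f) \<noteq> 0"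
    using assms(1) by (auto simp: wnorm_pos_iff minor_def)
  let ?c = "\<lambda>k. rowdet (upd (padded I w f) k u) / rowdet (padded I w f)"
  have "?c k = 0" if "k \<notin> I" for k
  proof -
    have "(upd (padded I w f) k u) = padded (insert k I) (upd w k u) f"
      using that by (auto simp: padded_def fun_eq_iff upd_apply)
    then show ?thesis
      using minor_le_wnorm[of "insert k I" "upd w k u" f] assms(2)[OF that] by (simp add: minor_def)
  qed
  then have "(\<Sum>k\<in>UNIV. ?c k *\<^sub>R padded I w f k) = (\<Sum>k\<in>I. ?c k *\<^sub>R w k)"
    by (intro sum.mono_neutral_cong_right) (auto simp: padded_def)
  then show ?thesis using rowdet_expand[OF f, of u] by metis
qed

text \<open>Laplace expansion along the row \<open>w k\<close>: some unit vector in its place keeps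
  the determinant nonzero.\<close>

lemma wnorm_remove:
  fixes w :: "'r::finite \<Rightarrow> real ^ 'r"
  assumes "0 < wnorm I w" "k \<in> I"
  shows "0 < wnorm (I - {k}) w"
proof -
  obtain f where f: "rowdet (padded I w f) \<noteq> 0"
    using assms(1) by (auto simp: wnorm_pos_iff minor_def)
  have wk: "w k = (\<Sum>r\<in>UNIV. (w k $ r) *\<^sub>R axis r 1)"
    using basis_expansion[of "w k"] by (simp add: scalar_mult_eq_scaleR)
  have "padded I w f = (upd (padded I w f) k (\<Sum>r\<in>UNIV. (w k $ r) *\<^sub>R axis r 1))"
    using wk assms(2) by (auto simp: padded_def fun_eq_iff upd_apply)
  then have "rowdet (padded I w f) = (\<Sum>r\<in>UNIV. w k $ r * rowdet (upd (padded I w f) k (axis r 1)))"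
    by (metis (no_types, lifting) rowdet_scale rowdet_sum sum.cong)
  then obtain r where "rowdet (upd (padded I w f) k (axis r 1)) \<noteq> 0"
    using f by (metis (no_types, lifting) mult_zero_right sum.neutral)
  moreover have "(upd (padded I w f) k (axis r 1)) = padded (I - {k}) w (upd f k r)"
    by (auto simp: padded_def fun_eq_iff upd_apply)
  ultimately show ?thesis by (auto simp: wnorm_pos_iff minor_def)
qed

text \<open>Subsets of \<open>'r\<close> stand for ranks, so tuples of one rank may sit on different
  index sets. A bijection between the sets extends to a permutation of all rows, which only changes
  signs.\<close>

lemma wnorm_reindex:
  fixes w :: "'r::finite \<Rightarrow> real ^ 'r"
  assumes "bij_betw \<sigma> I' I"
  shows "wnorm I' (w \<circ> \<sigma>) = wnorm I w"
proof -
  have "card I' = card I" using assms by (rule bij_betw_same_card)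
  then have "card (- I') = card (- I)" by (simp add: Compl_eq_Diff_UNIV card_Diff_subset)
  then obtain \<tau> where \<tau>: "bij_betw \<tau> (- I') (- I)"
    by (metis finite finite_same_card_bij)
  define \<pi> where "\<pi> k = (if k \<in> I' then \<sigma> k else \<tau> k)" for k
  have "bij_betw \<pi> (I' \<union> - I') (I \<union> - I)"
  proof (rule bij_betw_combine)
    show "bij_betw \<pi> I' I" using assms by (simp add: \<pi>_def cong: bij_betw_cong)
    show "bij_betw \<pi> (- I') (- I)" using \<tau> by (subst bij_betw_cong[of _ _ \<tau>]) (auto simp: \<pi>_def)
  qed simp
  then have bij: "bij \<pi>" by simp
  then have perm: "\<pi> permutes UNIV" unfolding permutes_def by (metis UNIV_I bij_pointE)
  have inI: "\<pi> k \<in> I \<longleftrightarrow> k \<in> I'" for k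
    using assms \<tau> by (auto simp: \<pi>_def bij_betw_def)
  have eq: "\<bar>minor I' (w \<circ> \<sigma>) (f \<circ> \<pi>)\<bar> = \<bar>minor I w f\<bar>" for f
  proof -
    have "padded I' (w \<circ> \<sigma>) (f \<circ> \<pi>) = padded I w f \<circ> \<pi>"
      using inI by (auto simp: padded_def fun_eq_iff) (auto simp: \<pi>_def)
    then show ?thesis unfolding minor_def using rowdet_permute[OF perm] by metis
  qed
  have "\<exists>g. f = g \<circ> \<pi>" for f :: "'r \<Rightarrow> 'r"
    by (rule exI[of _ "f \<circ> inv \<pi>"]) (use bij in \<open>auto simp: fun_eq_iff bij_is_inj\<close>)
  then show ?thesis
    by (intro antisym) (metis eq minor_le_wnorm wnorm_le_iff)+
qed

subsection \<open>Reduction of lattice bases\<close>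

text \<open>Products of elementary integer matrices. They preserve every minor on \<open>I\<close>
  exactly and keep the rows in any set closed under integer combinations.\<close>

inductive row_moves :: "'r set \<Rightarrow> ('r \<Rightarrow> real ^ 'n) \<Rightarrow> ('r \<Rightarrow> real ^ 'n) \<Rightarrow> bool" for I v where
  refl: "row_moves I v v"
| step: "row_moves I v w \<Longrightarrow> k \<in> I \<Longrightarrow> l \<in> I \<Longrightarrow> k \<noteq> l
    \<Longrightarrow> row_moves I v (upd w k (w k + of_int z *\<^sub>R w l))"

lemma row_moves_trans: "row_moves I w x \<Longrightarrow> row_moves I v w \<Longrightarrow> row_moves I v x"
  by (induction rule: row_moves.induct) (auto intro: row_moves.intros)

lemma row_moves_mono: "row_moves I v w \<Longrightarrow> I \<subseteq> J \<Longrightarrow> row_moves J v w"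
  by (induction rule: row_moves.induct) (auto intro: row_moves.intros)

lemma row_moves_outside: "row_moves I v w \<Longrightarrow> k \<notin> I \<Longrightarrow> w k = v k"
  by (induction rule: row_moves.induct) (auto simp: upd_apply)

lemma minor_row_moves: "row_moves I v w \<Longrightarrow> minor I w f = minor I v f"
proof (induction rule: row_moves.induct)
  case (step w k l z)
  have "padded I (upd w k (w k + of_int z *\<^sub>R w l)) f
    = upd (padded I w f) k (padded I w f k + of_int z *\<^sub>R padded I w f l)"
    using step.hyps by (auto simp: padded_def fun_eq_iff upd_apply)
  then show ?case using step by (simp add: minor_def rowdet_add_row)
qed simp

lemma wnorm_row_moves: "row_moves I v w \<Longrightarrow> wnorm I w = wnorm I v"
  by (simp add: wnorm_def minor_row_moves)

lemma row_moves_subgroup: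
  assumes "row_moves I v w" "\<And>k. k \<in> I \<Longrightarrow> v k \<in> L"
    and "\<And>x y z. x \<in> L \<Longrightarrow> y \<in> L \<Longrightarrow> x + of_int z *\<^sub>R y \<in> L"
  shows "k \<in> I \<Longrightarrow> w k \<in> L"
  using assms(1) by (induction arbitrary: k rule: row_moves.induct) (auto simp: upd_apply assms(2,3))

text \<open>The same integers are used upstairs, so a reduction of a projected basis lifts to the
  basis itself.\<close>

lemma row_moves_lift:
  assumes "row_moves I (\<lambda>k. h (v k)) y'" "linear h"
  shows "\<exists>y. row_moves I v y \<and> (\<forall>k. h (y k) = y' k)"
  using assms(1)
proof (induction rule: row_moves.induct)
  case refl
  then show ?case by (auto intro: row_moves.refl)
next
  case (step w k l z)
  then obtain y where y: "row_moves I v y" "\<And>k. h (y k) = w k" by blast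
  have "row_moves I v (upd y k (y k + of_int z *\<^sub>R y l))"
    using y(1) step.hyps by (auto intro: row_moves.step)
  moreover have "h (upd y k (y k + of_int z *\<^sub>R y l) j) = upd w k (w k + of_int z *\<^sub>R w l) j" for j
    using y(2) assms(2) by (simp add: upd_apply linear_add linear_scale)
  ultimately show ?case by blast
qed

lemma row_moves_add_one:
  fixes y :: "'r::finite \<Rightarrow> real ^ 'n"
  assumes "S \<subseteq> I - {k0}" "k0 \<in> I"
  shows "row_moves I y (\<lambda>k. if k \<in> S then y k + of_int (t k) *\<^sub>R y k0 else y k)"
proof -
  have "finite S" by simp
  then show ?thesis using assms(1)
  proof (induction S rule: finite_induct)
    case empty
    then show ?case by (simp add: row_moves.refl)
  next
    case (insert a F)
    let ?w = "\<lambda>k. if k \<in> F then y k + of_int (t k) *\<^sub>R y k0 else y k"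
    have "row_moves I y (upd ?w a (?w a + of_int (t a) *\<^sub>R ?w k0))"
      using insert assms(2) by (intro row_moves.step) auto
    moreover have "upd ?w a (?w a + of_int (t a) *\<^sub>R ?w k0)
      = (\<lambda>k. if k \<in> insert a F then y k + of_int (t k) *\<^sub>R y k0 else y k)"
      using insert by (intro ext) (auto simp: upd_apply)
    ultimately show ?case by simp
  qed
qed

text \<open>Discreteness of the lattice, read off from minors: a row reached by moves is a nonzero
  integer combination of the \<open>v l\<close>. Put in the place of some \<open>v l\<close> with
  nonzero coefficient, it multiplies a maximal minor by a nonzero integer, and the Hadamard-type
  bound then forbids it to be short.\<close>

lemma row_moves_bounded_below:
  fixes v :: "'r::finite \<Rightarrow> real ^ 'r"
  assumes "0 < wnorm I v"
  shows "\<exists>c>0. \<forall>w. row_moves I v w \<longrightarrow> (\<forall>k\<in>I. c \<le> infnorm (w k))"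
proof -
  define P where "P = fact CARD('r) * (\<Prod>k\<in>I. 1 + infnorm (v k))"
  have P: "P > 0" unfolding P_def by (intro mult_pos_pos prod_pos) (auto simp: add_pos_nonneg infnorm_pos_le)
  have "wnorm I v / P \<le> infnorm (w k)" if w: "row_moves I v w" and k: "k \<in> I" for w k
  proof -
    let ?L = "{x. \<exists>n::'r \<Rightarrow> int. x = (\<Sum>l\<in>I. of_int (n l) *\<^sub>R v l)}"
    have "w k \<in> ?L"
    proof (rule row_moves_subgroup[OF w _ _ k])
      fix k assume "k \<in> I"
      then have "(\<Sum>l\<in>I. of_int (if l = k then 1 else 0) *\<^sub>R v l) = (\<Sum>l\<in>{k}. v l)"
        by (intro sum.mono_neutral_cong_right) auto
      then show "v k \<in> ?L" by (auto intro!: exI[of _ "\<lambda>l. if l = k then 1 else 0"])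
    next
      fix x y :: "real ^ 'r" and z :: int
      assume "x \<in> ?L" "y \<in> ?L"
      then obtain n m :: "'r \<Rightarrow> int" where "x = (\<Sum>l\<in>I. of_int (n l) *\<^sub>R v l)" "y = (\<Sum>l\<in>I. of_int (m l) *\<^sub>R v l)"
        by blast
      then have "x + of_int z *\<^sub>R y = (\<Sum>l\<in>I. of_int (n l + z * m l) *\<^sub>R v l)"
        by (simp add: scaleR_add_left sum.distrib scaleR_sum_right)
      then show "x + of_int z *\<^sub>R y \<in> ?L"
        by (intro CollectI exI[of _ "\<lambda>l. n l + z * m l"])
    qed
    then obtain n :: "'r \<Rightarrow> int" where n: "w k = (\<Sum>l\<in>I. of_int (n l) *\<^sub>R v l)" by blast
    have "\<exists>l\<in>I. n l \<noteq> 0"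
    proof (rule ccontr)
      assume "\<not> ?thesis"
      then have "w k = 0" using n by simp
      then have "minor I w f = 0" for f
        using k rowdet_zero[of "padded I w f" k] upd_triv[of "padded I w f" k]
        by (simp add: minor_def padded_def)
      then show False using assms unfolding wnorm_row_moves[OF w, symmetric] wnorm_pos_iff by simp
    qed
    then obtain l where l: "l \<in> I" "n l \<noteq> 0" by blast
    obtain f where f: "wnorm I v = \<bar>minor I v f\<bar>" by (rule wnorm_attained)
    have "minor I (upd v l (w k)) f = rowdet (upd (padded I v f) l (\<Sum>c\<in>I. of_int (n c) *\<^sub>R v c))"
    proof -
      have "padded I (upd v l (w k)) f = upd (padded I v f) l (w k)"
        using l by (intro ext) (auto simp: padded_def upd_apply)
      then show ?thesis by (simp add: minor_def n)
    qed
    also have "\<dots> = (\<Sum>c\<in>I. of_int (n c) * rowdet (upd (padded I v f) l (v c)))"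
      unfolding rowdet_sum rowdet_scale ..
    also have "\<dots> = (\<Sum>c\<in>{l}. of_int (n c) * rowdet (upd (padded I v f) l (v c)))"
    proof (intro sum.mono_neutral_right)
      show "\<forall>i\<in>I - {l}. of_int (n i) * rowdet (upd (padded I v f) l (v i)) = 0"
      proof
        fix i assume i: "i \<in> I - {l}"
        then have "rowdet (upd (padded I v f) l (v i)) = 0"
          by (intro rowdet_eq_0[of i l]) (auto simp: padded_def upd_apply)
        then show "of_int (n i) * rowdet (upd (padded I v f) l (v i)) = 0" by simp
      qed
    qed (use l in auto)
    also have "\<dots> = of_int (n l) * minor I v f"
    proof -
      have "upd (padded I v f) l (v l) = padded I v f"
        using l by (intro ext) (auto simp: padded_def upd_apply)
      then show ?thesis by (simp add: minor_def)
    qed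
    finally have "\<bar>minor I (upd v l (w k)) f\<bar> = of_int \<bar>n l\<bar> * wnorm I v" using f by (simp add: abs_mult)
    moreover have "1 * wnorm I v \<le> of_int \<bar>n l\<bar> * wnorm I v"
      using l(2) by (intro mult_right_mono wnorm_nonneg) linarith
    moreover have "\<bar>minor I (upd v l (w k)) f\<bar> \<le> P * infnorm (w k)"
    proof -
      have "(\<Prod>k'\<in>I. infnorm (upd v l (w k) k')) = infnorm (w k) * (\<Prod>k'\<in>I-{l}. infnorm (v k'))"
        using l(1) by (subst prod.remove[of _ l]) (auto simp: upd_apply intro!: prod.cong)
      also have "\<dots> \<le> infnorm (w k) * (\<Prod>k'\<in>I-{l}. 1 + infnorm (v k'))"
        by (intro mult_left_mono prod_mono) (auto simp: infnorm_pos_le)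
      also have "\<dots> \<le> infnorm (w k) * (\<Prod>k'\<in>I. 1 + infnorm (v k'))"
      proof (intro mult_left_mono infnorm_pos_le)
        have "0 \<le> (\<Prod>k'\<in>I-{l}. 1 + infnorm (v k'))"
          by (intro prod_nonneg) (simp add: infnorm_pos_le)
        then have "1 * (\<Prod>k'\<in>I-{l}. 1 + infnorm (v k')) \<le> (1 + infnorm (v l)) * (\<Prod>k'\<in>I-{l}. 1 + infnorm (v k'))"
          by (intro mult_right_mono) (simp_all add: infnorm_pos_le)
        also have "\<dots> = (\<Prod>k'\<in>I. 1 + infnorm (v k'))" using l(1) by (subst (2) prod.remove[of _ l]) auto
        finally show "(\<Prod>k'\<in>I-{l}. 1 + infnorm (v k')) \<le> (\<Prod>k'\<in>I. 1 + infnorm (v k'))" by simp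
      qed
      finally have "(\<Prod>k'\<in>I. infnorm (upd v l (w k) k')) \<le> infnorm (w k) * (\<Prod>k'\<in>I. 1 + infnorm (v k'))" .
      then have "fact CARD('r) * (\<Prod>k'\<in>I. infnorm (upd v l (w k) k')) \<le> P * infnorm (w k)"
        by (simp add: P_def mult_ac)
      then show ?thesis
        using minor_le_wnorm[of I "upd v l (w k)" f] wnorm_le_prod[of I "upd v l (w k)"] by linarith
    qed
    ultimately have "wnorm I v \<le> P * infnorm (w k)" by linarith
    then show ?thesis using P by (simp add: field_simps)
  qed
  then show ?thesis using assms P by (intro exI[of _ "wnorm I v / P"]) simp
qed

text \<open>The projection along \<open>u\<close> onto the hyperplane where coordinate
  \<open>r\<close> vanishes. It is used with \<open>r\<close> a largest coordinate of
  \<open>u\<close>, which suits the sup-norm better than an orthogonal projection.\<close>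

definition drop_along :: "real ^ 'n \<Rightarrow> 'n \<Rightarrow> real ^ 'n \<Rightarrow> real ^ 'n" where
  "drop_along u r x = x - (x $ r / u $ r) *\<^sub>R u"

lemma linear_drop_along: "linear (drop_along u r)"
  by (rule linearI) (simp_all add: drop_along_def algebra_simps add_divide_distrib)

lemma drop_along_nth: "u $ r \<noteq> 0 \<Longrightarrow> drop_along u r x $ r = 0"
  by (simp add: drop_along_def)

lemma minor_drop_along:
  fixes w :: "'r::finite \<Rightarrow> real ^ 'r"
  assumes "k0 \<in> I"
  shows "minor I (upd (\<lambda>k. drop_along (w k0) r (w k)) k0 (w k0)) f = minor I w f"
proof -
  let ?S = "I - {k0}"
  let ?x = "\<lambda>k. - (w k $ r / w k0 $ r) *\<^sub>R w k0"
  have "padded I (upd (\<lambda>k. drop_along (w k0) r (w k)) k0 (w k0)) f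
    = (\<lambda>k. if k \<in> ?S then padded I w f k + ?x k else padded I w f k)"
    by (intro ext) (auto simp: padded_def upd_apply drop_along_def)
  moreover have "rowdet (\<lambda>k. if k \<in> ?S then padded I w f k + ?x k else padded I w f k) = rowdet (padded I w f)"
  proof (rule rowdet_span_set)
    fix k
    have "w k0 \<in> padded I w f ` (- ?S)"
      using assms by (intro image_eqI[of _ _ k0]) (auto simp: padded_def)
    then show "?x k \<in> span (padded I w f ` (- ?S))" by (intro span_scale span_base)
  qed
  ultimately show ?thesis by (simp add: minor_def)
qed

text \<open>Coordinate \<open>r\<close> vanishes on the projected family, so a nonzero minor of it
  must have \<open>axis r 1\<close> among its unit rows. Exchanging that row for \<open>w k0\<close>
  multiplies the determinant by \<open>w k0 $ r\<close> and produces a minor of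
  \<open>w\<close>.\<close>

lemma wnorm_drop_along:
  fixes w :: "'r::finite \<Rightarrow> real ^ 'r"
  assumes k0: "k0 \<in> I" and r: "w k0 $ r \<noteq> 0"
  shows "\<bar>w k0 $ r\<bar> * wnorm (I - {k0}) (\<lambda>k. drop_along (w k0) r (w k)) \<le> wnorm I w"
proof -
  let ?h = "drop_along (w k0) r"
  let ?v = "\<lambda>k. ?h (w k)"
  have "\<bar>w k0 $ r\<bar> * \<bar>minor (I - {k0}) ?v f\<bar> \<le> wnorm I w" for f
  proof (cases "\<exists>k1. k1 \<notin> I - {k0} \<and> f k1 = r")
    case False
    have "padded (I - {k0}) ?v f k $ r = 0" for k
      using False drop_along_nth[OF r] by (auto simp: padded_def axis_def)
    then have "minor (I - {k0}) ?v f = 0" unfolding minor_def by (rule rowdet_zero_column)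
    then show ?thesis by (simp add: wnorm_nonneg)
  next
    case True
    then obtain k1 where k1: "k1 \<notin> I - {k0}" "f k1 = r" by blast
    \<comment> \<open>The transposition brings the unit row \<open>axis r 1\<close> to position
      \<open>k0\<close>, where \<open>w k0\<close> is to be inserted.\<close>
    define \<sigma> where "\<sigma> = Transposition.transpose k0 k1"
    define p where "p = padded (I - {k0}) ?v f"
    define q where "q = p \<circ> \<sigma>"
    have \<sigma>: "\<sigma> permutes UNIV" unfolding \<sigma>_def by (rule permutes_swap_id) auto
    have qp: "\<bar>rowdet q\<bar> = \<bar>rowdet p\<bar>" unfolding q_def by (rule rowdet_permute[OF \<sigma>])
    have qk0: "q k0 = axis r 1" using k1 by (auto simp: q_def \<sigma>_def p_def padded_def)
    show ?thesis
    proof (cases "\<exists>k. k \<noteq> k0 \<and> q k $ r \<noteq> 0")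
      case True
      then obtain k where k: "k \<noteq> k0" "q k $ r \<noteq> 0" by blast
      have "q k = axis r 1"
        using k(2) drop_along_nth[OF r] by (auto simp: q_def p_def padded_def axis_def split: if_splits)
      then have "rowdet q = 0" using k qk0 by (intro rowdet_eq_0[of k k0]) auto
      then show ?thesis using qp by (simp add: minor_def p_def wnorm_nonneg)
    next
      case False
      define z where "z = w k0 - (w k0 $ r) *\<^sub>R axis r 1"
      have z: "rowdet (upd q k0 z) = 0"
        by (rule rowdet_zero_column[of _ r]) (use False in \<open>auto simp: upd_apply z_def\<close>)
      have "w k0 = (w k0 $ r) *\<^sub>R axis r 1 + z" by (simp add: z_def)
      then have "rowdet (upd q k0 (w k0)) = w k0 $ r * rowdet (upd q k0 (axis r 1)) + rowdet (upd q k0 z)"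
        using rowdet_add[of q k0 "(w k0 $ r) *\<^sub>R axis r 1" z] unfolding rowdet_scale by simp
      also have "\<dots> = w k0 $ r * rowdet q" using z qk0 by (metis add.right_neutral upd_triv)
      finally have 1: "rowdet (upd q k0 (w k0)) = w k0 $ r * rowdet q" .
      have "upd q k0 (w k0) = padded I (upd ?v k0 (w k0)) (f \<circ> \<sigma>)"
        using k0 k1 by (intro ext) (auto simp: upd_apply q_def p_def padded_def \<sigma>_def Transposition.transpose_def)
      then have "rowdet (upd q k0 (w k0)) = minor I w (f \<circ> \<sigma>)"
        using minor_drop_along[OF k0, of w r "f \<circ> \<sigma>"] by (simp add: minor_def)
      then have "\<bar>w k0 $ r\<bar> * \<bar>rowdet q\<bar> \<le> wnorm I w"
        using 1 minor_le_wnorm[of I w "f \<circ> \<sigma>"] by (simp add: abs_mult[symmetric])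
      then show ?thesis unfolding qp by (simp add: minor_def p_def)
    qed
  qed
  then have "\<bar>minor (I - {k0}) ?v f\<bar> \<le> wnorm I w / \<bar>w k0 $ r\<bar>" for f
    using r by (simp add: field_simps)
  then have "wnorm (I - {k0}) ?v \<le> wnorm I w / \<bar>w k0 $ r\<bar>" by (simp add: wnorm_le_iff)
  then show ?thesis using r by (simp add: field_simps)
qed

text \<open>Induction on the rank: take an almost shortest vector \<open>u\<close> among all bases, reduce the projection
  along \<open>u\<close>, and lift with the coordinate of \<open>u\<close> rounded; minimality of \<open>u\<close> keeps the lifts comparable
  to their projections.\<close>

lemma reduced_basis:
  fixes v :: "'r::finite \<Rightarrow> real ^ 'r"
  assumes "0 < wnorm I v"
  shows "\<exists>w. row_moves I v w \<and> (\<Prod>k\<in>I. infnorm (w k)) \<le> 3 ^ (card I * card I) * wnorm I v"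
  using assms
proof (induction "card I" arbitrary: I v)
  case 0
  then have I: "I = {}" by simp
  have "minor {} v id = 1" by (simp add: minor_def padded_def[abs_def] rowdet_axis)
  then have "1 \<le> wnorm {} v" using minor_le_wnorm[of "{}" v id] by simp
  then show ?case using I by (auto intro: row_moves.refl)
next
  case (Suc n)
  have "I \<noteq> {}" using Suc.hyps(2) by auto
  obtain c where c: "c > 0" "\<And>w k. row_moves I v w \<Longrightarrow> k \<in> I \<Longrightarrow> c \<le> infnorm (w k)"
    using row_moves_bounded_below[OF Suc.prems] by blast
  define X where "X = {infnorm (w k) | w k. row_moves I v w \<and> k \<in> I}"
  have X: "X \<noteq> {}" "bdd_below X"
  proof -
    show "X \<noteq> {}" using \<open>I \<noteq> {}\<close> row_moves.refl[of I v] unfolding X_def by blast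
    show "bdd_below X" using c(2) by (intro bdd_belowI[of _ c]) (auto simp: X_def)
  qed
  have "c \<le> Inf X" using c(2) X by (intro cInf_greatest) (auto simp: X_def)
  \<comment> \<open>Any slack below 2 would do: with the rounding error 1/2, the slack 4/3 gives a
    bound of the form \<open>z \<le> y' + 2 / 3 * z\<close>, hence the factor 3 for each lifted
    vector.\<close>
  then have "Inf X < 4 / 3 * Inf X" using c(1) by simp
  then obtain x where x: "x \<in> X" "x < 4 / 3 * Inf X" using cInf_lessD[OF X(1)] by blast
  then obtain w k0 where w: "row_moves I v w" "k0 \<in> I" and x': "x = infnorm (w k0)" by (auto simp: X_def)
  have min: "infnorm (w k0) \<le> 4 / 3 * infnorm (w' k)" if "row_moves I v w'" "k \<in> I" for w' k
  proof -
    have "Inf X \<le> infnorm (w' k)" using that X(2) by (intro cInf_lower) (auto simp: X_def)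
    then show ?thesis using x x' by linarith
  qed
  have "0 < infnorm (w k0)" using c w by (meson less_le_trans)
  obtain r where r: "\<bar>w k0 $ r\<bar> = infnorm (w k0)" by (rule infnorm_attained)
  then have r0: "w k0 $ r \<noteq> 0" using \<open>0 < infnorm (w k0)\<close> by auto
  let ?h = "drop_along (w k0) r"
  let ?J = "I - {k0}"
  have wn: "wnorm I w = wnorm I v" using w(1) by (rule wnorm_row_moves)
  have "wnorm I (upd (\<lambda>k. ?h (w k)) k0 (w k0)) = wnorm I w"
    by (simp add: wnorm_def minor_drop_along[OF w(2)])
  then have "0 < wnorm ?J (upd (\<lambda>k. ?h (w k)) k0 (w k0))"
    using Suc.prems wn w(2) by (intro wnorm_remove) auto
  also have "wnorm ?J (upd (\<lambda>k. ?h (w k)) k0 (w k0)) = wnorm ?J (\<lambda>k. ?h (w k))"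
    by (rule wnorm_cong) (auto simp: upd_apply)
  finally have pos: "0 < wnorm ?J (\<lambda>k. ?h (w k))" .
  have n: "n = card ?J" using Suc.hyps(2) w(2) by simp
  obtain y' where y': "row_moves ?J (\<lambda>k. ?h (w k)) y'"
      "(\<Prod>k\<in>?J. infnorm (y' k)) \<le> 3 ^ (n * n) * wnorm ?J (\<lambda>k. ?h (w k))"
    using Suc.hyps(1)[OF n pos] n by blast
  obtain y where y: "row_moves ?J w y" "\<And>k. ?h (y k) = y' k"
    using row_moves_lift[OF y'(1) linear_drop_along] by blast
  have yk0: "y k0 = w k0" using row_moves_outside[OF y(1)] by simp
  define t where "t k = - round (y k $ r / w k0 $ r)" for k
  define z where "z = (\<lambda>k. if k \<in> ?J then y k + of_int (t k) *\<^sub>R y k0 else y k)"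
  have "row_moves I y z" unfolding z_def using w(2) by (intro row_moves_add_one) auto
  moreover have "row_moves I w y" using y(1) by (rule row_moves_mono) auto
  ultimately have z: "row_moves I v z" using w(1) by (meson row_moves_trans)
  have zle: "infnorm (z k) \<le> 3 * infnorm (y' k)" if k: "k \<in> ?J" for k
  proof -
    let ?a = "y k $ r / w k0 $ r"
    have "z k = y' k + (?a + of_int (t k)) *\<^sub>R w k0"
      using k yk0 by (simp add: z_def y(2)[symmetric] drop_along_def scaleR_add_left)
    then have "infnorm (z k) \<le> infnorm (y' k) + \<bar>?a + of_int (t k)\<bar> * infnorm (w k0)"
      using infnorm_triangle[of "y' k" "(?a + of_int (t k)) *\<^sub>R w k0"] unfolding infnorm_mul by simp
    also have "\<bar>?a + of_int (t k)\<bar> \<le> 1/2"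
      using of_int_round_abs_le[of ?a] by (simp add: t_def abs_minus_commute)
    finally have "infnorm (z k) \<le> infnorm (y' k) + 1/2 * infnorm (w k0)"
      by (simp add: infnorm_pos_le mult_right_mono)
    moreover have "infnorm (w k0) \<le> 4/3 * infnorm (z k)" using min[OF z] k by auto
    ultimately show ?thesis by linarith
  qed
  have "(\<Prod>k\<in>I. infnorm (z k)) = infnorm (w k0) * (\<Prod>k\<in>?J. infnorm (z k))"
    using w(2) yk0 by (subst prod.remove[of _ k0]) (auto simp: z_def)
  also have "\<dots> \<le> infnorm (w k0) * (\<Prod>k\<in>?J. 3 * infnorm (y' k))"
    by (intro mult_left_mono prod_mono) (auto simp: infnorm_pos_le zle)
  also have "\<dots> = infnorm (w k0) * (3 ^ n * (\<Prod>k\<in>?J. infnorm (y' k)))"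
    by (simp add: prod.distrib n)
  also have "\<dots> \<le> infnorm (w k0) * (3 ^ n * (3 ^ (n * n) * wnorm ?J (\<lambda>k. ?h (w k))))"
    using y'(2) by (intro mult_left_mono) (auto simp: infnorm_pos_le)
  also have "\<dots> = 3 ^ n * 3 ^ (n * n) * (\<bar>w k0 $ r\<bar> * wnorm ?J (\<lambda>k. ?h (w k)))" using r by simp
  also have "\<dots> \<le> 3 ^ n * 3 ^ (n * n) * wnorm I w"
    using wnorm_drop_along[where w = w, OF w(2) r0] by (intro mult_left_mono) auto
  also have "\<dots> \<le> 3 ^ (Suc n * Suc n) * wnorm I v"
  proof -
    have "(3::real) ^ n * 3 ^ (n * n) \<le> 3 ^ (Suc n * Suc n)"
      unfolding power_add[symmetric] by (rule power_increasing) auto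
    then show ?thesis unfolding wn by (intro mult_right_mono wnorm_nonneg)
  qed
  finally show ?case using z Suc.hyps(2) by auto
qed

subsection \<open>Heights of lattices\<close>

lemma wnorm_subset:
  fixes w :: "'r::finite \<Rightarrow> real ^ 'r"
  assumes "0 < wnorm J w" "I \<subseteq> J"
  shows "0 < wnorm I w"
proof -
  have "0 < wnorm (J - S) w" if "finite S" "S \<subseteq> J" for S
    using that
  proof (induction S rule: finite_induct)
    case (insert a F)
    then have "0 < wnorm (J - F - {a}) w" by (intro wnorm_remove) auto
    then show ?case by (metis Diff_insert2 Diff_insert)
  qed (use assms in simp)
  from this[of "J - I"] show ?thesis using assms(2) by (simp add: double_diff)
qed

section \<open>Unimodular maps\<close>

definition unimodular :: "(real ^ 'r \<Rightarrow> real ^ 'r) \<Rightarrow> bool" where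
  "unimodular h \<longleftrightarrow> linear h \<and> \<bar>rowdet (\<lambda>r. h (axis r 1))\<bar> = 1"

lemma unimodular_rowdet: "unimodular h \<Longrightarrow> \<bar>rowdet (\<lambda>k. h (v k))\<bar> = \<bar>rowdet v\<bar>"
  by (simp add: unimodular_def rowdet_linear abs_mult)

lemma unimodular_comp:
  assumes "unimodular g" "unimodular h"
  shows "unimodular (g \<circ> h)"
  using assms unimodular_rowdet[OF assms(1), of "\<lambda>r. h (axis r 1)"]
  by (auto simp: unimodular_def intro: linear_compose)

lemma wnorm_unimodular_pos:
  assumes h: "unimodular h" and w: "0 < wnorm I w"
  shows "0 < wnorm I (h \<circ> w)"
proof -
  obtain f where f: "rowdet (padded I w f) \<noteq> 0" using w by (auto simp: wnorm_pos_iff minor_def)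
  let ?p = "\<lambda>k. h (padded I w f k)"
  have "minor UNIV ?p id = rowdet ?p" by (simp add: minor_def padded_def[abs_def])
  then have "minor UNIV ?p id \<noteq> 0" using f unimodular_rowdet[OF h, of "padded I w f"] by auto
  then have "0 < wnorm I ?p" using wnorm_subset[of UNIV ?p I] wnorm_pos_iff by blast
  then show ?thesis by (subst wnorm_cong[of _ _ ?p]) (auto simp: padded_def)
qed

lemma wnorm_UNIV: "wnorm UNIV v = \<bar>rowdet v\<bar>"
proof -
  have "minor UNIV v f = rowdet v" for f by (simp add: minor_def padded_def[abs_def])
  then show ?thesis by (simp add: wnorm_def)
qed

lemma prod_infnorm_pos:
  fixes w :: "'r::finite \<Rightarrow> real ^ 'r"
  assumes "0 < wnorm I w"
  shows "0 < (\<Prod>k\<in>I. infnorm (w k))"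
proof -
  have "0 < fact CARD('r) * (\<Prod>k\<in>I. infnorm (w k))" using assms wnorm_le_prod[of I w] by linarith
  then show ?thesis by (simp add: zero_less_mult_iff)
qed

lemma powr_neg_inverse_cancel: "0 < x \<Longrightarrow> 0 < c \<Longrightarrow> (x powr (- (1 / c))) powr (- c) = (x :: real)"
  by (simp add: powr_powr)

text \<open>\<open>\<phi>\<close> vanishes at both ends because the trivial and the full lattice
  have covolume bounded below; the concavity argument can then step from any intermediate rank to
  both neighbours. The bound \<open>b\<close> controls all exponents \<open>1 / \<phi> i\<close> at
  once.\<close>

locale height =
  fixes L :: "(real ^ 'r::finite) set" and \<phi> :: "nat \<Rightarrow> real" and b :: real
  assumes L_closed: "\<And>x y z. x \<in> L \<Longrightarrow> y \<in> L \<Longrightarrow> x + of_int z *\<^sub>R y \<in> L"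
    and L_covol: "\<And>v. (\<And>k. v k \<in> L) \<Longrightarrow> rowdet v \<noteq> 0 \<Longrightarrow> 1 \<le> \<bar>rowdet v\<bar>"
    and \<phi>_0: "\<phi> 0 = 0" and \<phi>_N: "\<phi> CARD('r) = 0"
    and \<phi>_pos: "\<And>i. 0 < i \<Longrightarrow> i < CARD('r) \<Longrightarrow> 0 < \<phi> i"
    and \<phi>_le: "\<And>i. \<phi> i \<le> 1"
    and \<phi>_concave: "\<And>i. 0 < i \<Longrightarrow> i < CARD('r) \<Longrightarrow> \<phi> (i - 1) + \<phi> (i + 1) \<le> 2 * \<phi> i"
    and b: "\<And>i. 0 < i \<Longrightarrow> i < CARD('r) \<Longrightarrow> 1 / \<phi> i \<le> b"
begin

definition indep_tuple :: "'r set \<Rightarrow> ('r \<Rightarrow> real ^ 'r) \<Rightarrow> bool" where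
  "indep_tuple I w \<longleftrightarrow> I \<noteq> {} \<and> I \<noteq> UNIV \<and> (\<forall>k\<in>I. w k \<in> L) \<and> 0 < wnorm I w"

text \<open>The product of norms stands in for the covolume. It dominates the covolume up to a
  constant, is comparable with it for a reduced basis, and changes transparently when a single
  vector is added or dropped.\<close>

definition tuple_height :: "real \<Rightarrow> 'r set \<Rightarrow> ('r \<Rightarrow> real ^ 'r) \<Rightarrow> real" where
  "tuple_height K I w
    = (K ^ (card I * (CARD('r) - card I)) * (\<Prod>k\<in>I. infnorm (w k))) powr (- (1 / \<phi> (card I)))"

text \<open>The height of the lattice \<open>h ` L\<close>.\<close>

definition lat_height :: "real \<Rightarrow> (real ^ 'r \<Rightarrow> real ^ 'r) \<Rightarrow> ennreal" where
  "lat_height K h = (SUP (I, w) \<in> {(I, w). indep_tuple I w}. ennreal (tuple_height K I (h \<circ> w)))"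

lemma indep_tuple_card:
  assumes "indep_tuple I w"
  shows "0 < card I" "card I < CARD('r)"
  using assms by (auto simp: indep_tuple_def card_gt_0_iff intro!: psubset_card_mono)

lemma tuple_height_le: "indep_tuple I w \<Longrightarrow> ennreal (tuple_height K I (h \<circ> w)) \<le> lat_height K h"
  unfolding lat_height_def by (rule SUP_upper2[of "(I, w)"]) auto

lemma tuple_height_nonneg: "0 \<le> tuple_height K I w"
  by (simp add: tuple_height_def)

lemma b_nonneg: "indep_tuple I w \<Longrightarrow> 0 \<le> b"
  using b[of "card I"] \<phi>_pos[of "card I"] indep_tuple_card[of I w]
  by (meson divide_nonneg_pos order_trans zero_le_one)

lemma tuple_height_lipschitz:
  assumes t: "indep_tuple I w" and h: "unimodular h" "unimodular h'" and \<Lambda>: "1 \<le> \<Lambda>"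
    and lip: "\<And>x. infnorm (h x) \<le> \<Lambda> * infnorm (h' x)" and K: "0 < K"
  shows "tuple_height K I (h' \<circ> w) \<le> \<Lambda> powr (CARD('r) * b) * tuple_height K I (h \<circ> w)"
proof -
  let ?i = "card I"
  let ?c = "K ^ (?i * (CARD('r) - ?i))"
  let ?P = "\<lambda>h. \<Prod>k\<in>I. infnorm ((h \<circ> w) k)"
  note i = indep_tuple_card[OF t]
  have \<phi>: "0 < \<phi> ?i" by (rule \<phi>_pos[OF i])
  have pos: "0 < ?P h" "0 < ?P h'"
    using t h by (simp_all add: prod_infnorm_pos wnorm_unimodular_pos indep_tuple_def del: comp_apply)
  have c: "0 < ?c" using K by simp
  have "?P h \<le> (\<Prod>k\<in>I. \<Lambda> * infnorm ((h' \<circ> w) k))"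
    by (intro prod_mono) (auto simp: infnorm_pos_le lip)
  also have "\<dots> = \<Lambda> ^ ?i * ?P h'" by (simp add: prod.distrib)
  finally have "?c * ?P h / \<Lambda> ^ ?i \<le> ?c * ?P h'" using \<Lambda> c by (simp add: field_simps)
  moreover have "0 < ?c * ?P h / \<Lambda> ^ ?i" using c pos \<Lambda> by simp
  ultimately have "(?c * ?P h') powr (- (1 / \<phi> ?i)) \<le> (?c * ?P h / \<Lambda> ^ ?i) powr (- (1 / \<phi> ?i))"
    using \<phi> by (intro powr_mono2') auto
  also have "\<dots> = (?c * ?P h) powr (- (1 / \<phi> ?i)) * (\<Lambda> ^ ?i) powr (1 / \<phi> ?i)"
    using c pos \<Lambda> by (subst powr_divide) (auto simp: powr_minus field_simps)
  also have "(\<Lambda> ^ ?i) powr (1 / \<phi> ?i) = \<Lambda> powr (?i * (1 / \<phi> ?i))"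
    using \<Lambda> by (simp add: powr_powr flip: powr_realpow)
  also have "(?c * ?P h) powr (- (1 / \<phi> ?i)) * \<Lambda> powr (?i * (1 / \<phi> ?i))
    \<le> (?c * ?P h) powr (- (1 / \<phi> ?i)) * \<Lambda> powr (CARD('r) * b)"
    using \<Lambda> i b[OF i] \<phi> b_nonneg[OF t] by (intro mult_left_mono powr_mono mult_mono) auto
  finally show ?thesis unfolding tuple_height_def by (simp only: mult.commute)
qed

lemma lat_height_lipschitz:
  assumes h: "unimodular h" "unimodular h'" and \<Lambda>: "1 \<le> \<Lambda>"
    and lip: "\<And>x. infnorm (h x) \<le> \<Lambda> * infnorm (h' x)" and K: "0 < K"
  shows "lat_height K h' \<le> ennreal (\<Lambda> powr (CARD('r) * b)) * lat_height K h"
  unfolding lat_height_def[of K h']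
proof (rule SUP_least, clarsimp)
  fix I w assume t: "indep_tuple I w"
  have "ennreal (tuple_height K I (h' \<circ> w)) \<le> ennreal (\<Lambda> powr (CARD('r) * b) * tuple_height K I (h \<circ> w))"
    by (rule ennreal_leI, rule tuple_height_lipschitz[OF t h \<Lambda> lip K])
  also have "\<dots> = ennreal (\<Lambda> powr (CARD('r) * b)) * ennreal (tuple_height K I (h \<circ> w))"
    by (simp add: ennreal_mult tuple_height_nonneg)
  also have "\<dots> \<le> ennreal (\<Lambda> powr (CARD('r) * b)) * lat_height K h"
    by (intro mult_left_mono tuple_height_le t) auto
  finally show "ennreal (tuple_height K I (h' \<circ> w)) \<le> ennreal (\<Lambda> powr (CARD('r) * b)) * lat_height K h" .
qed

text \<open>Read backwards, an upper bound for the height bounds all products from below. The ranks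
  0 and N are included through the empty product and \<open>L_covol\<close>.\<close>

lemma prod_lower_bound:
  assumes h: "unimodular h" and F: "lat_height K h \<le> ennreal F" "1 \<le> F" and K: "1 \<le> K"
    and w: "\<And>k. k \<in> I \<Longrightarrow> w k \<in> L" "0 < wnorm I w"
  shows "F powr (- \<phi> (card I)) \<le> fact CARD('r) * (K ^ (card I * (CARD('r) - card I)) * (\<Prod>k\<in>I. infnorm (h (w k))))"
proof -
  let ?P = "\<Prod>k\<in>I. infnorm (h (w k))"
  have fact1: "1 \<le> (fact CARD('r) :: real)" by (rule fact_ge_1)
  consider "I = {}" | "I = UNIV" | "I \<noteq> {}" "I \<noteq> UNIV" by blast
  then show ?thesis
  proof cases
    case 1
    then show ?thesis using F fact1 by (simp add: \<phi>_0)
  next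
    case 2
    have "rowdet w \<noteq> 0" using w(2) 2 by (auto simp: wnorm_UNIV)
    then have "1 \<le> \<bar>rowdet w\<bar>" using w(1) 2 by (intro L_covol) auto
    also have "\<dots> = \<bar>rowdet (\<lambda>k. h (w k))\<bar>" using unimodular_rowdet[OF h] by simp
    also have "\<dots> \<le> fact CARD('r) * ?P" using rowdet_le[of "\<lambda>k. h (w k)"] 2 by simp
    finally show ?thesis using F 2 by (simp add: \<phi>_N)
  next
    case 3
    then have t: "indep_tuple I w" using w by (simp add: indep_tuple_def)
    let ?i = "card I"
    let ?X = "K ^ (?i * (CARD('r) - ?i)) * ?P"
    have \<phi>: "0 < \<phi> ?i" using \<phi>_pos indep_tuple_card[OF t] by blast
    have "0 < ?P" using prod_infnorm_pos[OF wnorm_unimodular_pos[OF h w(2)]] by simp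
    then have X: "0 < ?X" using K by simp
    have "ennreal (?X powr (- (1 / \<phi> ?i))) \<le> ennreal F"
      using tuple_height_le[OF t, of K h] F(1) unfolding tuple_height_def by (simp add: order_trans)
    then have le: "?X powr (- (1 / \<phi> ?i)) \<le> F" using F(2) by (simp add: ennreal_le_iff2)
    have "0 < ?X powr (- (1 / \<phi> ?i))" using X by (simp only: powr_gt_zero)
    with le have "F powr (- \<phi> ?i) \<le> (?X powr (- (1 / \<phi> ?i))) powr (- \<phi> ?i)"
      using \<phi> by (intro powr_mono2') auto
    also have "\<dots> = ?X" using X \<phi> by (rule powr_neg_inverse_cancel)
    also have "\<dots> \<le> fact CARD('r) * ?X" using fact1 X by (simp add: mult_le_cancel_right1)
    finally show ?thesis .
  qed
qed

text \<open>The factor \<open>K ^ (i * (N - i))\<close> makes the weights strictly concave in the rank \<open>i\<close>. Hence a short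
  vector outside the span of an almost optimal tuple would, added to the tuple or exchanged for its
  longest member, produce a tuple of larger height.\<close>

lemma gap:
  assumes h: "unimodular h" and F: "lat_height K h \<le> ennreal F" "1 \<le> F"
    and \<Theta>: "1 \<le> \<Theta>" and K: "fact CARD('r) * \<Theta> < K"
    and t: "indep_tuple I w" and near: "F / \<Theta> \<le> tuple_height K I (h \<circ> w)"
    and u: "u \<in> L" "m \<in> I" "infnorm (h u) \<le> infnorm (h (w m))"
  shows "\<exists>c. u = (\<Sum>k\<in>I. c k *\<^sub>R w k)"
proof (rule ccontr)
  assume no: "\<not> ?thesis"
  have w: "\<And>k. k \<in> I \<Longrightarrow> w k \<in> L" "0 < wnorm I w" using t by (auto simp: indep_tuple_def)
  obtain k where k: "k \<notin> I" "wnorm (insert k I) (upd w k u) \<noteq> 0"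
    using no span_of_no_extension[OF w(2), of u] by blast
  then have kpos: "0 < wnorm (insert k I) (upd w k u)" using wnorm_nonneg by (simp add: order_less_le)
  have fact1: "1 \<le> (fact CARD('r) :: real)" by (rule fact_ge_1)
  have "1 * 1 \<le> fact CARD('r) * \<Theta>" using fact1 \<Theta> by (intro mult_mono) auto
  then have K1: "1 \<le> K" using K by linarith
  define n where "n = (fact CARD('r) :: real)"
  define i where "i = card I"
  define N where "N = CARD('r)"
  define P where "P = (\<Prod>k\<in>I. infnorm (h (w k)))"
  define Q where "Q = (\<Prod>k\<in>I-{m}. infnorm (h (w k)))"
  note cards = indep_tuple_card[OF t]
  have i: "0 < i" "i < N" using cards by (auto simp: i_def N_def)
  have P: "0 < P" using prod_infnorm_pos[OF wnorm_unimodular_pos[OF h w(2)]] by (simp add: P_def)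
  have "0 < Q" using prod_infnorm_pos[OF wnorm_unimodular_pos[OF h wnorm_remove[OF w(2) u(2)]]] by (simp add: Q_def)
  have QP: "P = infnorm (h (w m)) * Q" unfolding P_def Q_def using u(2) by (intro prod.remove) auto
  have up: "F powr (- \<phi> (i + 1)) \<le> n * (K ^ ((i + 1) * (N - (i + 1))) * (infnorm (h u) * P))"
  proof -
    have "(\<Prod>j\<in>insert k I. infnorm (h (upd w k u j))) = infnorm (h u) * P"
      unfolding P_def using k(1) by (subst prod.insert) (auto simp: upd_apply intro!: prod.cong)
    moreover have "F powr (- \<phi> (card (insert k I))) \<le> fact CARD('r) * (K ^ (card (insert k I) * (CARD('r) - card (insert k I))) * (\<Prod>j\<in>insert k I. infnorm (h (upd w k u j))))"
    proof (rule prod_lower_bound[OF h F K1])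
      show "upd w k u j \<in> L" if "j \<in> insert k I" for j using that w(1) u(1) by (auto simp: upd_apply)
    qed (rule kpos)
    ultimately show ?thesis using k(1) by (simp add: n_def i_def N_def)
  qed
  have down: "F powr (- \<phi> (i - 1)) \<le> n * (K ^ ((i - 1) * (N - (i - 1))) * Q)"
  proof -
    have "F powr (- \<phi> (card (I - {m}))) \<le> fact CARD('r) * (K ^ (card (I - {m}) * (CARD('r) - card (I - {m}))) * (\<Prod>j\<in>I-{m}. infnorm (h (w j))))"
      by (rule prod_lower_bound[OF h F K1]) (use w wnorm_remove[OF w(2) u(2)] in auto)
    then show ?thesis using u(2) by (simp add: n_def i_def N_def Q_def)
  qed
  define X where "X = K ^ (i * (N - i)) * P"
  have X: "0 < X" using K1 P by (simp add: X_def)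
  have \<phi>: "0 < \<phi> i" using \<phi>_pos i by (simp add: N_def)
  have "F / \<Theta> \<le> X powr (- (1 / \<phi> i))"
    using near by (simp add: tuple_height_def X_def i_def N_def P_def)
  then have "(X powr (- (1 / \<phi> i))) powr (- \<phi> i) \<le> (F / \<Theta>) powr (- \<phi> i)"
    using F \<Theta> \<phi> by (intro powr_mono2') auto
  also have "(X powr (- (1 / \<phi> i))) powr (- \<phi> i) = X" using X \<phi> by (simp add: powr_powr)
  also have "(F / \<Theta>) powr (- \<phi> i) = F powr (- \<phi> i) * \<Theta> powr \<phi> i"
    using F \<Theta> by (subst powr_divide) (auto simp: powr_minus field_simps)
  also have "\<dots> \<le> F powr (- \<phi> i) * \<Theta>"
    using powr_mono[OF \<phi>_le[of i] \<Theta>] \<Theta> by (intro mult_left_mono) auto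
  finally have XF: "X \<le> F powr (- \<phi> i) * \<Theta>" .
  \<comment> \<open>The second difference of \<open>i * (N - i)\<close> is -2; this is where the
    decisive factor \<open>K\<^sup>2\<close> comes from.\<close>
  have expo: "(i + 1) * (N - (i + 1)) + (i - 1) * (N - (i - 1)) + 2 = 2 * (i * (N - i))"
  proof -
    obtain j where j: "i = Suc j" using i(1) by (cases i) auto
    obtain c where c: "N = i + 1 + c" using i(2) by (metis Suc_eq_plus1 Suc_leI le_Suc_ex)
    show ?thesis unfolding c j by (simp add: algebra_simps)
  qed
  \<comment> \<open>Concavity compares the product bounds at ranks \<open>i - 1\<close> and
    \<open>i + 1\<close> with the square of the one at rank \<open>i\<close>. As \<open>u\<close> is
    no longer than \<open>w m\<close>, the norms cancel and mainly the powers of \<open>K\<close>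
    differ.\<close>
  have "F powr (- (2 * \<phi> i)) \<le> F powr (- (\<phi> (i - 1) + \<phi> (i + 1)))"
    using \<phi>_concave[of i] i F(2) by (intro powr_mono) (auto simp: N_def)
  also have "\<dots> = F powr (- \<phi> (i + 1)) * F powr (- \<phi> (i - 1))"
    by (simp add: powr_add[symmetric] algebra_simps)
  also have "\<dots> \<le> (n * (K ^ ((i + 1) * (N - (i + 1))) * (infnorm (h u) * P))) * (n * (K ^ ((i - 1) * (N - (i - 1))) * Q))"
    by (intro mult_mono up down order_trans[OF powr_ge_zero up]) auto
  also have "\<dots> = n\<^sup>2 * K ^ ((i + 1) * (N - (i + 1)) + (i - 1) * (N - (i - 1))) * (infnorm (h u) * Q * P)"
    by (simp add: power2_eq_square power_add mult_ac)
  also have "\<dots> \<le> n\<^sup>2 * K ^ ((i + 1) * (N - (i + 1)) + (i - 1) * (N - (i - 1))) * (P * P)"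
  proof (intro mult_left_mono mult_right_mono)
    show "infnorm (h u) * Q \<le> P" unfolding QP using u(3) \<open>0 < Q\<close> by (intro mult_right_mono) auto
  qed (use P K1 in auto)
  finally have "F powr (- (2 * \<phi> i)) * K\<^sup>2 \<le> n\<^sup>2 * K ^ ((i + 1) * (N - (i + 1)) + (i - 1) * (N - (i - 1))) * (P * P) * K\<^sup>2"
    by (rule mult_right_mono) simp
  also have "\<dots> = n\<^sup>2 * K ^ ((i + 1) * (N - (i + 1)) + (i - 1) * (N - (i - 1)) + 2) * (P * P)"
    unfolding power_add by (simp only: mult_ac)
  also have "\<dots> = n\<^sup>2 * X\<^sup>2" unfolding expo X_def by (simp add: power2_eq_square mult_2 power_add)
  also have "\<dots> \<le> n\<^sup>2 * (F powr (- \<phi> i) * \<Theta>)\<^sup>2"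
    using XF X by (intro mult_left_mono power_mono) auto
  also have "\<dots> = F powr (- (2 * \<phi> i)) * (n * \<Theta>)\<^sup>2"
    by (simp add: power2_eq_square mult_ac flip: powr_add)
  finally have "K\<^sup>2 \<le> (n * \<Theta>)\<^sup>2" using F(2) by simp
  moreover have "0 \<le> n * \<Theta>" using \<Theta> by (simp add: n_def)
  ultimately have "K \<le> n * \<Theta>" using K1 by (simp add: power2_le_iff_abs_le)
  then show False using K by (simp add: n_def)
qed

text \<open>Of the two tuples take the one whose longest vector is longer. By \<open>gap\<close>
  every vector of the other tuple lies in its span, and equal ranks make the wedges
  proportional.\<close>

lemma near_optimal_proportional:
  assumes h: "unimodular h" and F: "lat_height K h \<le> ennreal F" "1 \<le> F"
    and \<Theta>: "1 \<le> \<Theta>" and K: "fact CARD('r) * \<Theta> < K"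
    and t: "indep_tuple I w" "F / \<Theta> \<le> tuple_height K I (h \<circ> w)"
    and t': "indep_tuple I' w'" "F / \<Theta> \<le> tuple_height K I' (h \<circ> w')"
    and c: "card I = card I'"
  shows "\<exists>\<rho>. \<forall>g. linear g \<longrightarrow> wnorm I (g \<circ> w) = \<rho> * wnorm I' (g \<circ> w')"
proof -
  have *: "\<exists>\<rho>>0. \<forall>g. linear g \<longrightarrow> wnorm I (g \<circ> w) = \<rho> * wnorm I' (g \<circ> w')"
    if t: "indep_tuple I w" and t': "indep_tuple I' w'" "F / \<Theta> \<le> tuple_height K I' (h \<circ> w')"
      and c: "card I = card I'" and m: "m \<in> I'" "\<And>k. k \<in> I \<Longrightarrow> infnorm (h (w k)) \<le> infnorm (h (w' m))"
    for I w I' w' m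
  proof -
    obtain \<sigma> where \<sigma>: "bij_betw \<sigma> I' I" using c by (metis finite finite_same_card_bij)
    have "\<exists>c. w (\<sigma> k) = (\<Sum>j\<in>I'. c j *\<^sub>R w' j)" if "k \<in> I'" for k
    proof -
      have "\<sigma> k \<in> I" using \<sigma> that by (rule bij_betw_apply)
      then show ?thesis using t m by (intro gap[OF h F \<Theta> K t']) (auto simp: indep_tuple_def)
    qed
    then obtain Q where Q: "\<And>k. k \<in> I' \<Longrightarrow> w (\<sigma> k) = (\<Sum>j\<in>I'. Q k j *\<^sub>R w' j)" by metis
    obtain \<rho> where \<rho>: "\<And>g f. linear g \<Longrightarrow> minor I' (g \<circ> (w \<circ> \<sigma>)) f = \<rho> * minor I' (g \<circ> w') f"
      using minor_comb[of I' "w \<circ> \<sigma>" Q w'] Q by auto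
    have eq: "wnorm I (g \<circ> w) = \<bar>\<rho>\<bar> * wnorm I' (g \<circ> w')" if "linear g" for g
    proof -
      have "wnorm I (g \<circ> w) = wnorm I' ((g \<circ> w) \<circ> \<sigma>)" using wnorm_reindex[OF \<sigma>] by metis
      also have "\<dots> = Max (range (\<lambda>f. \<bar>\<rho>\<bar> * \<bar>minor I' (g \<circ> w') f\<bar>))"
        unfolding wnorm_def using \<rho>[OF that] by (simp add: comp_assoc abs_mult)
      also have "\<dots> = \<bar>\<rho>\<bar> * wnorm I' (g \<circ> w')"
      proof (rule antisym)
        show "Max (range (\<lambda>f. \<bar>\<rho>\<bar> * \<bar>minor I' (g \<circ> w') f\<bar>)) \<le> \<bar>\<rho>\<bar> * wnorm I' (g \<circ> w')"
          by (subst Max_le_iff) (auto intro!: mult_left_mono minor_le_wnorm)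
        obtain f where "wnorm I' (g \<circ> w') = \<bar>minor I' (g \<circ> w') f\<bar>" by (rule wnorm_attained)
        then show "\<bar>\<rho>\<bar> * wnorm I' (g \<circ> w') \<le> Max (range (\<lambda>f. \<bar>\<rho>\<bar> * \<bar>minor I' (g \<circ> w') f\<bar>))"
          by (intro Max_ge) auto
      qed
      finally show ?thesis .
    qed
    have "\<rho> \<noteq> 0" using eq[OF linear_id] t by (auto simp: indep_tuple_def)
    then show ?thesis using eq by (intro exI[of _ "\<bar>\<rho>\<bar>"]) auto
  qed
  have max: "\<exists>m\<in>I. \<forall>k\<in>I. infnorm (h (w k)) \<le> infnorm (h (w m))" if "indep_tuple I w" for I w
  proof -
    have "I \<noteq> {}" using that by (simp add: indep_tuple_def)
    then have "Max ((\<lambda>k. infnorm (h (w k))) ` I) \<in> (\<lambda>k. infnorm (h (w k))) ` I" by (intro Max_in) auto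
    then obtain m where "m \<in> I" "Max ((\<lambda>k. infnorm (h (w k))) ` I) = infnorm (h (w m))" by auto
    moreover have "infnorm (h (w k)) \<le> Max ((\<lambda>k. infnorm (h (w k))) ` I)" if "k \<in> I" for k
      using that by (intro Max_ge) auto
    ultimately show ?thesis by metis
  qed
  obtain m where m: "m \<in> I" "\<forall>k\<in>I. infnorm (h (w k)) \<le> infnorm (h (w m))" using max[OF t(1)] by blast
  obtain m' where m': "m' \<in> I'" "\<forall>k\<in>I'. infnorm (h (w' k)) \<le> infnorm (h (w' m'))" using max[OF t'(1)] by blast
  show ?thesis
  proof (cases "infnorm (h (w m)) \<le> infnorm (h (w' m'))")
    case True
    then show ?thesis using *[OF t(1) t' c m'(1)] m by (meson order_trans)
  next
    case False
    then have "\<And>k. k \<in> I' \<Longrightarrow> infnorm (h (w' k)) \<le> infnorm (h (w m))" using m' by fastforce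
    then obtain \<rho> where \<rho>: "\<rho> > 0" "\<And>g. linear g \<Longrightarrow> wnorm I' (g \<circ> w') = \<rho> * wnorm I (g \<circ> w)"
      using *[OF t'(1) t c[symmetric] m(1)] by blast
    have "wnorm I (g \<circ> w) = inverse \<rho> * wnorm I' (g \<circ> w')" if "linear g" for g
      using \<rho>(2)[OF that] \<rho>(1) by simp
    then show ?thesis by blast
  qed
qed

text \<open>The converse comparison: a reduced basis of the lattice generated by the tuple has
  product of norms at most a constant times the covolume, so heights computed from
  \<open>wnorm\<close> are controlled by \<open>lat_height\<close>.\<close>

lemma wnorm_le_lat_height:
  assumes h: "unimodular h" and K: "0 < K" and t: "indep_tuple I e"
  shows "ennreal ((K ^ (card I * (CARD('r) - card I)) * wnorm I (h \<circ> e)) powr (- (1 / \<phi> (card I))))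
    \<le> ennreal (3 powr (CARD('r) * CARD('r) * b)) * lat_height K h"
proof -
  let ?i = "card I"
  let ?c = "K ^ (?i * (CARD('r) - ?i))"
  note i = indep_tuple_card[OF t]
  have \<phi>: "0 < \<phi> ?i" by (rule \<phi>_pos[OF i])
  have e: "0 < wnorm I e" "\<And>k. k \<in> I \<Longrightarrow> e k \<in> L" using t by (auto simp: indep_tuple_def)
  have pos: "0 < wnorm I (h \<circ> e)" by (rule wnorm_unimodular_pos[OF h e(1)])
  obtain w' where w': "row_moves I (\<lambda>k. h (e k)) w'"
      "(\<Prod>k\<in>I. infnorm (w' k)) \<le> 3 ^ (?i * ?i) * wnorm I (h \<circ> e)"
    using reduced_basis[OF pos] by (auto simp: comp_def)
  have "linear h" using h by (simp add: unimodular_def)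
  then obtain w where w: "row_moves I e w" "\<And>k. h (w k) = w' k"
    using row_moves_lift[where h = h and v = e, OF w'(1)] by blast
  have tw: "indep_tuple I w"
    using t row_moves_subgroup[OF w(1) e(2) L_closed] wnorm_row_moves[OF w(1)] by (auto simp: indep_tuple_def)
  let ?P = "\<Prod>k\<in>I. infnorm ((h \<circ> w) k)"
  have P: "0 < ?P" using tw by (intro prod_infnorm_pos wnorm_unimodular_pos[OF h]) (simp add: indep_tuple_def)
  have le: "?P \<le> 3 ^ (?i * ?i) * wnorm I (h \<circ> e)" using w'(2) w(2) by simp
  have c: "0 < ?c" using K by simp
  have "?c * ?P / 3 ^ (?i * ?i) \<le> ?c * wnorm I (h \<circ> e)" using le c by (simp add: field_simps)
  then have "(?c * wnorm I (h \<circ> e)) powr (- (1 / \<phi> ?i)) \<le> (?c * ?P / 3 ^ (?i * ?i)) powr (- (1 / \<phi> ?i))"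
    using \<phi> c P by (intro powr_mono2') auto
  also have "\<dots> = (?c * ?P) powr (- (1 / \<phi> ?i)) * (3 ^ (?i * ?i)) powr (1 / \<phi> ?i)"
    using c P by (subst powr_divide) (auto simp: powr_minus field_simps)
  also have "(3 ^ (?i * ?i)) powr (1 / \<phi> ?i) = 3 powr (real ?i * real ?i * (1 / \<phi> ?i))"
    by (simp add: powr_powr flip: powr_realpow)
  also have "(?c * ?P) powr (- (1 / \<phi> ?i)) * 3 powr (real ?i * real ?i * (1 / \<phi> ?i))
    \<le> (?c * ?P) powr (- (1 / \<phi> ?i)) * 3 powr (CARD('r) * CARD('r) * b)"
  proof (intro mult_left_mono powr_mono)
    have "real ?i * real ?i \<le> real CARD('r) * real CARD('r)"
      using i by (intro mult_mono) auto
    then show "real ?i * real ?i * (1 / \<phi> ?i) \<le> CARD('r) * CARD('r) * b"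
      using b[OF i] \<phi> by (intro mult_mono) auto
  qed auto
  finally have "(?c * wnorm I (h \<circ> e)) powr (- (1 / \<phi> ?i)) \<le> 3 powr (CARD('r) * CARD('r) * b) * tuple_height K I (h \<circ> w)"
    unfolding tuple_height_def by (simp only: mult.commute)
  then have "ennreal ((?c * wnorm I (h \<circ> e)) powr (- (1 / \<phi> ?i))) \<le> ennreal (3 powr (CARD('r) * CARD('r) * b)) * ennreal (tuple_height K I (h \<circ> w))"
    by (simp add: ennreal_mult[symmetric] tuple_height_nonneg ennreal_leI)
  also have "\<dots> \<le> ennreal (3 powr (CARD('r) * CARD('r) * b)) * lat_height K h"
    by (intro mult_left_mono tuple_height_le tw) auto
  finally show ?thesis .
qed

end

context height
begin

text \<open>The near-optimal tuples of one rank are proportional, so for each rank a single family \<open>e i\<close> bounds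
  the heights of all the lattices \<open>g j ` h ` L\<close> that are not small.\<close>

lemma dominating_tuples:
  assumes h: "unimodular h" and J: "finite J" and g: "\<And>j. j \<in> J \<Longrightarrow> unimodular (g j)" and \<Lambda>: "1 \<le> \<Lambda>"
    and lip: "\<And>j x. j \<in> J \<Longrightarrow> infnorm (g j x) \<le> \<Lambda> * infnorm x"
    and lip': "\<And>j x. j \<in> J \<Longrightarrow> infnorm x \<le> \<Lambda> * infnorm (g j x)"
    and b0: "0 \<le> b"
    and K: "fact CARD('r) * (2 * \<Lambda> powr (2 * (CARD('r) * b))) < K"
    and fin: "lat_height K h < top"
  shows "\<exists>R I e. R \<subseteq> {0<..<CARD('r)} \<and> (\<forall>i\<in>R. card (I i) = i \<and> indep_tuple (I i) (e i)) \<and>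
    (\<forall>j\<in>J. lat_height K (g j \<circ> h) \<le> ennreal (\<Lambda> powr (CARD('r) * b)) +
      (\<Sum>i\<in>R. ennreal (2 * fact CARD('r) powr b * (K ^ (i * (CARD('r) - i)) * wnorm (I i) (g j \<circ> h \<circ> e i)) powr (- (1 / \<phi> i)))))"
proof -
  define B where "B = \<Lambda> powr (CARD('r) * b)"
  have B1: "1 \<le> B" unfolding B_def using \<Lambda> b0 by (intro ge_one_powr_ge_zero) auto
  \<comment> \<open>Passing between \<open>h\<close> and \<open>g j \<circ> h\<close> costs a factor
    \<open>B\<close> in each direction, and replacing the supremum by a single tuple costs
    2.\<close>
  define \<Theta> where "\<Theta> = 2 * \<Lambda> powr (2 * (CARD('r) * b))"
  have \<Theta>eq: "\<Theta> = 2 * (B * B)" by (simp add: \<Theta>_def B_def powr_add[symmetric] algebra_simps)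
  have \<Theta>1: "1 \<le> \<Theta>" using mult_mono[OF B1 B1] B1 by (simp add: \<Theta>eq)
  have fact1: "1 \<le> (fact CARD('r) :: real)" by (rule fact_ge_1)
  have K': "fact CARD('r) * \<Theta> < K" using K by (simp add: \<Theta>_def)
  have "1 * 1 \<le> fact CARD('r) * \<Theta>" using fact1 \<Theta>1 by (intro mult_mono) auto
  then have K0: "0 < K" using K' by linarith
  obtain F where F: "lat_height K h = ennreal F" "0 \<le> F"
    using fin by (cases "lat_height K h") auto
  have gh: "unimodular (g j \<circ> h)" if "j \<in> J" for j using g[OF that] h by (rule unimodular_comp)
  \<comment> \<open>Outside \<open>bad\<close> the additive constant suffices. If \<open>bad\<close>
    is nonempty, the height of \<open>h\<close> itself is at least 1, as \<open>gap\<close>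
    requires.\<close>
  define bad where "bad = {j \<in> J. \<not> lat_height K (g j \<circ> h) \<le> ennreal B}"
  have "\<exists>I w. indep_tuple I w \<and> lat_height K (g j \<circ> h) \<le> ennreal (2 * tuple_height K I (g j \<circ> h \<circ> w)) \<and>
      F / \<Theta> \<le> tuple_height K I (h \<circ> w) \<and> 1 \<le> F" if "j \<in> bad" for j
  proof -
    have j: "j \<in> J" and big: "ennreal B < lat_height K (g j \<circ> h)" using that by (auto simp: bad_def)
    have le1: "lat_height K (g j \<circ> h) \<le> ennreal B * lat_height K h"
      unfolding B_def using lip'[OF j] by (intro lat_height_lipschitz[OF h gh[OF j] \<Lambda> _ K0]) auto
    have le2: "lat_height K h \<le> ennreal B * lat_height K (g j \<circ> h)"
      unfolding B_def using lip[OF j] by (intro lat_height_lipschitz[OF gh[OF j] h \<Lambda> _ K0]) auto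
    have "lat_height K (g j \<circ> h) < top" using le1 by (rule order.strict_trans1) (simp add: F ennreal_mult_less_top)
    then obtain G where G: "lat_height K (g j \<circ> h) = ennreal G" "0 \<le> G" by (cases "lat_height K (g j \<circ> h)") auto
    have BG: "B < G" using big G B1 by (simp add: ennreal_less_iff)
    have GF: "G \<le> B * F" using le1 G F B1 by (simp add: ennreal_mult[symmetric] ennreal_le_iff)
    have FG: "F \<le> B * G" using le2 G F B1 by (simp add: ennreal_mult[symmetric] ennreal_le_iff)
    have "1 \<le> F" using BG GF B1 by (smt (verit) mult_le_cancel_left1)
    have "ennreal (G / 2) < lat_height K (g j \<circ> h)" using G BG B1 by (simp add: ennreal_less_iff)
    then obtain I w where t: "indep_tuple I w" "ennreal (G / 2) < ennreal (tuple_height K I (g j \<circ> h \<circ> w))"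
      unfolding lat_height_def by (auto simp: less_SUP_iff)
    then have half: "G / 2 < tuple_height K I (g j \<circ> h \<circ> w)"
      using G by (simp add: ennreal_less_iff)
    have "tuple_height K I (g j \<circ> h \<circ> w) \<le> B * tuple_height K I (h \<circ> w)"
      unfolding B_def using lip'[OF j] by (intro tuple_height_lipschitz[OF t(1) h gh[OF j] \<Lambda> _ K0]) auto
    with half have "G / 2 \<le> B * tuple_height K I (h \<circ> w)" by linarith
    then have "B * G \<le> B * (2 * (B * tuple_height K I (h \<circ> w)))" using B1 by (intro mult_left_mono) auto
    then have "F \<le> \<Theta> * tuple_height K I (h \<circ> w)" using FG by (simp add: \<Theta>eq mult_ac)
    then have "F / \<Theta> \<le> tuple_height K I (h \<circ> w)" using \<Theta>1 by (simp add: field_simps)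
    moreover have "lat_height K (g j \<circ> h) \<le> ennreal (2 * tuple_height K I (g j \<circ> h \<circ> w))"
      using half G by (simp add: ennreal_leI)
    ultimately show ?thesis using t(1) \<open>1 \<le> F\<close> by blast
  qed
  then obtain IJ wJ where IJ: "\<And>j. j \<in> bad \<Longrightarrow> indep_tuple (IJ j) (wJ j)"
    "\<And>j. j \<in> bad \<Longrightarrow> lat_height K (g j \<circ> h) \<le> ennreal (2 * tuple_height K (IJ j) (g j \<circ> h \<circ> wJ j))"
    "\<And>j. j \<in> bad \<Longrightarrow> F / \<Theta> \<le> tuple_height K (IJ j) (h \<circ> wJ j)" "bad \<noteq> {} \<Longrightarrow> 1 \<le> F"
    by (metis ex_in_conv)
  define R where "R = (\<lambda>j. card (IJ j)) ` bad"
  have finbad: "finite bad" using J by (simp add: bad_def)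
  \<comment> \<open>Among the chosen tuples of rank \<open>i\<close> the one of least covolume is
    kept, so that the proportionality factor \<open>\<rho>\<close> below is at least 1.\<close>
  have "\<exists>s. s \<in> bad \<and> card (IJ s) = i \<and>
      (\<forall>j. j \<in> bad \<and> card (IJ j) = i \<longrightarrow> wnorm (IJ s) (wJ s) \<le> wnorm (IJ j) (wJ j))" if "i \<in> R" for i
  proof -
    let ?S = "{j \<in> bad. card (IJ j) = i}"
    have S: "finite ?S" "?S \<noteq> {}" using finbad that by (auto simp: R_def)
    obtain s where "is_arg_min (\<lambda>j. wnorm (IJ j) (wJ j)) (\<lambda>j. j \<in> ?S) s"
      using ex_is_arg_min_if_finite[OF S] by blast
    then show ?thesis by (intro exI[of _ s]) (auto simp: is_arg_min_linorder)
  qed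
  then obtain s where s: "\<And>i. i \<in> R \<Longrightarrow> s i \<in> bad" "\<And>i. i \<in> R \<Longrightarrow> card (IJ (s i)) = i"
    "\<And>i j. i \<in> R \<Longrightarrow> j \<in> bad \<Longrightarrow> card (IJ j) = i \<Longrightarrow> wnorm (IJ (s i)) (wJ (s i)) \<le> wnorm (IJ j) (wJ j)"
    by metis
  define T where "T i j = ennreal (2 * fact CARD('r) powr b * (K ^ (i * (CARD('r) - i))
      * wnorm (IJ (s i)) (g j \<circ> h \<circ> wJ (s i))) powr (- (1 / \<phi> i)))" for i j
  show ?thesis
  proof (intro exI[of _ R] exI[of _ "\<lambda>i. IJ (s i)"] exI[of _ "\<lambda>i. wJ (s i)"] conjI ballI)
    show "R \<subseteq> {0<..<CARD('r)}" using indep_tuple_card[OF IJ(1)] by (auto simp: R_def)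
  next
    fix i assume "i \<in> R"
    then show "card (IJ (s i)) = i" "indep_tuple (IJ (s i)) (wJ (s i))" using s IJ by auto
  next
    fix j assume j: "j \<in> J"
    have "lat_height K (g j \<circ> h) \<le> ennreal B + (\<Sum>i\<in>R. T i j)"
    proof (cases "j \<in> bad")
      case False
      then have "lat_height K (g j \<circ> h) \<le> ennreal B" using j by (simp add: bad_def)
      then show ?thesis by (rule order_trans) simp
    next
      case True
      define i where "i = card (IJ j)"
      have iR: "i \<in> R" using True by (simp add: i_def R_def)
      have F1: "1 \<le> F" using IJ(4) True by blast
      obtain \<rho> where \<rho>: "\<And>q. linear q \<Longrightarrow> wnorm (IJ j) (q \<circ> wJ j) = \<rho> * wnorm (IJ (s i)) (q \<circ> wJ (s i))"
        using near_optimal_proportional[OF h _ F1 \<Theta>1 K' IJ(1)[OF True] IJ(3)[OF True] IJ(1)[OF s(1)[OF iR]] IJ(3)[OF s(1)[OF iR]]]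
          F s(2)[OF iR] by (auto simp: i_def)
      have pos: "0 < wnorm (IJ (s i)) (wJ (s i))" using IJ(1)[OF s(1)[OF iR]] by (simp add: indep_tuple_def)
      have "wnorm (IJ (s i)) (wJ (s i)) \<le> wnorm (IJ j) (wJ j)" using s(3)[OF iR True] by (simp add: i_def)
      also have "\<dots> = \<rho> * wnorm (IJ (s i)) (wJ (s i))" using \<rho>[OF linear_id] by simp
      finally have \<rho>1: "1 \<le> \<rho>" using pos by simp
      have lin: "linear (g j \<circ> h)" using gh[OF j] by (simp add: unimodular_def)
      note ic = indep_tuple_card[OF IJ(1)[OF True]]
      have \<phi>: "0 < \<phi> i" using \<phi>_pos ic by (simp add: i_def)
      let ?c = "K ^ (i * (CARD('r) - i))"
      let ?P = "\<Prod>k\<in>IJ j. infnorm ((g j \<circ> h \<circ> wJ j) k)"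
      let ?W = "wnorm (IJ (s i)) (g j \<circ> h \<circ> wJ (s i))"
      have c: "0 < ?c" using K0 by simp
      have W: "0 < ?W" using IJ(1)[OF s(1)[OF iR]] wnorm_unimodular_pos[OF gh[OF j]] by (simp add: indep_tuple_def)
      have "?W \<le> \<rho> * ?W" using \<rho>1 W by simp
      also have "\<dots> = wnorm (IJ j) (g j \<circ> h \<circ> wJ j)" using \<rho>[OF lin] by simp
      also have "\<dots> \<le> fact CARD('r) * ?P" by (rule wnorm_le_prod)
      finally have "?c * ?W / fact CARD('r) \<le> ?c * ?P" using c by (simp add: field_simps)
      moreover have "0 < ?c * ?W / fact CARD('r)" using c W by simp
      ultimately have "(?c * ?P) powr (- (1 / \<phi> i)) \<le> (?c * ?W / fact CARD('r)) powr (- (1 / \<phi> i))"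
        using \<phi> by (intro powr_mono2') auto
      also have "\<dots> = (?c * ?W) powr (- (1 / \<phi> i)) * fact CARD('r) powr (1 / \<phi> i)"
        using c W by (subst powr_divide) (auto simp: powr_minus field_simps)
      also have "\<dots> \<le> (?c * ?W) powr (- (1 / \<phi> i)) * fact CARD('r) powr b"
        using fact1 b[of i] ic by (intro mult_left_mono powr_mono) (auto simp: i_def)
      finally have th: "tuple_height K (IJ j) (g j \<circ> h \<circ> wJ j) \<le> fact CARD('r) powr b * (?c * ?W) powr (- (1 / \<phi> i))"
        unfolding tuple_height_def i_def by (simp only: mult.commute)
      have "lat_height K (g j \<circ> h) \<le> ennreal (2 * tuple_height K (IJ j) (g j \<circ> h \<circ> wJ j))" by (rule IJ(2)[OF True])
      also have "\<dots> \<le> T i j" unfolding T_def using th by (intro ennreal_leI) simp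
      also have "\<dots> \<le> (\<Sum>i\<in>R. T i j)" using iR finbad by (intro member_le_sum) (auto simp: R_def)
      finally show ?thesis by (simp add: add_increasing)
    qed
    then show "lat_height K (g j \<circ> h) \<le> ennreal (\<Lambda> powr (CARD('r) * b)) +
      (\<Sum>i\<in>R. ennreal (2 * fact CARD('r) powr b * (K ^ (i * (CARD('r) - i)) * wnorm (IJ (s i)) (g j \<circ> h \<circ> wJ (s i))) powr (- (1 / \<phi> i))))"
      by (simp add: T_def B_def)
  qed
qed

end

subsection \<open>Diagonal and unipotent maps\<close>

definition diag_map :: "('r \<Rightarrow> real) \<Rightarrow> real ^ 'r \<Rightarrow> real ^ 'r" where
  "diag_map c v = (\<chi> r. c r * v $ r)"

lemma linear_diag_map: "linear (diag_map c)"
  by (rule linearI) (simp_all add: diag_map_def vec_eq_iff algebra_simps)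

lemma diag_map_axis: "diag_map c (axis r 1) = c r *\<^sub>R axis r 1"
  by (simp add: diag_map_def vec_eq_iff axis_def)

lemma rowdet_diag_map: "rowdet (\<lambda>r. diag_map c (axis r 1)) = (\<Prod>r\<in>UNIV. c r)"
  by (simp add: diag_map_axis rowdet_scale_all rowdet_axis)

text \<open>The padding unit rows are scaled together with the rest, and their factors must be taken
  out again; the identity is stated without division.\<close>

lemma minor_diag_map:
  fixes v :: "'r::finite \<Rightarrow> real ^ 'r"
  shows "(\<Prod>k\<in>-I. c (f k)) * minor I (diag_map c \<circ> v) f = (\<Prod>r\<in>UNIV. c r) * minor I v f"
proof -
  have "(\<lambda>k. diag_map c (padded I v f k))
    = (\<lambda>k. (if k \<in> I then 1 else c (f k)) *\<^sub>R padded I (diag_map c \<circ> v) f k)"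
    by (auto simp: padded_def diag_map_axis fun_eq_iff)
  then have "rowdet (\<lambda>k. diag_map c (padded I v f k))
    = (\<Prod>k\<in>UNIV. if k \<in> I then 1 else c (f k)) * minor I (diag_map c \<circ> v) f"
    by (simp add: rowdet_scale_all minor_def del: o_apply)
  also have "(\<Prod>k\<in>UNIV. if k \<in> I then 1 else c (f k)) = (\<Prod>k\<in>-I. c (f k))"
    by (intro prod.mono_neutral_cong_right) auto
  finally show ?thesis
    using rowdet_linear[OF linear_diag_map, of c "padded I v f"] by (simp add: rowdet_diag_map minor_def mult.commute del: o_apply)
qed

lemma minor_inj:
  assumes "minor I v f \<noteq> 0"
  shows "inj_on f (- I)"
proof (rule inj_onI, rule ccontr)
  fix k l assume "k \<in> - I" "l \<in> - I" "f k = f l" "k \<noteq> l"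
  then have "rowdet (padded I v f) = 0" by (intro rowdet_eq_0[of k l]) (auto simp: padded_def)
  then show False using assms by (simp add: minor_def)
qed

lemma wnorm_scaleR:
  fixes v :: "'r::finite \<Rightarrow> real ^ 'r"
  shows "wnorm I (\<lambda>k. c *\<^sub>R v k) = \<bar>c\<bar> ^ card I * wnorm I v"
proof -
  have m: "\<bar>minor I (\<lambda>k. c *\<^sub>R v k) f\<bar> = \<bar>c\<bar> ^ card I * \<bar>minor I v f\<bar>" for f
  proof -
    have "padded I (\<lambda>k. c *\<^sub>R v k) f = (\<lambda>k. (if k \<in> I then c else 1) *\<^sub>R padded I v f k)"
      by (auto simp: padded_def fun_eq_iff)
    moreover have "(\<Prod>k\<in>UNIV. if k \<in> I then c else 1) = c ^ card I"
      by (simp add: prod.If_cases)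
    ultimately show ?thesis by (simp add: minor_def rowdet_scale_all abs_mult power_abs)
  qed
  show ?thesis
  proof (rule antisym)
    show "wnorm I (\<lambda>k. c *\<^sub>R v k) \<le> \<bar>c\<bar> ^ card I * wnorm I v"
      by (auto simp: wnorm_le_iff m intro!: mult_left_mono minor_le_wnorm)
    obtain f where "wnorm I v = \<bar>minor I v f\<bar>" by (rule wnorm_attained)
    then show "\<bar>c\<bar> ^ card I * wnorm I v \<le> wnorm I (\<lambda>k. c *\<^sub>R v k)"
      using minor_le_wnorm[of I "\<lambda>k. c *\<^sub>R v k" f] by (simp add: m)
  qed
qed

section \<open>The dilations and shears of the problem and their effect on minors\<close>

abbreviation top_row :: "'d option + 'm" where "top_row \<equiv> Inl None"

definition ydil :: "real \<Rightarrow> real ^ ('d::finite option + 'm::finite) \<Rightarrow> real ^ ('d option + 'm)" where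
  "ydil X = diag_map (case_sum (\<lambda>_. X) (\<lambda>_. 1))"

definition topdil :: "real \<Rightarrow> real ^ ('d::finite option + 'm::finite) \<Rightarrow> real ^ ('d option + 'm)" where
  "topdil M = diag_map (\<lambda>r. if r = top_row then M else 1)"

definition shear_coeff :: "real ^ 'd \<Rightarrow> 'd::finite option + 'm \<Rightarrow> real" where
  "shear_coeff s r = (case r of Inl (Some a) \<Rightarrow> s $ a | _ \<Rightarrow> 0)"

definition shear :: "real ^ 'd::finite \<Rightarrow> real ^ ('d option + 'm::finite) \<Rightarrow> real ^ ('d option + 'm)" where
  "shear s v = v + (\<Sum>a\<in>UNIV. s $ a * v $ Inl (Some a)) *\<^sub>R axis top_row 1"

text \<open>The number of \<open>Y\<close>-rows, i.e. rows \<open>Inl _\<close>, of the minor, namely those that \<open>f\<close> does not hit.\<close>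

definition yrank :: "('d::finite option + 'm::finite) set \<Rightarrow> ('d option + 'm \<Rightarrow> 'd option + 'm) \<Rightarrow> nat" where
  "yrank I f = CARD('d) + 1 - card {k \<in> - I. f k \<in> range Inl}"

lemma linear_shear: "linear (shear s)"
  by (rule linearI) (simp_all add: shear_def algebra_simps sum.distrib sum_distrib_left)

lemma shear_top: "shear s v $ top_row = v $ top_row + (\<Sum>a\<in>UNIV. s $ a * v $ Inl (Some a))"
  by (simp add: shear_def)

lemma shear_other: "r \<noteq> top_row \<Longrightarrow> shear s v $ r = v $ r"
  by (simp add: shear_def axis_def)

lemma shear_add: "shear s (shear t v) = shear (s + t) v"
  by (simp add: shear_def axis_def scaleR_add_left[symmetric] sum.distrib distrib_right)

lemma shear_0: "shear 0 v = v"
  by (simp add: shear_def)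

lemma shear_axis: "shear s (axis r 1) = axis r 1 + shear_coeff s r *\<^sub>R axis top_row 1"
proof -
  have "(\<Sum>a\<in>UNIV. s $ a * axis r 1 $ Inl (Some a)) = shear_coeff s r"
  proof (cases r)
    case (Inl x)
    show ?thesis
    proof (cases x)
      case (Some b)
      have "(\<Sum>a\<in>UNIV. s $ a * axis r 1 $ Inl (Some a)) = (\<Sum>a\<in>{b}. s $ a)"
        by (intro sum.mono_neutral_cong_right) (auto simp: Inl Some axis_def)
      then show ?thesis by (simp add: Inl Some shear_coeff_def)
    qed (simp add: Inl shear_coeff_def axis_def)
  qed (simp add: shear_coeff_def axis_def)
  then show ?thesis by (simp add: shear_def)
qed

lemma rowdet_shear: "rowdet (\<lambda>r :: 'd::finite option + 'm::finite. shear s (axis r 1)) = 1"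
proof -
  have "rowdet (\<lambda>r :: 'd option + 'm. shear s (axis r 1)) = 1 + (\<Sum>r\<in>(UNIV :: ('d option + 'm) set). shear_coeff s r * rowdet (upd (\<lambda>r. axis r 1) r (axis top_row 1)))"
    using rowdet_common[of UNIV "\<lambda>r :: 'd option + 'm. axis r 1" "shear_coeff s" "axis top_row 1"]
    by (simp add: shear_axis rowdet_axis)
  also have "(\<Sum>r\<in>(UNIV :: ('d option + 'm) set). shear_coeff s r * rowdet (upd (\<lambda>r. axis r 1) r (axis top_row 1))) = 0"
  proof (rule sum.neutral, rule ballI)
    fix r :: "'d option + 'm"
    show "shear_coeff s r * rowdet (upd (\<lambda>r. axis r 1) r (axis top_row 1)) = 0"
    proof (cases "r = top_row")
      case False
      have "rowdet (upd (\<lambda>r. axis r 1) r (axis top_row 1)) = 0"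
        by (rule rowdet_eq_0[OF False]) (use False in \<open>simp add: upd_apply\<close>)
      then show ?thesis by simp
    qed (simp add: shear_coeff_def)
  qed
  finally show ?thesis by simp
qed

text \<open>The shear has determinant 1 and is pulled out of the padded family; this changes each
  unit row \<open>axis (f k) 1\<close> by a multiple of the top unit vector, and only first-order
  terms survive. Every minor is thus affine in \<open>s\<close>, with minors of \<open>v\<close> as
  coefficients.\<close>

lemma minor_shear:
  fixes v :: "'d::finite option + 'm::finite \<Rightarrow> real ^ ('d option + 'm)"
  shows "minor I (shear s \<circ> v) f = minor I v f - (\<Sum>k\<in>-I. shear_coeff s (f k) * minor I v (upd f k top_row))"
proof -
  let ?z = "\<lambda>k. if k \<in> - I then padded I v f k + (- shear_coeff s (f k)) *\<^sub>R axis top_row 1 else padded I v f k"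
  have "padded I (shear s \<circ> v) f = (\<lambda>k. shear s (?z k))"
  proof
    fix k
    have top: "shear s (axis top_row 1) = axis top_row 1" by (simp add: shear_axis shear_coeff_def)
    have "shear s (axis (f k) 1 - shear_coeff s (f k) *\<^sub>R axis top_row 1) = axis (f k) 1"
      unfolding linear_diff[OF linear_shear] linear_scale[OF linear_shear] top by (simp add: shear_axis)
    then show "padded I (shear s \<circ> v) f k = shear s (?z k)" by (auto simp: padded_def)
  qed
  then have "minor I (shear s \<circ> v) f = rowdet ?z"
    using rowdet_linear[OF linear_shear, of s ?z] by (simp add: minor_def rowdet_shear)
  also have "\<dots> = minor I v f - (\<Sum>k\<in>-I. shear_coeff s (f k) * rowdet (upd (padded I v f) k (axis top_row 1)))"
    unfolding rowdet_common by (simp add: minor_def sum_negf)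
  also have "(\<Sum>k\<in>-I. shear_coeff s (f k) * rowdet (upd (padded I v f) k (axis top_row 1)))
    = (\<Sum>k\<in>-I. shear_coeff s (f k) * minor I v (upd f k top_row))"
  proof (rule sum.cong[OF HOL.refl])
    fix k assume "k \<in> - I"
    then have "upd (padded I v f) k (axis top_row 1) = padded I v (upd f k top_row)"
      by (intro ext) (auto simp: padded_def upd_apply)
    then show "shear_coeff s (f k) * rowdet (upd (padded I v f) k (axis top_row 1))
      = shear_coeff s (f k) * minor I v (upd f k top_row)" by (simp add: minor_def)
  qed
  finally show ?thesis .
qed

lemma yrow_iff: "r \<in> range Inl \<longleftrightarrow> (\<exists>x. r = Inl x)"
  by auto

lemma card_yrows: "card (range Inl :: ('d::finite option + 'm::finite) set) = CARD('d) + 1"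
  by (subst card_image) (auto simp: card_option)

lemma card_yhits_le:
  fixes f :: "'d::finite option + 'm::finite \<Rightarrow> 'd option + 'm"
  assumes "inj_on f (- I)"
  shows "card {k \<in> - I. f k \<in> range Inl} \<le> CARD('d) + 1"
proof -
  have "card {k \<in> - I. f k \<in> range Inl} = card (f ` {k \<in> - I. f k \<in> range Inl})"
    by (rule card_image[symmetric]) (rule inj_on_subset[OF assms], auto)
  also have "\<dots> \<le> card (range Inl :: ('d option + 'm) set)" by (intro card_mono) auto
  finally show ?thesis by (simp add: card_yrows)
qed

lemma prod_case_sum: "(\<Prod>r\<in>UNIV. case_sum (\<lambda>_. X) (\<lambda>_. 1) (r :: 'd::finite option + 'm::finite)) = (X::real) ^ (CARD('d) + 1)"
proof -
  have "(\<Prod>r\<in>UNIV. case_sum (\<lambda>_. X) (\<lambda>_. 1) (r :: 'd option + 'm)) = (\<Prod>r\<in>(range Inl :: ('d option + 'm) set). X)"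
    by (intro prod.mono_neutral_cong_right) (auto simp: yrow_iff split: sum.split)
  then show ?thesis by (simp add: card_yrows)
qed

lemma minor_ydil:
  fixes v :: "'d::finite option + 'm::finite \<Rightarrow> real ^ ('d option + 'm)"
  assumes "X \<noteq> 0"
  shows "minor I (ydil X \<circ> v) f = X ^ yrank I f * minor I v f"
proof -
  let ?n = "card {k \<in> - I. f k \<in> range Inl}"
  have "(\<Prod>k\<in>-I. case_sum (\<lambda>_. X) (\<lambda>_. 1) (f k)) = (\<Prod>k\<in>{k \<in> - I. f k \<in> range Inl}. X)"
    by (intro prod.mono_neutral_cong_right) (auto simp: yrow_iff split: sum.split)
  then have eq: "X ^ ?n * minor I (ydil X \<circ> v) f = X ^ (CARD('d) + 1) * minor I v f"
    using minor_diag_map[where c = "case_sum (\<lambda>_. X) (\<lambda>_. 1)" and I = I and v = v and f = f]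
    by (simp add: prod_case_sum ydil_def)
  show ?thesis
  proof (cases "minor I v f = 0")
    case True
    then show ?thesis using eq assms by simp
  next
    case False
    then have "?n \<le> CARD('d) + 1" by (intro card_yhits_le minor_inj)
    then have "X ^ (CARD('d) + 1) = X ^ ?n * X ^ yrank I f" by (simp add: yrank_def flip: power_add)
    then show ?thesis using eq assms by simp
  qed
qed

lemma prod_topdil: "(\<Prod>r\<in>UNIV. if r = (top_row :: 'd::finite option + 'm::finite) then M else 1) = (M::real)"
  by (simp add: prod.If_cases)

lemma minor_topdil:
  fixes v :: "'d::finite option + 'm::finite \<Rightarrow> real ^ ('d option + 'm)"
  shows "top_row \<notin> f ` (- I) \<Longrightarrow> minor I (topdil M \<circ> v) f = M * minor I v f"
    and "1 \<le> M \<Longrightarrow> \<bar>minor I v f\<bar> \<le> \<bar>minor I (topdil M \<circ> v) f\<bar>"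
    and "1 \<le> M \<Longrightarrow> \<bar>minor I (topdil M \<circ> v) f\<bar> \<le> M * \<bar>minor I v f\<bar>"
proof -
  let ?c = "\<lambda>r. if r = (top_row :: 'd option + 'm) then M else 1"
  have eq: "(\<Prod>k\<in>-I. ?c (f k)) * minor I (topdil M \<circ> v) f = M * minor I v f"
    using minor_diag_map[where c = ?c and I = I and v = v and f = f] by (simp add: prod_topdil topdil_def)
  have none: "(\<Prod>k\<in>-I. ?c (f k)) = 1" if "top_row \<notin> f ` (- I)"
  proof (intro prod.neutral ballI)
    fix k assume "k \<in> - I"
    then have "f k \<noteq> top_row" using that by (metis image_eqI)
    then show "?c (f k) = 1" by simp
  qed
  then show 1: "minor I (topdil M \<circ> v) f = M * minor I v f" if "top_row \<notin> f ` (- I)"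
    using eq that by simp
  {
    assume M: "1 \<le> M"
    have ge: "1 \<le> (\<Prod>k\<in>-I. ?c (f k))" using M by (intro prod_ge_1) auto
    have "1 * \<bar>minor I (topdil M \<circ> v) f\<bar> \<le> (\<Prod>k\<in>-I. ?c (f k)) * \<bar>minor I (topdil M \<circ> v) f\<bar>"
      using ge by (intro mult_right_mono) auto
    also have "\<dots> = M * \<bar>minor I v f\<bar>" 
    proof -
      have "(\<Prod>k\<in>-I. ?c (f k)) * \<bar>minor I (topdil M \<circ> v) f\<bar> = \<bar>(\<Prod>k\<in>-I. ?c (f k)) * minor I (topdil M \<circ> v) f\<bar>"
        using ge by (simp add: abs_mult)
      then show ?thesis unfolding eq using M by (simp add: abs_mult)
    qed
    finally show "\<bar>minor I (topdil M \<circ> v) f\<bar> \<le> M * \<bar>minor I v f\<bar>" by simp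
    show "\<bar>minor I v f\<bar> \<le> \<bar>minor I (topdil M \<circ> v) f\<bar>"
    proof (cases "top_row \<in> f ` (- I) \<and> minor I v f \<noteq> 0")
      case True
      then obtain k0 where k0: "k0 \<in> - I" "f k0 = top_row" by (metis imageE)
      have inj: "inj_on f (- I)" using True minor_inj by blast
      have "(\<Prod>k\<in>-I. ?c (f k)) = (\<Prod>k\<in>{k0}. M)"
        using k0 inj by (intro prod.mono_neutral_cong_right) (auto simp: inj_on_def)
      then show ?thesis using eq M by simp
    next
      case False
      then show ?thesis using 1 M by (auto simp: abs_mult mult_le_cancel_right1)
    qed
  }
qed

lemma wnorm_shear_le:
  fixes v :: "'d::finite option + 'm::finite \<Rightarrow> real ^ ('d option + 'm)"
  assumes "\<And>a. \<bar>s $ a\<bar> \<le> 1"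
  shows "wnorm I (shear s \<circ> v) \<le> (1 + CARD('d option + 'm)) * wnorm I v"
  unfolding wnorm_le_iff
proof
  fix f
  have t: "\<bar>shear_coeff s r\<bar> \<le> 1" for r :: "'d option + 'm"
    using assms by (auto simp: shear_coeff_def split: sum.split option.split)
  have "\<bar>minor I (shear s \<circ> v) f\<bar> \<le> \<bar>minor I v f\<bar> + \<bar>\<Sum>k\<in>-I. shear_coeff s (f k) * minor I v (upd f k top_row)\<bar>"
    unfolding minor_shear by linarith
  also have "\<dots> \<le> wnorm I v + (\<Sum>k\<in>-I. 1 * wnorm I v)"
  proof (intro add_mono minor_le_wnorm order_trans[OF sum_abs] sum_mono)
    fix k
    show "\<bar>shear_coeff s (f k) * minor I v (upd f k top_row)\<bar> \<le> 1 * wnorm I v"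
      unfolding abs_mult by (intro mult_mono t minor_le_wnorm) auto
  qed
  also have "\<dots> \<le> wnorm I v + CARD('d option + 'm) * wnorm I v"
  proof -
    have "card (- I) \<le> CARD('d option + 'm)" by (rule card_mono) auto
    then have "real (card (- I)) * wnorm I v \<le> real CARD('d option + 'm) * wnorm I v"
      by (intro mult_right_mono wnorm_nonneg) (simp only: of_nat_le_iff)
    then show ?thesis by simp
  qed
  finally show "\<bar>minor I (shear s \<circ> v) f\<bar> \<le> (1 + CARD('d option + 'm)) * wnorm I v"
    by (simp add: algebra_simps)
qed

lemma wnorm_topdil_shear:
  fixes v :: "'d::finite option + 'm::finite \<Rightarrow> real ^ ('d option + 'm)"
  assumes s: "\<And>a. \<bar>s $ a\<bar> \<le> 1" and M: "1 \<le> M"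
  shows "wnorm I v \<le> (1 + CARD('d option + 'm)) * wnorm I (topdil M \<circ> shear s \<circ> v)"
    and "wnorm I (topdil M \<circ> shear s \<circ> v) \<le> M * ((1 + CARD('d option + 'm)) * wnorm I v)"
proof -
  have "wnorm I v = wnorm I (shear (- s) \<circ> (shear s \<circ> v))"
    by (rule wnorm_cong) (simp add: shear_add shear_0)
  also have "\<dots> \<le> (1 + CARD('d option + 'm)) * wnorm I (shear s \<circ> v)"
    by (rule wnorm_shear_le) (use s in auto)
  also have "wnorm I (shear s \<circ> v) \<le> wnorm I (topdil M \<circ> (shear s \<circ> v))"
    unfolding wnorm_le_iff using minor_topdil(2)[OF M] minor_le_wnorm by (blast intro: order_trans)
  finally show "wnorm I v \<le> (1 + CARD('d option + 'm)) * wnorm I (topdil M \<circ> shear s \<circ> v)"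
    by (simp add: comp_assoc mult_left_mono)
  have "\<bar>minor I (topdil M \<circ> (shear s \<circ> v)) f\<bar> \<le> M * wnorm I (shear s \<circ> v)" for f
    using order_trans[OF minor_topdil(3)[OF M, of I "shear s \<circ> v" f] mult_left_mono[OF minor_le_wnorm[of I "shear s \<circ> v" f], of M]] M
    by simp
  then have "wnorm I (topdil M \<circ> shear s \<circ> v) \<le> M * wnorm I (shear s \<circ> v)"
    by (simp add: wnorm_le_iff comp_assoc)
  also have "\<dots> \<le> M * ((1 + CARD('d option + 'm)) * wnorm I v)"
    using M by (intro mult_left_mono wnorm_shear_le s) auto
  finally show "wnorm I (topdil M \<circ> shear s \<circ> v) \<le> M * ((1 + CARD('d option + 'm)) * wnorm I v)" .
qed

subsection \<open>Counting grid points\<close>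

definition grid :: "nat \<Rightarrow> ('d::finite \<Rightarrow> nat) set" where
  "grid M = UNIV \<rightarrow>\<^sub>E {..<M}"

definition grid_pt :: "nat \<Rightarrow> ('d::finite \<Rightarrow> nat) \<Rightarrow> real ^ 'd" where
  "grid_pt M j = (\<chi> a. real (j a) / real M)"

lemma grid_iff: "j \<in> grid M \<longleftrightarrow> (\<forall>a. j a < M)"
  by (auto simp: grid_def PiE_def)

lemma finite_grid: "finite (grid M)"
  unfolding grid_def by (intro finite_PiE) auto

lemma card_grid: "card (grid M :: ('d::finite \<Rightarrow> nat) set) = M ^ CARD('d)"
  unfolding grid_def by (subst card_PiE) auto

lemma grid_pt_abs_le: "j \<in> grid M \<Longrightarrow> \<bar>grid_pt M j $ a\<bar> \<le> 1"
  by (auto simp: grid_iff grid_pt_def divide_simps less_imp_le)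

lemma card_nat_near:
  assumes "0 \<le> r"
  shows "finite {x::nat. \<bar>real x - c\<bar> \<le> r}" "real (card {x::nat. \<bar>real x - c\<bar> \<le> r}) \<le> 2 * r + 1"
proof -
  have sub: "{x::nat. \<bar>real x - c\<bar> \<le> r} \<subseteq> nat ` {\<lceil>c - r\<rceil>..\<lfloor>c + r\<rfloor>}"
  proof
    fix x assume "x \<in> {x::nat. \<bar>real x - c\<bar> \<le> r}"
    then have "\<lceil>c - r\<rceil> \<le> int x" "int x \<le> \<lfloor>c + r\<rfloor>" by (auto simp: ceiling_le_iff le_floor_iff abs_le_iff)
    then show "x \<in> nat ` {\<lceil>c - r\<rceil>..\<lfloor>c + r\<rfloor>}" by (intro image_eqI[of _ _ "int x"]) auto
  qed
  then show "finite {x::nat. \<bar>real x - c\<bar> \<le> r}" by (rule finite_subset) simp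
  have "card {x::nat. \<bar>real x - c\<bar> \<le> r} \<le> card {\<lceil>c - r\<rceil>..\<lfloor>c + r\<rfloor>}"
    using card_mono[OF _ sub] card_image_le[of "{\<lceil>c - r\<rceil>..\<lfloor>c + r\<rfloor>}" nat] by simp
  then have "real (card {x::nat. \<bar>real x - c\<bar> \<le> r}) \<le> real (nat (\<lfloor>c + r\<rfloor> - \<lceil>c - r\<rceil> + 1))" by simp
  also have "\<dots> \<le> 2 * r + 1"
    using assms by (cases "\<lfloor>c + r\<rfloor> - \<lceil>c - r\<rceil> + 1 \<ge> 0") (simp_all, linarith)
  finally show "real (card {x::nat. \<bar>real x - c\<bar> \<le> r}) \<le> 2 * r + 1" .
qed

text \<open>Once the coordinates outside \<open>S\<close> are fixed, so are the targets
  \<open>g a j\<close>, and each coordinate in \<open>S\<close> has at most \<open>2 * r + 1\<close>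
  values left.\<close>

lemma card_grid_constraints:
  fixes g :: "'d::finite \<Rightarrow> ('d \<Rightarrow> nat) \<Rightarrow> real"
  assumes g: "\<And>a j j'. a \<in> S \<Longrightarrow> (\<And>b. b \<notin> S \<Longrightarrow> j b = j' b) \<Longrightarrow> g a j = g a j'" and r: "0 \<le> r"
  shows "real (card {j \<in> grid M. \<forall>a\<in>S. \<bar>real (j a) - g a j\<bar> \<le> r}) \<le> (2 * r + 1) ^ card S * real M ^ (CARD('d) - card S)"
proof -
  let ?A = "{j \<in> grid M. \<forall>a\<in>S. \<bar>real (j a) - g a j\<bar> \<le> r}"
  let ?ext = "\<lambda>u b. if b \<in> S then 0 else u b :: nat"
  let ?B = "\<lambda>u. PiE S (\<lambda>a. {x. \<bar>real x - g a (?ext u)\<bar> \<le> r})"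
  let ?U = "PiE (- S) (\<lambda>_. {..<M})"
  let ?\<Phi> = "\<lambda>j. (restrict j (- S), restrict j S)"
  have inj: "inj_on ?\<Phi> ?A"
  proof (rule inj_onI)
    fix j j' :: "'d \<Rightarrow> nat" assume "?\<Phi> j = ?\<Phi> j'"
    then have *: "restrict j (- S) = restrict j' (- S)" "restrict j S = restrict j' S" by simp_all
    show "j = j'"
    proof
      fix a show "j a = j' a"
        using fun_cong[OF *(1), of a] fun_cong[OF *(2), of a] by (cases "a \<in> S") auto
    qed
  qed
  have finB: "finite (?B u)" for u using card_nat_near(1)[OF r] by (intro finite_PiE) auto
  have finU: "finite ?U" by (intro finite_PiE) auto
  have sub: "?\<Phi> ` ?A \<subseteq> Sigma ?U ?B"
  proof
    fix p assume "p \<in> ?\<Phi> ` ?A"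
    then obtain j where j: "j \<in> grid M" "\<And>a. a \<in> S \<Longrightarrow> \<bar>real (j a) - g a j\<bar> \<le> r" "p = ?\<Phi> j" by blast
    have "g a (?ext (restrict j (- S))) = g a j" if "a \<in> S" for a using that by (intro g) auto
    then show "p \<in> Sigma ?U ?B" using j by (auto simp: grid_iff)
  qed
  have "card ?A = card (?\<Phi> ` ?A)" using inj by (rule card_image[symmetric])
  also have "\<dots> \<le> card (Sigma ?U ?B)" using finU finB sub by (intro card_mono finite_SigmaI) auto
  also have "\<dots> = (\<Sum>u\<in>?U. card (?B u))" using finU finB by (intro card_SigmaI) auto
  finally have "real (card ?A) \<le> (\<Sum>u\<in>?U. real (card (?B u)))" by (simp flip: of_nat_sum)
  also have "\<dots> \<le> (\<Sum>u\<in>?U. (2 * r + 1) ^ card S)"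
  proof (rule sum_mono)
    fix u
    have "real (card (?B u)) = (\<Prod>a\<in>S. real (card {x. \<bar>real x - g a (?ext u)\<bar> \<le> r}))"
      by (subst card_PiE) auto
    also have "\<dots> \<le> (\<Prod>a\<in>S. 2 * r + 1)" using card_nat_near(2)[OF r] by (intro prod_mono) auto
    finally show "real (card (?B u)) \<le> (2 * r + 1) ^ card S" by simp
  qed
  also have "\<dots> = (2 * r + 1) ^ card S * real M ^ (CARD('d) - card S)"
    by (simp add: card_PiE Compl_eq_Diff_UNIV card_Diff_subset mult.commute)
  finally show ?thesis .
qed

subsection \<open>Counting grid points with a small minor\<close>

lemma card_sum_rows_gt_1: "1 < CARD('d::finite option + 'm::finite)"
proof -
  have "0 < CARD('d)" "0 < CARD('m)" by (simp_all add: card_gt_0_iff)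
  then show ?thesis by (simp add: card_option)
qed

lemma yrank_le: "yrank I f \<le> CARD('d) + 1" for I :: "('d::finite option + 'm::finite) set"
  by (simp add: yrank_def)

text \<open>As \<open>f k0\<close> hits the top row, all \<open>Y\<close>-rows of the minor are of
  the form \<open>Inl (Some a)\<close>. Their number is the number of independent linear conditions
  in the count below.\<close>

lemma card_unhit_rows:
  fixes f :: "'d::finite option + 'm::finite \<Rightarrow> 'd option + 'm"
  assumes inj: "inj_on f (- I)" and k0: "k0 \<notin> I" "f k0 = top_row"
  shows "card {a. Inl (Some a) \<notin> f ` (- I)} = yrank I f"
proof -
  let ?H = "{k \<in> - I. f k \<in> range Inl}"
  let ?S = "{a. Inl (Some a) \<notin> f ` (- I)}"
  have "range Inl - f ` ?H = (\<lambda>a. Inl (Some a)) ` ?S"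
  proof (intro equalityI subsetI)
    fix r assume r: "r \<in> range Inl - f ` ?H"
    then obtain x where x: "r = Inl x" by blast
    have "r \<notin> f ` (- I)"
    proof
      assume "r \<in> f ` (- I)"
      then have "r \<in> f ` ?H" using x by blast
      then show False using r by blast
    qed
    moreover have "top_row \<in> f ` (- I)" using k0 by (metis ComplI image_eqI)
    ultimately have "x \<noteq> None" using x by metis
    then obtain a where "x = Some a" by blast
    then show "r \<in> (\<lambda>a. Inl (Some a)) ` ?S" using \<open>r \<notin> f ` (- I)\<close> x by blast
  qed auto
  then have "card (range Inl - f ` ?H) = card ?S"
    by (simp add: card_image inj_on_def)
  moreover have "card (range Inl - f ` ?H) = card (range Inl :: ('d option + 'm) set) - card (f ` ?H)"
    by (rule card_Diff_subset) auto
  moreover have "card (f ` ?H) = card ?H"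
    by (rule card_image) (rule inj_on_subset[OF inj], auto)
  ultimately show ?thesis by (simp add: yrank_def card_yrows)
qed

context
  fixes I :: "('d::finite option + 'm::finite) set" and e :: "'d option + 'm \<Rightarrow> real ^ ('d option + 'm)" and M :: nat
  assumes M: "1 \<le> M"
begin

text \<open>Only minors through the top row are expanded by \<open>M\<close>. After division by
  \<open>M\<close> they are exactly those minors of the sheared family.\<close>

definition sheared_norm :: "('d \<Rightarrow> nat) \<Rightarrow> real" where
  "sheared_norm j = wnorm I (topdil (real M) \<circ> shear (grid_pt M j) \<circ> e) / real M"

lemma minor_le_sheared_norm:
  assumes "top_row \<notin> f ` (- I)"
  shows "\<bar>minor I (shear (grid_pt M j) \<circ> e) f\<bar> \<le> sheared_norm j"
  using minor_topdil(1)[OF assms, of "real M" "shear (grid_pt M j) \<circ> e"]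
    minor_le_wnorm[of I "topdil (real M) \<circ> (shear (grid_pt M j) \<circ> e)" f] M
  by (simp add: sheared_norm_def comp_assoc abs_mult field_simps)

lemma sheared_norm_bounds:
  assumes "j \<in> grid M"
  shows "wnorm I e / ((1 + CARD('d option + 'm)) * real M) \<le> sheared_norm j"
    and "sheared_norm j \<le> (1 + CARD('d option + 'm)) * wnorm I e"
proof -
  define c where "c = real (1 + CARD('d option + 'm))"
  define W where "W = wnorm I (topdil (real M) \<circ> shear (grid_pt M j) \<circ> e)"
  have c: "0 < c" unfolding c_def by linarith
  have "wnorm I e \<le> c * W" "W \<le> real M * (c * wnorm I e)"
    using wnorm_topdil_shear[of "grid_pt M j" "real M" I e] grid_pt_abs_le[OF assms] M
    by (simp_all only: c_def W_def)
  then have "wnorm I e / (c * real M) \<le> W / real M" "W / real M \<le> c * wnorm I e"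
    using c M by (simp_all add: field_simps)
  then show "wnorm I e / ((1 + CARD('d option + 'm)) * real M) \<le> sheared_norm j"
    and "sheared_norm j \<le> (1 + CARD('d option + 'm)) * wnorm I e"
    unfolding sheared_norm_def c_def W_def by simp_all
qed

text \<open>The minor of \<open>f\<close> omits the top row and contains the rows
  \<open>Some a\<close> with \<open>a \<in> S\<close>. Replacing one of them by the top row gives a
  minor that after the shear is a remainder minus \<open>s $ a\<close> times the original minor, and
  the remainder involves only coordinates of \<open>s\<close> outside \<open>S\<close>. A small norm
  therefore imposes \<open>card S\<close> independent conditions.\<close>

lemma count_minor_top:
  fixes q :: real
  assumes k0: "k0 \<notin> I" "f k0 = top_row" and D: "minor I e f \<noteq> 0"
    and q: "wnorm I e \<le> (1 + CARD('d option + 'm)) * real M * q"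
  shows "real (card {j \<in> grid M. sheared_norm j \<le> q})
    \<le> ((real CARD('d option + 'm) + 3) * q / \<bar>minor I e f\<bar>) ^ yrank I f * real M ^ CARD('d)"
proof -
  define N where "N = real CARD('d option + 'm)"
  define m where "m = minor I e f"
  define S where "S = {a. Inl (Some a) \<notin> f ` (- I)}"
  have inj: "inj_on f (- I)" using D by (rule minor_inj)
  have cS: "card S = yrank I f" unfolding S_def by (rule card_unhit_rows[OF inj k0])
  have N: "0 \<le> N" by (simp add: N_def)
  have m0: "0 < \<bar>m\<bar>" using D by (simp add: m_def)
  have "\<bar>m\<bar> \<le> (1 + N) * real M * q"
    using minor_le_wnorm[of I e f] q by (simp add: m_def N_def)
  \<comment> \<open>The lower bound on \<open>q\<close> is the smallest value that
    \<open>sheared_norm\<close> can have up to constants; it lets the summand 1 of the count be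
    absorbed into the main term.\<close>
  then have rM: "1 \<le> (1 + N) * (real M * q / \<bar>m\<bar>)" using m0 by (simp add: field_simps)
  have "0 < (1 + N) * (real M * q / \<bar>m\<bar>)" using rM by linarith
  then have r0: "0 \<le> real M * q / \<bar>m\<bar>" using N by (metis add_pos_nonneg less_eq_real_def zero_less_mult_pos zero_less_one)
  define f' where "f' a = upd f k0 (Inl (Some a))" for a
  define R where "R a s = minor I e (f' a) - (\<Sum>k\<in>-I - {k0}. shear_coeff s (f k) * minor I e (upd (f' a) k top_row))" for a s
  define g where "g a j = real M * R a (grid_pt M j) / m" for a j
  have "{j \<in> grid M. sheared_norm j \<le> q} \<subseteq> {j \<in> grid M. \<forall>a\<in>S. \<bar>real (j a) - g a j\<bar> \<le> real M * q / \<bar>m\<bar>}"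
  proof (clarsimp)
    fix j a assume j: "j \<in> grid M" "sheared_norm j \<le> q" and a: "a \<in> S"
    let ?s = "grid_pt M j"
    have "top_row \<notin> f' a ` (- I)"
    proof
      assume "top_row \<in> f' a ` (- I)"
      then obtain k where k: "k \<in> - I" "f' a k = top_row" by (metis imageE)
      then have "k \<noteq> k0" "f k = f k0" using k0 by (auto simp: f'_def upd_apply split: if_splits)
      then show False using inj k(1) k0(1) by (meson ComplI inj_onD)
    qed
    then have "\<bar>minor I (shear ?s \<circ> e) (f' a)\<bar> \<le> q" using minor_le_sheared_norm j(2) order_trans by blast
    moreover have "minor I (shear ?s \<circ> e) (f' a) = R a ?s - ?s $ a * m"
    proof -
      have "(\<Sum>k\<in>-I. shear_coeff ?s (f' a k) * minor I e (upd (f' a) k top_row))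
        = shear_coeff ?s (f' a k0) * minor I e (upd (f' a) k0 top_row)
          + (\<Sum>k\<in>-I - {k0}. shear_coeff ?s (f' a k) * minor I e (upd (f' a) k top_row))"
        using k0(1) by (intro sum.remove) auto
      also have "upd (f' a) k0 top_row = f" using k0(2) by (metis f'_def upd_triv upd_upd)
      also have "(\<Sum>k\<in>-I - {k0}. shear_coeff ?s (f' a k) * minor I e (upd (f' a) k top_row))
        = (\<Sum>k\<in>-I - {k0}. shear_coeff ?s (f k) * minor I e (upd (f' a) k top_row))"
        by (intro sum.cong) (auto simp: f'_def upd_apply)
      also have "shear_coeff ?s (f' a k0) = ?s $ a" by (simp add: f'_def upd_apply shear_coeff_def)
      finally show ?thesis unfolding minor_shear R_def m_def by linarith
    qed
    ultimately have "\<bar>R a ?s - ?s $ a * m\<bar> \<le> q" by simp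
    then have "\<bar>(R a ?s - ?s $ a * m) * (real M / m)\<bar> \<le> q * (real M / \<bar>m\<bar>)"
      unfolding abs_mult using m0 M by (intro mult_mono) auto
    moreover have "(R a ?s - ?s $ a * m) * (real M / m) = g a j - real (j a)"
      using m0 M by (simp add: g_def grid_pt_def field_simps)
    ultimately have "\<bar>g a j - real (j a)\<bar> \<le> q * (real M / \<bar>m\<bar>)" by (simp only:)
    then show "\<bar>real (j a) - g a j\<bar> \<le> real M * q / \<bar>m\<bar>" by (simp add: abs_minus_commute mult.commute)
  qed
  then have "real (card {j \<in> grid M. sheared_norm j \<le> q}) \<le> real (card {j \<in> grid M. \<forall>a\<in>S. \<bar>real (j a) - g a j\<bar> \<le> real M * q / \<bar>m\<bar>})"
    by (intro of_nat_mono card_mono finite_subset[OF _ finite_grid]) auto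
  also have "\<dots> \<le> (2 * (real M * q / \<bar>m\<bar>) + 1) ^ card S * real M ^ (CARD('d) - card S)"
  proof (rule card_grid_constraints[OF _ r0])
    fix a and j j' :: "'d \<Rightarrow> nat" assume a: "a \<in> S" and jj: "\<And>b. b \<notin> S \<Longrightarrow> j b = j' b"
    have eq: "shear_coeff (grid_pt M j) (f k) = shear_coeff (grid_pt M j') (f k)" if "k \<in> - I - {k0}" for k
    proof -
      have "b \<notin> S" if "f k = Inl (Some b)" for b
        using \<open>k \<in> - I - {k0}\<close> that by (auto simp: S_def intro: image_eqI[of _ _ k])
      then show ?thesis using jj by (auto simp: shear_coeff_def grid_pt_def split: sum.split option.split)
    qed
    have "R a (grid_pt M j) = R a (grid_pt M j')"
      unfolding R_def by (intro arg_cong2[where f = "(-)"] HOL.refl sum.cong) (simp add: eq)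
    then show "g a j = g a j'" by (simp add: g_def)
  qed
  also have "\<dots> \<le> ((N + 3) * (real M * q / \<bar>m\<bar>)) ^ card S * real M ^ (CARD('d) - card S)"
  proof (intro mult_right_mono power_mono)
    have "(N + 3) * (real M * q / \<bar>m\<bar>) = 2 * (real M * q / \<bar>m\<bar>) + (1 + N) * (real M * q / \<bar>m\<bar>)"
      by (simp only: distrib_right) simp
    then show "2 * (real M * q / \<bar>m\<bar>) + 1 \<le> (N + 3) * (real M * q / \<bar>m\<bar>)" using rM by linarith
  qed (use r0 in auto)
  also have "\<dots> = ((N + 3) * q / \<bar>m\<bar>) ^ card S * (real M ^ card S * real M ^ (CARD('d) - card S))"
    by (simp add: power_mult_distrib[symmetric] mult_ac)
  also have "real M ^ card S * real M ^ (CARD('d) - card S) = real M ^ CARD('d)"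
    unfolding power_add[symmetric] by (simp add: card_mono)
  finally show ?thesis unfolding cS m_def N_def .
qed

text \<open>If the minor contains the top row, the shear changes it by a combination of the minors
  in which the top row is exchanged for some row \<open>Some a\<close>. If one of these is large,
  the previous count applies to it with the same rank; otherwise the minor keeps half its size on
  the whole grid.\<close>

lemma count_minor:
  fixes q :: real
  assumes D: "minor I e f \<noteq> 0" and y: "yrank I f \<le> CARD('d)"
    and q: "wnorm I e \<le> (1 + CARD('d option + 'm)) * real M * q"
  shows "real (card {j \<in> grid M. sheared_norm j \<le> q})
    \<le> (2 * real CARD('d option + 'm) * (real CARD('d option + 'm) + 3) * q / \<bar>minor I e f\<bar>) ^ yrank I f * real M ^ CARD('d)"
proof -
  define N where "N = real CARD('d option + 'm)"
  define m where "m = \<bar>minor I e f\<bar>"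
  define A where "A = {j \<in> grid M. sheared_norm j \<le> q}"
  have N: "1 \<le> N" using card_sum_rows_gt_1[where 'd = 'd and 'm = 'm] unfolding N_def by linarith
  have m0: "0 < m" using D by (simp add: m_def)
  have "m \<le> (1 + N) * real M * q"
    using minor_le_wnorm[of I e f] q by (simp add: m_def N_def)
  then have "0 < (1 + N) * real M * q" using m0 by linarith
  moreover have "0 < (1 + N) * real M" using N M by simp
  ultimately have q0: "0 < q" by (metis zero_less_mult_pos)
  have cA: "real (card A) \<le> real M ^ CARD('d)"
  proof -
    have "card A \<le> card (grid M :: ('d \<Rightarrow> nat) set)"
      by (rule card_mono[OF finite_grid]) (simp add: A_def)
    then show ?thesis by (simp add: card_grid flip: of_nat_power)
  qed
  have goal: "real (card A) \<le> (2 * N * (N + 3) * q / m) ^ yrank I f * real M ^ CARD('d)"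
  proof (cases "\<exists>k0. k0 \<notin> I \<and> f k0 = top_row")
    case True
    then obtain k0 where k0: "k0 \<notin> I" "f k0 = top_row" by blast
    have "real (card A) \<le> ((N + 3) * q / m) ^ yrank I f * real M ^ CARD('d)"
      using count_minor_top[of k0 f q, OF k0 D q] by (simp add: A_def N_def m_def)
    also have "\<dots> \<le> (2 * N * (N + 3) * q / m) ^ yrank I f * real M ^ CARD('d)"
      using N q0 m0 by (intro mult_right_mono power_mono divide_right_mono) auto
    finally show ?thesis .
  next
    case False
    then have nt: "top_row \<notin> f ` (- I)" by auto
    show ?thesis
    proof (cases "\<exists>k\<in>-I. (\<exists>a. f k = Inl (Some a)) \<and> m / (2 * N) \<le> \<bar>minor I e (upd f k top_row)\<bar>")
      case True
      then obtain k a where k: "k \<in> - I" "f k = Inl (Some a)" "m / (2 * N) \<le> \<bar>minor I e (upd f k top_row)\<bar>" by blast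
      let ?f = "upd f k top_row"
      have m': "0 < \<bar>minor I e ?f\<bar>" using k(3) m0 N by (smt (verit) divide_pos_pos)
      have "{l \<in> - I. ?f l \<in> range Inl} = {l \<in> - I. f l \<in> range Inl}" using k(2) by (auto simp: upd_apply)
      then have yr: "yrank I ?f = yrank I f" by (simp add: yrank_def)
      have "real (card A) \<le> ((N + 3) * q / \<bar>minor I e ?f\<bar>) ^ yrank I ?f * real M ^ CARD('d)"
        using count_minor_top[of k ?f q] k(1) m' q by (simp add: A_def N_def upd_apply)
      also have "\<dots> \<le> (2 * N * (N + 3) * q / m) ^ yrank I f * real M ^ CARD('d)"
        unfolding yr
      proof (intro mult_right_mono power_mono)
        have "(N + 3) * q / \<bar>minor I e ?f\<bar> \<le> (N + 3) * q / (m / (2 * N))"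
          using k(3) m0 N q0 m' by (intro divide_left_mono mult_pos_pos) auto
        then show "(N + 3) * q / \<bar>minor I e ?f\<bar> \<le> 2 * N * (N + 3) * q / m" by (simp add: field_simps)
      qed (use N q0 in auto)
      finally show ?thesis .
    next
      case no: False
      \<comment> \<open>At most N terms, each at most \<open>m / (2 * N)\<close>, move the minor by
        at most half of its size.\<close>
      have half: "m / 2 \<le> sheared_norm j" if j: "j \<in> grid M" for j
      proof -
        let ?s = "grid_pt M j"
        have "\<bar>\<Sum>k\<in>-I. shear_coeff ?s (f k) * minor I e (upd f k top_row)\<bar> \<le> (\<Sum>k\<in>-I. m / (2 * N))"
        proof (rule order_trans[OF sum_abs], rule sum_mono)
          fix k assume k: "k \<in> - I"
          show "\<bar>shear_coeff ?s (f k) * minor I e (upd f k top_row)\<bar> \<le> m / (2 * N)"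
          proof (cases "\<exists>a. f k = Inl (Some a)")
            case True
            then have le: "\<bar>minor I e (upd f k top_row)\<bar> \<le> m / (2 * N)" using no k by force
            have "\<bar>shear_coeff ?s (f k)\<bar> \<le> 1" using True grid_pt_abs_le[OF j] by (auto simp: shear_coeff_def)
            then have "\<bar>shear_coeff ?s (f k)\<bar> * \<bar>minor I e (upd f k top_row)\<bar> \<le> 1 * (m / (2 * N))"
              using le by (intro mult_mono) auto
            then show ?thesis by (simp add: abs_mult)
          next
            case False
            then have "shear_coeff ?s (f k) = 0" by (auto simp: shear_coeff_def split: sum.split option.split)
            then show ?thesis using m0 N by simp
          qed
        qed
        also have "\<dots> = real (card (- I)) * (m / (2 * N))" by simp
        also have "\<dots> \<le> N * (m / (2 * N))"
        proof (rule mult_right_mono)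
          have "card (- I) \<le> CARD('d option + 'm)" by (rule card_mono) auto
          then show "real (card (- I)) \<le> N" unfolding N_def by (simp only: of_nat_le_iff)
        qed (use m0 N in simp)
        also have "\<dots> = m / 2" using N by simp
        finally have "m / 2 \<le> \<bar>minor I (shear ?s \<circ> e) f\<bar>" unfolding minor_shear m_def by linarith
        then show ?thesis using minor_le_sheared_norm[OF nt, of j] by linarith
      qed
      show ?thesis
      proof (cases "q < m / 2")
        case True
        then have "A = {}" using half by (force simp: A_def)
        then show ?thesis using N q0 m0 by simp
      next
        case False
        have "1 * m \<le> (N * (N + 3)) * (2 * q)"
          using False N mult_mono[of 1 N 1 "N + 3"] m0 by (intro mult_mono) auto
        then have "1 \<le> 2 * N * (N + 3) * q / m" using m0 by (simp add: field_simps)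
        then have "1 \<le> (2 * N * (N + 3) * q / m) ^ yrank I f" by (rule one_le_power)
        then have "1 * real M ^ CARD('d) \<le> (2 * N * (N + 3) * q / m) ^ yrank I f * real M ^ CARD('d)"
          by (intro mult_right_mono) auto
        then show ?thesis using cA by linarith
      qed
    qed
  qed
  then show ?thesis unfolding A_def N_def m_def .
qed

text \<open>When all d + 1 \<open>Y\<close>-rows belong to the minor, none of them is hit by
  \<open>f\<close>, and the shear leaves the minor unchanged.\<close>

lemma count_minor_full:
  assumes D: "minor I e f \<noteq> 0" and y: "yrank I f = CARD('d) + 1" and q: "q < \<bar>minor I e f\<bar>"
  shows "{j \<in> grid M. sheared_norm j \<le> q} = {}"
proof -
  have "card {k \<in> - I. f k \<in> range Inl} = 0" using y unfolding yrank_def by arith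
  then have no: "f k \<notin> range Inl" if "k \<in> - I" for k using that by (auto simp: card_eq_0_iff)
  then have nt: "top_row \<notin> f ` (- I)" by (metis imageE rangeI)
  have "shear_coeff s (f k) = 0" if "k \<in> - I" for s k
    using no[OF that] by (auto simp: shear_coeff_def split: sum.split)
  then have "minor I (shear s \<circ> e) f = minor I e f" for s unfolding minor_shear by simp
  then have "\<bar>minor I e f\<bar> \<le> sheared_norm j" for j using minor_le_sheared_norm[OF nt, of j] by metis
  then have "\<not> sheared_norm j \<le> q" for j using q by (meson not_le order.strict_trans2)
  then show ?thesis by blast
qed

end

text \<open>A quantitative basis exchange. A \<open>Y\<close>-unit vector missing from the maximal
  minor \<open>fb\<close> is expanded in the basis of \<open>fb\<close>, with coefficients at most 1
  on the unit rows by maximality, and substituted in its row of \<open>fa\<close>. A surviving term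
  puts a unit row outside \<open>Y\<close> there, because \<open>fa\<close> already hits all
  \<open>Y\<close>-rows; so its rank is exactly 1. The purpose is to leave rank 0, where the count
  says nothing.\<close>

lemma exchange_minor:
  fixes v :: "'d::finite option + 'm::finite \<Rightarrow> real ^ ('d option + 'm)"
  assumes a: "minor I v fa \<noteq> 0" "yrank I fa = 0"
    and b: "\<bar>minor I v fb\<bar> = wnorm I v" "1 \<le> yrank I fb"
  shows "\<exists>f. yrank I f = 1 \<and> \<bar>minor I v fa\<bar> / CARD('d option + 'm) \<le> \<bar>minor I v f\<bar>"
proof -
  let ?N = "real CARD('d option + 'm)"
  have N0: "0 < ?N" using card_sum_rows_gt_1[where 'd = 'd and 'm = 'm] by simp
  have b0: "minor I v fb \<noteq> 0" using a(1) b(1) minor_le_wnorm[of I v fa] by auto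
  let ?Ha = "{k \<in> - I. fa k \<in> range Inl}" and ?Hb = "{k \<in> - I. fb k \<in> range Inl}"
  have ia: "inj_on fa (- I)" and ib: "inj_on fb (- I)" using a(1) b0 minor_inj by auto
  have ca: "card (fa ` ?Ha) = CARD('d) + 1"
  proof -
    have "card ?Ha = CARD('d) + 1" using card_yhits_le[OF ia] a(2) unfolding yrank_def by arith
    moreover have "card (fa ` ?Ha) = card ?Ha" by (rule card_image) (rule inj_on_subset[OF ia], auto)
    ultimately show ?thesis by (simp only:)
  qed
  have alla: "fa ` ?Ha = range Inl"
  proof (rule card_subset_eq)
    show "card (fa ` ?Ha) = card (range Inl :: ('d option + 'm) set)" unfolding ca card_yrows ..
  qed auto
  have "card (fb ` ?Hb) < card (range Inl :: ('d option + 'm) set)"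
  proof -
    have "card (fb ` ?Hb) = card ?Hb" by (rule card_image) (rule inj_on_subset[OF ib], auto)
    then show ?thesis using b(2) by (simp add: yrank_def card_yrows)
  qed
  then have "\<not> range Inl \<subseteq> fb ` ?Hb" using card_mono[of "fb ` ?Hb" "range Inl"] by auto
  then obtain y where y: "y \<in> range Inl" "y \<notin> fb ` ?Hb" by blast
  obtain k1 where k1: "k1 \<in> - I" "fa k1 = y" using y(1) alla by (metis (no_types, lifting) imageE mem_Collect_eq)
  let ?A = "padded I v fa" and ?B = "padded I v fb"
  define t where "t k = rowdet (upd ?B k (axis y 1)) / rowdet ?B" for k
  have "axis y 1 = (\<Sum>k\<in>UNIV. t k *\<^sub>R ?B k)"
    unfolding t_def by (rule rowdet_expand) (use b0 in \<open>simp add: minor_def\<close>)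
  then have "rowdet (upd ?A k1 (axis y 1)) = rowdet (upd ?A k1 (\<Sum>k\<in>UNIV. t k *\<^sub>R ?B k))" by simp
  also have "\<dots> = (\<Sum>k\<in>UNIV. t k * rowdet (upd ?A k1 (?B k)))"
    unfolding rowdet_sum rowdet_scale ..
  also have "\<dots> = (\<Sum>k\<in>-I. t k * minor I v (upd fa k1 (fb k)))"
  proof (rule sum.mono_neutral_cong_right)
    show "\<forall>k\<in>UNIV - - I. t k * rowdet (upd ?A k1 (?B k)) = 0"
    proof
      fix k assume "k \<in> UNIV - - I"
      then have "rowdet (upd ?A k1 (?B k)) = 0"
        using k1(1) by (intro rowdet_eq_0[of k k1]) (auto simp: upd_apply padded_def)
      then show "t k * rowdet (upd ?A k1 (?B k)) = 0" by simp
    qed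
    fix k assume "k \<in> - I"
    then have "upd ?A k1 (?B k) = padded I v (upd fa k1 (fb k))"
      using k1(1) by (intro ext) (auto simp: upd_apply padded_def)
    then show "t k * rowdet (upd ?A k1 (?B k)) = t k * minor I v (upd fa k1 (fb k))" by (simp add: minor_def)
  qed auto
  also have "rowdet (upd ?A k1 (axis y 1)) = minor I v fa"
  proof -
    have "upd ?A k1 (axis y 1) = ?A" using k1 by (intro ext) (auto simp: upd_apply padded_def)
    then show ?thesis by (simp add: minor_def)
  qed
  finally have eq: "minor I v fa = (\<Sum>k\<in>-I. t k * minor I v (upd fa k1 (fb k)))" .
  have t1: "\<bar>t k\<bar> \<le> 1" if "k \<in> - I" for k
  proof -
    have "upd ?B k (axis y 1) = padded I v (upd fb k y)"
      using that by (intro ext) (auto simp: upd_apply padded_def)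
    then have "\<bar>rowdet (upd ?B k (axis y 1))\<bar> \<le> \<bar>rowdet ?B\<bar>"
      using minor_le_wnorm[of I v "upd fb k y"] b(1) by (simp add: minor_def)
    then show ?thesis using b0 by (simp add: t_def minor_def)
  qed
  have "\<exists>k\<in>-I. \<bar>minor I v fa\<bar> / ?N \<le> \<bar>minor I v (upd fa k1 (fb k))\<bar>"
  proof (rule ccontr)
    assume "\<not> ?thesis"
    then have lt: "\<bar>minor I v (upd fa k1 (fb k))\<bar> < \<bar>minor I v fa\<bar> / ?N" if "k \<in> - I" for k
      using that by force
    have "\<bar>minor I v fa\<bar> \<le> (\<Sum>k\<in>-I. \<bar>t k * minor I v (upd fa k1 (fb k))\<bar>)"
      unfolding eq by (rule sum_abs)
    also have "\<dots> < (\<Sum>k\<in>-I. \<bar>minor I v fa\<bar> / ?N)"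
    proof (rule sum_strict_mono)
      show "- I \<noteq> {}" using k1 by blast
      fix k assume k: "k \<in> - I"
      have "\<bar>t k\<bar> * \<bar>minor I v (upd fa k1 (fb k))\<bar> \<le> 1 * \<bar>minor I v (upd fa k1 (fb k))\<bar>"
        using t1[OF k] by (intro mult_right_mono) auto
      then show "\<bar>t k * minor I v (upd fa k1 (fb k))\<bar> < \<bar>minor I v fa\<bar> / ?N" using lt[OF k] by (simp add: abs_mult)
    qed simp
    also have "\<dots> = real (card (- I)) * (\<bar>minor I v fa\<bar> / ?N)" by simp
    also have "\<dots> \<le> ?N * (\<bar>minor I v fa\<bar> / ?N)"
    proof (rule mult_right_mono)
      have "card (- I) \<le> CARD('d option + 'm)" by (rule card_mono) auto
      then show "real (card (- I)) \<le> ?N" by (simp only: of_nat_le_iff)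
    qed (use N0 in simp)
    finally show False using N0 by simp
  qed
  then obtain k where k: "k \<in> - I" "\<bar>minor I v fa\<bar> / ?N \<le> \<bar>minor I v (upd fa k1 (fb k))\<bar>" by blast
  let ?f = "upd fa k1 (fb k)"
  have "0 < \<bar>minor I v fa\<bar> / ?N" using a(1) N0 by (intro divide_pos_pos) auto
  then have "minor I v ?f \<noteq> 0" using k(2) by auto
  then have inj: "inj_on ?f (- I)" by (rule minor_inj)
  have nY: "fb k \<notin> range Inl"
  proof
    assume Y: "fb k \<in> range Inl"
    then have "fb k \<noteq> y" using y(2) k(1) by blast
    obtain k' where k': "k' \<in> - I" "fa k' = fb k" using Y alla by (metis (no_types, lifting) imageE mem_Collect_eq)
    have "k' \<noteq> k1" using k' k1(2) \<open>fb k \<noteq> y\<close> by auto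
    moreover have "?f k' = ?f k1" using \<open>k' \<noteq> k1\<close> k'(2) by (simp add: upd_apply)
    ultimately show False using inj k'(1) k1(1) by (meson inj_onD)
  qed
  have "{l \<in> - I. ?f l \<in> range Inl} = ?Ha - {k1}" using nY by (auto simp: upd_apply)
  moreover have "k1 \<in> ?Ha" using k1 y(1) by simp
  moreover have "card ?Ha = CARD('d) + 1" using ca by (metis (no_types, lifting) card_image ia inj_on_subset mem_Collect_eq subsetI)
  ultimately have "yrank I ?f = 1" by (simp add: yrank_def)
  then show ?thesis using k(2) by blast
qed

subsection \<open>Averages of minors over the grid\<close>

text \<open>With \<open>x = ln X\<close> and \<open>y = - ln \<rho>\<close>, the available counts
  have the exponents 0, \<open>a * (y - a * x)\<close> and \<open>b * (y - b * x)\<close>. Their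
  maximum is convex and piecewise linear in \<open>y\<close> with kinks at \<open>a * x\<close> and
  \<open>(a + b) * x\<close>, so the linear function on the left need only be compared at the kinks
  and by the outer slopes.\<close>

lemma exponent_interpolation:
  fixes x y a b D \<beta> :: real
  assumes x: "0 \<le> x" and a: "1 \<le> a" "a \<le> b" "b \<le> D" and \<beta>: "0 < \<beta>" "D \<le> \<beta> * (D + 1 - a)" "\<beta> * (D + 1 - b) \<le> D"
  shows "\<beta> * y - (\<beta> * (D + 1) - D) * x \<le> 0 \<or> \<beta> * y - (\<beta> * (D + 1) - D) * x \<le> a * (y - a * x) \<or>
    \<beta> * y - (\<beta> * (D + 1) - D) * x \<le> b * (y - b * x)"
proof -
  define T where "T = \<beta> * (D + 1) - D"
  \<comment> \<open>The function \<open>t * (D + 1 - t)\<close> is concave and takes the value D at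
    1 and at D.\<close>
  have ab: "D \<le> a * (D + 1 - a)" "D \<le> b * (D + 1 - b)"
    using mult_nonneg_nonneg[of "a - 1" "D - a"] mult_nonneg_nonneg[of "b - 1" "D - b"] a
    by (simp_all add: algebra_simps)
  \<comment> \<open>The comparison at the kink \<open>y = (a + b) * x\<close>; the one at
    \<open>y = a * x\<close> is \<open>aT\<close>.\<close>
  have key: "\<beta> * (a + b) \<le> T + a * b"
  proof (cases "b \<le> D + 1 - a")
    case True
    have P: "0 < D + 1 - a" using a by simp
    have "D / (D + 1 - a) \<le> \<beta>" using \<beta>(2) P by (simp add: field_simps)
    then have "D / (D + 1 - a) * (D + 1 - a - b) \<le> \<beta> * (D + 1 - a - b)" using True by (intro mult_right_mono) auto
    moreover have "D / (D + 1 - a) * (D + 1 - a - b) = D - b * (D / (D + 1 - a))" using P by (simp add: field_simps)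
    moreover have "b * (D / (D + 1 - a)) \<le> b * a" using ab(1) P a by (intro mult_left_mono) (auto simp: field_simps)
    ultimately show ?thesis by (simp add: T_def algebra_simps)
  next
    case False
    have P: "0 < D + 1 - b" using a by simp
    have "\<beta> \<le> D / (D + 1 - b)" using \<beta>(3) P by (simp add: field_simps)
    then have "D / (D + 1 - b) * (D + 1 - b - a) \<le> \<beta> * (D + 1 - b - a)" using False by (intro mult_right_mono_neg) auto
    moreover have "D / (D + 1 - b) * (D + 1 - b - a) = D - a * (D / (D + 1 - b))" using P by (simp add: field_simps)
    moreover have "a * (D / (D + 1 - b)) \<le> a * b" using ab(2) P a by (intro mult_left_mono) (auto simp: field_simps)
    ultimately show ?thesis by (simp add: T_def algebra_simps)
  qed
  have bP: "\<beta> \<le> b"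
  proof -
    have "\<beta> * (D + 1 - b) \<le> b * (D + 1 - b)" using \<beta>(3) ab(2) by linarith
    then show ?thesis using a by simp
  qed
  have aT: "\<beta> * a \<le> T" using \<beta>(2) by (simp add: T_def algebra_simps)
  consider "y \<le> a * x" | "a * x \<le> y" "y \<le> (a + b) * x" | "(a + b) * x \<le> y" by linarith
  then have "\<beta> * y - T * x \<le> 0 \<or> \<beta> * y - T * x \<le> a * (y - a * x) \<or> \<beta> * y - T * x \<le> b * (y - b * x)"
  proof cases
    case 1
    have "\<beta> * y \<le> \<beta> * (a * x)" using 1 \<beta> by (intro mult_left_mono) auto
    also have "\<dots> \<le> T * x" using aT x by (metis mult.assoc mult_right_mono)
    finally show ?thesis by simp
  next
    case 2
    define t where "t = y - a * x"
    have t: "0 \<le> t" "t \<le> b * x" using 2 by (auto simp: t_def algebra_simps)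
    have "0 \<le> (T - \<beta> * a) * x + (a - \<beta>) * t"
    proof (cases "\<beta> \<le> a")
      case True
      then show ?thesis using aT x t by (intro add_nonneg_nonneg mult_nonneg_nonneg) auto
    next
      case False
      have "(a - \<beta>) * (b * x) \<le> (a - \<beta>) * t" using False t by (intro mult_left_mono_neg) auto
      moreover have "0 \<le> (T + a * b - \<beta> * (a + b)) * x" using key x by (intro mult_nonneg_nonneg) auto
      ultimately show ?thesis by (simp add: algebra_simps)
    qed
    then show ?thesis by (simp add: t_def algebra_simps)
  next
    case 3
    have "(b - \<beta>) * ((a + b) * x) \<le> (b - \<beta>) * y" using bP 3 by (intro mult_left_mono) auto
    moreover have "0 \<le> (T + a * b - \<beta> * (a + b)) * x" using key x by (intro mult_nonneg_nonneg) auto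
    ultimately show ?thesis by (simp add: algebra_simps)
  qed
  then show ?thesis by (simp add: T_def)
qed

text \<open>The variant for \<open>b = D + 1\<close>: in place of the second power bound, the count
  is zero for larger \<open>y\<close>, so \<open>y\<close> may be assumed at most
  \<open>(D + 1) * x\<close>.\<close>

lemma exponent_interpolation_full:
  fixes x y a D \<beta> :: real
  assumes x: "0 \<le> x" and a: "1 \<le> a" "a \<le> D" and \<beta>: "0 < \<beta>" "D \<le> \<beta> * (D + 1 - a)" and y: "y \<le> (D + 1) * x"
  shows "\<beta> * y - (\<beta> * (D + 1) - D) * x \<le> 0 \<or> \<beta> * y - (\<beta> * (D + 1) - D) * x \<le> a * (y - a * x)"
proof -
  define T where "T = \<beta> * (D + 1) - D"
  have ab: "D \<le> a * (D + 1 - a)"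
    using mult_nonneg_nonneg[of "a - 1" "D - a"] a by (simp add: algebra_simps)
  have aT: "\<beta> * a \<le> T" using \<beta>(2) by (simp add: T_def algebra_simps)
  consider "y \<le> a * x" | "a * x \<le> y" by linarith
  then have "\<beta> * y - T * x \<le> 0 \<or> \<beta> * y - T * x \<le> a * (y - a * x)"
  proof cases
    case 1
    have "\<beta> * y \<le> \<beta> * (a * x)" using 1 \<beta> by (intro mult_left_mono) auto
    also have "\<dots> \<le> T * x" using aT x by (metis mult.assoc mult_right_mono)
    finally show ?thesis by simp
  next
    case 2
    define t where "t = y - a * x"
    have t: "0 \<le> t" "t \<le> (D + 1 - a) * x" using 2 y by (auto simp: t_def algebra_simps)
    have "0 \<le> (T - \<beta> * a) * x + (a - \<beta>) * t"
    proof (cases "\<beta> \<le> a")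
      case True
      then show ?thesis using aT x t by (intro add_nonneg_nonneg mult_nonneg_nonneg) auto
    next
      case False
      have "(a - \<beta>) * ((D + 1 - a) * x) \<le> (a - \<beta>) * t" using False t by (intro mult_left_mono_neg) auto
      moreover have "0 \<le> (a * (D + 1 - a) - D) * x" using ab x by (intro mult_nonneg_nonneg) auto
      ultimately show ?thesis by (simp add: T_def algebra_simps)
    qed
    then show ?thesis by (simp add: t_def algebra_simps)
  qed
  then show ?thesis by (simp add: T_def)
qed

lemma power_as_exp:
  fixes \<rho> X :: real
  assumes "0 < \<rho>" "0 < X"
  shows "(\<rho> * X ^ a) ^ a = exp (- (real a * (- ln \<rho> - real a * ln X)))"
proof -
  have "(\<rho> * X ^ a) ^ a = exp (ln ((\<rho> * X ^ a) ^ a))" using assms by simp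
  also have "ln ((\<rho> * X ^ a) ^ a) = - (real a * (- ln \<rho> - real a * ln X))"
    using assms by (simp add: ln_realpow ln_mult algebra_simps)
  finally show ?thesis .
qed

lemma powr_as_exp:
  fixes \<rho> X :: real
  assumes "0 < \<rho>" "0 < X"
  shows "\<rho> powr \<beta> * X powr T = exp (- (\<beta> * (- ln \<rho>) - T * ln X))"
proof -
  have "\<rho> powr \<beta> * X powr T = exp (\<beta> * ln \<rho>) * exp (T * ln X)" using assms unfolding powr_def by auto
  also have "\<dots> = exp (\<beta> * ln \<rho> + T * ln X)" by (simp only: exp_add)
  finally show ?thesis by (simp add: algebra_simps)
qed

text \<open>The two conditions on \<open>\<beta>\<close> say that the ranks \<open>a\<close> and
  \<open>b\<close> lie on either side of \<open>d + 1 - d / \<beta>\<close>; the claim is the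
  exponential form of the preceding inequalities.\<close>

lemma power_interpolation:
  fixes \<rho> X \<beta> n :: real and a b d :: nat
  assumes \<rho>: "0 < \<rho>" and X: "1 \<le> X" and a: "1 \<le> a" "a \<le> b" "a \<le> d" "b \<le> d + 1"
    and \<beta>: "0 < \<beta>" "real d \<le> \<beta> * (real d + 1 - a)" "\<beta> * (real d + 1 - b) \<le> real d"
    and n: "n \<le> 1" "n \<le> (\<rho> * X ^ a) ^ a" "b \<le> d \<Longrightarrow> n \<le> (\<rho> * X ^ b) ^ b"
      "b = d + 1 \<Longrightarrow> \<rho> * X ^ (d + 1) < 1 \<Longrightarrow> n \<le> 0"
  shows "n \<le> \<rho> powr \<beta> * X powr (\<beta> * (real d + 1) - real d)"
proof -
  have X0: "0 < X" "0 \<le> ln X" using X by auto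
  let ?y = "- ln \<rho>" and ?x = "ln X"
  let ?E = "\<beta> * ?y - (\<beta> * (real d + 1) - real d) * ?x"
  have R: "\<rho> powr \<beta> * X powr (\<beta> * (real d + 1) - real d) = exp (- ?E)"
    by (rule powr_as_exp[OF \<rho> X0(1)])
  have 0: ?thesis if "?E \<le> 0"
  proof -
    have "1 \<le> exp (- ?E)" using that by simp
    then show ?thesis unfolding R using n(1) by linarith
  qed
  have 1: ?thesis if "?E \<le> real c * (?y - real c * ?x)" "n \<le> (\<rho> * X ^ c) ^ c" for c
  proof -
    have "(\<rho> * X ^ c) ^ c \<le> exp (- ?E)" unfolding power_as_exp[OF \<rho> X0(1)] using that(1) by simp
    then show ?thesis unfolding R using that(2) by linarith
  qed
  show ?thesis
  proof (cases "b \<le> d")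
    case True
    have "?E \<le> 0 \<or> ?E \<le> real a * (?y - real a * ?x) \<or> ?E \<le> real b * (?y - real b * ?x)"
      using X0 a \<beta> True by (intro exponent_interpolation) auto
    then show ?thesis using 0 1 n True by blast
  next
    case False
    then have b: "b = d + 1" using a by simp
    show ?thesis
    proof (cases "\<rho> * X ^ (d + 1) < 1")
      case True
      then show ?thesis using n(4)[OF b True] by (smt (verit) mult_nonneg_nonneg powr_ge_zero)
    next
      case False
      then have "0 \<le> ln (\<rho> * X ^ (d + 1))" using \<rho> X0 by (subst ln_ge_zero_iff) auto
      also have "ln (\<rho> * X ^ (d + 1)) = ln \<rho> + ln (X ^ (d + 1))" using \<rho> X0(1) by (intro ln_mult_pos zero_less_power)
      also have "ln (X ^ (d + 1)) = real (d + 1) * ln X" using X0(1) by (simp only: ln_realpow)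
      finally have "0 \<le> ln \<rho> + (real d + 1) * ?x" by (simp add: add.commute)
      then have "?E \<le> 0 \<or> ?E \<le> real a * (?y - real a * ?x)"
        using X0 a \<beta> by (intro exponent_interpolation_full) auto
      then show ?thesis using 0 1 n by blast
    qed
  qed
qed

text \<open>Follow a dominating minor of the dilated family as \<open>l\<close> grows. Its rank can
  be taken below \<open>thr\<close> for ever, or is at least \<open>thr\<close> at the start, or
  there is a least \<open>l\<close> where it can be at least \<open>thr\<close>. In the last case
  one doubling costs at most \<open>2 ^ (CARD('d) + 1)\<close>, so a minor of low rank is still
  comparable with the dominating one.\<close>

lemma select_scale:
  fixes I :: "('d::finite option + 'm::finite) set" and e :: "'d option + 'm \<Rightarrow> real ^ ('d option + 'm)" and thr :: real
  defines "\<psi> \<equiv> \<lambda>l. wnorm I (ydil (2 ^ l) \<circ> e)"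
  obtains (low) "\<And>l. \<exists>f. real (yrank I f) < thr \<and> 2 ^ (l * yrank I f) * \<bar>minor I e f\<bar> = \<psi> l"
  | (base) f where "thr \<le> real (yrank I f)" "\<bar>minor I e f\<bar> = \<psi> 0"
  | (cross) l fa fb where "thr \<le> real (yrank I fb)" "2 ^ (l * yrank I fb) * \<bar>minor I e fb\<bar> = \<psi> l"
      "real (yrank I fa) < thr" "\<psi> l \<le> 2 ^ (CARD('d) + 1) * (2 ^ (l * yrank I fa) * \<bar>minor I e fa\<bar>)"
proof -
  have m: "\<bar>minor I (ydil (2 ^ l) \<circ> e) f\<bar> = 2 ^ (l * yrank I f) * \<bar>minor I e f\<bar>" for l f
    by (simp add: minor_ydil abs_mult power_mult)
  have le: "2 ^ (l * yrank I f) * \<bar>minor I e f\<bar> \<le> \<psi> l" for l f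
    using minor_le_wnorm[of I "ydil (2 ^ l) \<circ> e" f] by (simp add: m \<psi>_def)
  have att: "\<exists>f. 2 ^ (l * yrank I f) * \<bar>minor I e f\<bar> = \<psi> l" for l
    using wnorm_attained[of I "ydil (2 ^ l) \<circ> e"] unfolding m \<psi>_def by metis
  define P where "P l \<longleftrightarrow> (\<exists>f. thr \<le> real (yrank I f) \<and> 2 ^ (l * yrank I f) * \<bar>minor I e f\<bar> = \<psi> l)" for l
  show thesis
  proof (cases "\<exists>l. P l")
    case False
    then show thesis using low att unfolding P_def by (metis not_le)
  next
    case True
    define l where "l = (LEAST l. P l)"
    have "P l" unfolding l_def using True by (rule LeastI_ex)
    then obtain fb where fb: "thr \<le> real (yrank I fb)" "2 ^ (l * yrank I fb) * \<bar>minor I e fb\<bar> = \<psi> l"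
      by (auto simp: P_def)
    show thesis
    proof (cases l)
      case 0
      then show thesis using base[of fb] fb by simp
    next
      case (Suc k)
      have "\<not> P k" using not_less_Least[of k P] Suc by (simp add: l_def)
      then obtain fa where fa: "real (yrank I fa) < thr" "2 ^ (k * yrank I fa) * \<bar>minor I e fa\<bar> = \<psi> k"
        using att[of k] unfolding P_def by (metis not_le)
      have "\<psi> l = 2 ^ yrank I fb * (2 ^ (k * yrank I fb) * \<bar>minor I e fb\<bar>)"
        using fb(2) by (simp add: Suc power_add)
      also have "\<dots> \<le> 2 ^ (CARD('d) + 1) * \<psi> k"
        using le[of k fb] yrank_le[of I fb] wnorm_nonneg by (intro mult_mono power_increasing) (auto simp: \<psi>_def)
      also have "\<psi> k \<le> 2 ^ (l * yrank I fa) * \<bar>minor I e fa\<bar>"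
        unfolding fa(2)[symmetric] Suc by (intro mult_right_mono power_increasing) auto
      finally have "\<psi> l \<le> 2 ^ (CARD('d) + 1) * (2 ^ (l * yrank I fa) * \<bar>minor I e fa\<bar>)" by simp
      then show thesis using cross fb fa by blast
    qed
  qed
qed

text \<open>The factors come from the count of a minor, from the crossing of one dyadic scale and
  from the exchange of a minor, in this order.\<close>

definition grid_const :: "'d::finite itself \<Rightarrow> 'm::finite itself \<Rightarrow> real" where
  "grid_const _ _ = 2 * real CARD('d option + 'm) * (real CARD('d option + 'm) + 3) * 2 ^ (CARD('d) + 1) * real CARD('d option + 'm)"

lemma grid_const_ge:
  fixes N :: real
  defines "N \<equiv> real CARD('d::finite option + 'm::finite)" and "C \<equiv> grid_const TYPE('d) TYPE('m)"
  shows "1 \<le> C" "2 * N * (N + 3) \<le> C" "2 ^ (CARD('d) + 1) * (1 + N) \<le> C"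
    "2 * N * (N + 3) * (2 ^ (CARD('d) + 1) * N) = C"
proof -
  have N: "1 < N" using card_sum_rows_gt_1[where 'd = 'd and 'm = 'm] unfolding N_def by linarith
  show eq: "2 * N * (N + 3) * (2 ^ (CARD('d) + 1) * N) = C"
    by (simp only: C_def grid_const_def N_def mult_ac)
  have p: "(1::real) \<le> 2 ^ (CARD('d) + 1)" by (rule one_le_power) simp
  have "2 * N * (N + 3) * (1 * 1) \<le> 2 * N * (N + 3) * (2 ^ (CARD('d) + 1) * N)"
    using N p by (intro mult_left_mono mult_mono) auto
  then show 2: "2 * N * (N + 3) \<le> C" unfolding eq by simp
  have "1 * 1 \<le> 2 * N * (N + 3)" using N by (intro mult_mono) auto
  then show "1 \<le> C" using 2 by linarith
  have "1 * (1 + N) \<le> 2 * N * N * (N + 3)"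
  proof (rule mult_mono)
    have "1 * 1 \<le> N * N" using N by (intro mult_mono) auto
    then show "1 \<le> 2 * N * N" by simp
  qed (use N in auto)
  then have "2 ^ (CARD('d) + 1) * (1 * (1 + N)) \<le> 2 ^ (CARD('d) + 1) * (2 * N * N * (N + 3))"
    by (intro mult_left_mono) auto
  then show "2 ^ (CARD('d) + 1) * (1 + N) \<le> C" unfolding eq[symmetric] by (simp only: mult_ac mult_1)
qed

text \<open>\<open>thr\<close> is the \<open>Y\<close>-rank at which the minors of \<open>e\<close> and of its dilations balance. The first branch uses
  only that a nonzero linear form is small on a small part of the grid, the second one that several
  independent linear forms are.\<close>

lemma count_weighted:
  fixes I :: "('d::finite option + 'm::finite) set" and e :: "'d option + 'm \<Rightarrow> real ^ ('d option + 'm)"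
    and M :: nat and \<beta> T E thr :: real
  defines "\<psi> \<equiv> \<lambda>l. wnorm I (ydil (2 ^ l) \<circ> e)" and "C \<equiv> grid_const TYPE('d) TYPE('m)"
    and "d \<equiv> CARD('d)" and "N \<equiv> real CARD('d option + 'm)"
  assumes M: "1 \<le> M" and pos: "0 < wnorm I e" and \<beta>: "1 \<le> \<beta>"
    and branch: "(thr = 1 \<and> T = 1 \<and> E = \<beta> - 1) \<or> (thr = real d + 1 - real d / \<beta> \<and> T = \<beta> * (real d + 1) - real d \<and> E = 0)"
  shows "(\<forall>l. \<exists>f. real (yrank I f) < thr \<and> 2 ^ (l * yrank I f) * \<bar>minor I e f\<bar> = \<psi> l) \<or>
    (\<exists>l. \<forall>q. wnorm I e \<le> (1 + N) * real M * q \<longrightarrow> real (card {j \<in> grid M. sheared_norm I e M j \<le> q})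
      \<le> C ^ (d + 1) * C powr \<beta> * ((q / \<psi> l) powr \<beta> * 2 powr (real l * T)) * real M ^ d * real M powr E)"
proof -
  define w where "w = wnorm I e"
  have w: "0 < w" using pos by (simp add: w_def)
  define A where "A q = {j \<in> grid M. sheared_norm I e M j \<le> q}" for q
  define n where "n q = real (card (A q)) / real M ^ d" for q
  have Md: "0 < real M ^ d" using M by simp
  have N: "1 < N" using card_sum_rows_gt_1[where 'd = 'd and 'm = 'm] unfolding N_def by linarith
  have C: "1 \<le> C" "2 * N * (N + 3) \<le> C" "2 ^ (d + 1) * (1 + N) \<le> C" "2 * N * (N + 3) * (2 ^ (d + 1) * N) = C"
    using grid_const_ge[where 'd = 'd and 'm = 'm] by (simp_all only: C_def N_def d_def)
  have d1: "1 \<le> d" unfolding d_def by (simp add: Suc_leI card_gt_0_iff)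
  have thr: "1 \<le> thr" "thr < real d + 1"
  proof -
    have "real d / \<beta> \<le> real d / 1" using \<beta> by (intro divide_left_mono) auto
    moreover have "0 < real d / \<beta>" using \<beta> d1 by (intro divide_pos_pos) auto
    ultimately show "1 \<le> thr" "thr < real d + 1" using branch d1 by auto
  qed
  have n1: "n q \<le> 1" for q
  proof -
    have "card (A q) \<le> card (grid M :: ('d \<Rightarrow> nat) set)"
      by (rule card_mono[OF finite_grid]) (simp add: A_def)
    then have "real (card (A q)) \<le> real M ^ d" by (simp add: card_grid d_def flip: of_nat_power)
    then show ?thesis using Md by (simp add: n_def)
  qed
  have n2: "n q \<le> (2 * N * (N + 3) * q / \<bar>minor I e f\<bar>) ^ yrank I f"
    if "minor I e f \<noteq> 0" "yrank I f \<le> d" "w \<le> (1 + N) * real M * q" for f q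
  proof -
    have "real (card (A q)) \<le> (2 * N * (N + 3) * q / \<bar>minor I e f\<bar>) ^ yrank I f * real M ^ d"
      unfolding A_def N_def d_def
      using count_minor[where I = I and e = e and M = M and f = f and q = q] M that
      by (simp only: w_def N_def d_def of_nat_add of_nat_1 not_False_eq_True simp_thms)
    then show ?thesis using Md by (simp add: n_def field_simps)
  qed
  have n3: "n q \<le> 0" if "minor I e f \<noteq> 0" "yrank I f = d + 1" "q < \<bar>minor I e f\<bar>" for f q
  proof -
    have "A q = {}" unfolding A_def by (rule count_minor_full[OF M]) (use that in \<open>simp_all add: d_def\<close>)
    then show ?thesis by (simp add: n_def)
  qed
  have red: "real (card {j \<in> grid M. sheared_norm I e M j \<le> q})
      \<le> C ^ (d + 1) * C powr \<beta> * ((q / \<psi> l) powr \<beta> * 2 powr (real l * T)) * real M ^ d * real M powr E"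
    if "n q \<le> C ^ (d + 1) * C powr \<beta> * ((q / \<psi> l) powr \<beta> * 2 powr (real l * T)) * real M powr E" for q l
    using that Md by (simp add: n_def A_def field_simps)
  have CC: "1 \<le> C ^ (d + 1)" "1 \<le> C powr \<beta>"
    using one_le_power[OF C(1), of "d + 1"] ge_one_powr_ge_zero[OF C(1), of \<beta>] \<beta> by linarith+
  have ME: "1 \<le> real M powr E" using M branch \<beta> by (intro ge_one_powr_ge_zero) auto
  have q0: "0 < q" if "w \<le> (1 + N) * real M * q" for q
  proof -
    have "0 < (1 + N) * real M * q" using w that by linarith
    moreover have "0 < (1 + N) * real M" using N M by simp
    ultimately show ?thesis by (rule zero_less_mult_pos)
  qed
  consider (low) "\<And>l. \<exists>f. real (yrank I f) < thr \<and> 2 ^ (l * yrank I f) * \<bar>minor I e f\<bar> = \<psi> l"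
  | (base) f where "thr \<le> real (yrank I f)" "\<bar>minor I e f\<bar> = \<psi> 0"
  | (cross) l fa fb where "thr \<le> real (yrank I fb)" "2 ^ (l * yrank I fb) * \<bar>minor I e fb\<bar> = \<psi> l"
      "real (yrank I fa) < thr" "\<psi> l \<le> 2 ^ (d + 1) * (2 ^ (l * yrank I fa) * \<bar>minor I e fa\<bar>)"
  proof (rule select_scale[of I thr e])
    assume "\<And>l. \<exists>f. real (yrank I f) < thr \<and> 2 ^ (l * yrank I f) * \<bar>minor I e f\<bar> = wnorm I (ydil (2 ^ l) \<circ> e)"
    then show thesis by (intro that(1)) (simp only: \<psi>_def)
  next
    fix f assume "thr \<le> real (yrank I f)" "\<bar>minor I e f\<bar> = wnorm I (ydil (2 ^ 0) \<circ> e)"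
    then show thesis by (intro that(2)[of f]) (simp_all only: \<psi>_def)
  next
    fix l fa fb
    assume "thr \<le> real (yrank I fb)" "2 ^ (l * yrank I fb) * \<bar>minor I e fb\<bar> = wnorm I (ydil (2 ^ l) \<circ> e)"
      "real (yrank I fa) < thr" "wnorm I (ydil (2 ^ l) \<circ> e) \<le> 2 ^ (CARD('d) + 1) * (2 ^ (l * yrank I fa) * \<bar>minor I e fa\<bar>)"
    then show thesis by (intro that(3)[of fb l fa]) (simp_all only: \<psi>_def d_def)
  qed
  then show ?thesis
  proof cases
    case low
    then show ?thesis by blast
  next
    case base
    have \<psi>0: "\<psi> 0 = w" unfolding \<psi>_def w_def
      by (rule wnorm_cong) (simp add: ydil_def diag_map_def vec_eq_iff split: sum.split)
    let ?J = "yrank I f"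
    have J: "1 \<le> ?J" "?J \<le> d + 1" using base(1) thr(1) yrank_le[of I f] by (auto simp: d_def)
    have m0: "minor I e f \<noteq> 0" "\<bar>minor I e f\<bar> = w" using base(2) \<psi>0 w by auto
    have "n q \<le> C ^ (d + 1) * C powr \<beta> * ((q / \<psi> 0) powr \<beta> * 2 powr (real 0 * T)) * real M powr E"
      if q: "w \<le> (1 + N) * real M * q" for q
    proof -
      define \<rho> where "\<rho> = q / w"
      have \<rho>: "0 < \<rho>" using q0[OF q] w by (simp add: \<rho>_def)
      have "n q \<le> C ^ (d + 1) * C powr \<beta> * (\<rho> powr \<beta>) * real M powr E"
      proof (cases "1 \<le> \<rho>")
        case True
        then have "1 \<le> \<rho> powr \<beta>" using \<beta> by (intro ge_one_powr_ge_zero) auto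
        then have "1 * 1 * 1 * 1 \<le> C ^ (d + 1) * C powr \<beta> * (\<rho> powr \<beta>) * real M powr E"
          using CC ME by (intro mult_mono) auto
        then show ?thesis using n1[of q] by linarith
      next
        case False
        show ?thesis
        proof (cases "?J = d + 1")
          case True
          then have "n q \<le> 0" using False w m0 by (intro n3[OF m0(1)]) (auto simp: \<rho>_def field_simps)
          moreover have "0 \<le> C ^ (d + 1) * C powr \<beta> * (\<rho> powr \<beta>) * real M powr E"
            using C(1) by (intro mult_nonneg_nonneg zero_le_power) auto
          ultimately show ?thesis by (rule order_trans)
        next
          case False': False
          then have Jd: "?J \<le> d" using J by simp
          have "n q \<le> (2 * N * (N + 3) * \<rho>) ^ ?J"
            using n2[OF m0(1) Jd q] by (simp add: m0(2) \<rho>_def)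
          also have "\<dots> \<le> (C * \<rho>) ^ ?J"
            using C(2) N \<rho> by (intro power_mono mult_right_mono) auto
          also have "\<dots> = C ^ ?J * \<rho> ^ ?J" by (simp add: power_mult_distrib)
          also have "\<dots> \<le> C ^ (d + 1) * \<rho> ^ ?J"
            using C(1) J \<rho> by (intro mult_right_mono power_increasing) auto
          also have "\<rho> ^ ?J \<le> C powr \<beta> * \<rho> powr \<beta> * real M powr E"
            using branch
          proof
            assume b: "thr = 1 \<and> T = 1 \<and> E = \<beta> - 1"
            \<comment> \<open>Only one condition is used. The lower bound for \<open>q\<close> makes
              \<open>1 / \<rho>\<close> at most of order \<open>M\<close>, which turns the missing
              power \<open>\<beta> - 1\<close> into the loss \<open>E\<close>.\<close>
            have "\<rho> ^ ?J \<le> \<rho> ^ 1" using False \<rho> J by (intro power_decreasing) auto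
            also have "\<rho> ^ 1 = \<rho> powr \<beta> * \<rho> powr (- (\<beta> - 1))" using \<rho> by (simp flip: powr_add)
            also have "\<dots> = \<rho> powr \<beta> * (1 / \<rho>) powr (\<beta> - 1)"
              unfolding powr_minus_divide using \<rho> by (simp add: powr_divide)
            also have "\<dots> \<le> \<rho> powr \<beta> * (C * real M) powr (\<beta> - 1)"
            proof (intro mult_left_mono powr_mono2)
              have "1 \<le> (1 + N) * real M * \<rho>" using q w by (simp add: \<rho>_def field_simps)
              also have "\<dots> \<le> C * real M * \<rho>"
              proof (intro mult_right_mono)
                have "1 * (1 + N) \<le> 2 ^ (d + 1) * (1 + N)" using N by (intro mult_right_mono one_le_power) auto
                from order_trans[OF this C(3)] show "1 + N \<le> C" by simp
              qed (use \<rho> in auto)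
              finally show "1 / \<rho> \<le> C * real M" using \<rho> by (simp add: field_simps)
            qed (use \<beta> \<rho> in auto)
            also have "\<dots> = \<rho> powr \<beta> * (C powr (\<beta> - 1) * real M powr (\<beta> - 1))" using C(1) by (simp add: powr_mult)
            also have "\<dots> \<le> \<rho> powr \<beta> * (C powr \<beta> * real M powr (\<beta> - 1))"
              using C(1) by (intro mult_left_mono mult_right_mono powr_mono) auto
            finally show ?thesis using b by (simp add: mult_ac)
          next
            assume b: "thr = real d + 1 - real d / \<beta> \<and> T = \<beta> * (real d + 1) - real d \<and> E = 0"
            have "real d \<le> \<beta> * (real d + 1 - ?J) \<or> \<beta> * (real d + 1 - ?J) \<le> real d" by linarith
            \<comment> \<open>The chain
              \<open>\<beta> * (d + 1 - J) \<le> d \<le> J * (d + 1 - J)\<close> gives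
              \<open>\<beta> \<le> J\<close>, so the power bound with exponent \<open>J\<close> is
              already strong enough.\<close>
            have "real d + 1 - ?J \<le> real d / \<beta>" using base(1) b by linarith
            then have "\<beta> * (real d + 1 - ?J) \<le> real d" using \<beta> by (simp add: field_simps)
            also have "real d \<le> ?J * (real d + 1 - ?J)"
              using mult_nonneg_nonneg[of "real ?J - 1" "real d - real ?J"] J Jd by (simp add: algebra_simps)
            finally have "\<beta> \<le> ?J" using Jd by simp
            then have "\<rho> powr real ?J \<le> \<rho> powr \<beta>" using False \<rho> by (intro powr_mono') auto
            then have "\<rho> ^ ?J \<le> \<rho> powr \<beta>" using \<rho> by (simp add: powr_realpow)
            also have "\<dots> = 1 * \<rho> powr \<beta>" by simp
            also have "\<dots> \<le> C powr \<beta> * \<rho> powr \<beta>" using CC(2) by (intro mult_right_mono) auto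
            finally show ?thesis using b M by simp
          qed
          finally show ?thesis using C(1) by (simp add: mult_ac mult_left_mono)
        qed
      qed
      then show ?thesis using M by (simp add: \<psi>0 \<rho>_def)
    qed
    then show ?thesis using red unfolding w_def by blast
  next
    case cross
    define X where "X = (2::real) ^ l"
    have X: "1 \<le> X" "0 < X" by (simp_all add: X_def)
    have Xp: "2 ^ (l * k) = X ^ k" for k by (simp add: X_def power_mult)
    have m: "\<bar>minor I (ydil X \<circ> e) f\<bar> = X ^ yrank I f * \<bar>minor I e f\<bar>" for f
      using X by (simp add: minor_ydil abs_mult)
    have \<psi>0: "0 < \<psi> l"
    proof -
      obtain f where "minor I e f \<noteq> 0" using pos by (auto simp: wnorm_pos_iff)
      then have "minor I (ydil X \<circ> e) f \<noteq> 0" using m[of f] X by auto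
      then show ?thesis unfolding \<psi>_def X_def wnorm_pos_iff by blast
    qed
    let ?a = "yrank I fa" and ?b = "yrank I fb"
    have b: "1 \<le> ?b" "?b \<le> d + 1" using cross(1) thr(1) yrank_le[of I fb] by (auto simp: d_def)
    have mb: "\<bar>minor I e fb\<bar> = \<psi> l / X ^ ?b" using cross(2) X by (simp add: Xp field_simps)
    have ma: "\<psi> l / (2 ^ (d + 1) * X ^ ?a) \<le> \<bar>minor I e fa\<bar>" using cross(4) X by (simp add: Xp field_simps)
    have mb0: "minor I e fb \<noteq> 0" using mb \<psi>0 X by auto
    have "0 < \<psi> l / (2 ^ (d + 1) * X ^ ?a)" using \<psi>0 X by simp
    then have ma0: "minor I e fa \<noteq> 0" using ma by auto
    \<comment> \<open>A minor of rank 0 imposes no condition on the grid; it is traded for one of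
      rank 1 at the cost of a factor N.\<close>
    have "\<exists>f. 1 \<le> yrank I f \<and> real (yrank I f) \<le> thr \<and> \<psi> l / (2 ^ (d + 1) * N * X ^ yrank I f) \<le> \<bar>minor I e f\<bar>"
    proof (cases "?a = 0")
      case False
      have "\<psi> l / (2 ^ (d + 1) * N * X ^ ?a) \<le> \<psi> l / (2 ^ (d + 1) * X ^ ?a)"
        using \<psi>0 X N by (intro divide_left_mono) auto
      then show ?thesis using False ma cross(3) by (intro exI[of _ fa]) auto
    next
      case True
      have "minor I (ydil X \<circ> e) fa \<noteq> 0" using m[of fa] ma0 X by auto
      moreover have "\<bar>minor I (ydil X \<circ> e) fb\<bar> = wnorm I (ydil X \<circ> e)"
        unfolding m using cross(2) unfolding Xp \<psi>_def X_def[symmetric] .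
      ultimately obtain f where f: "yrank I f = 1" "\<bar>minor I (ydil X \<circ> e) fa\<bar> / N \<le> \<bar>minor I (ydil X \<circ> e) f\<bar>"
        using exchange_minor[of I "ydil X \<circ> e" fa fb] True b(1) unfolding N_def by blast
      have "\<psi> l / 2 ^ (d + 1) \<le> \<bar>minor I e fa\<bar>" using ma True by simp
      have "\<psi> l / 2 ^ (d + 1) / N \<le> X * \<bar>minor I e f\<bar>"
      proof -
        have "\<psi> l / 2 ^ (d + 1) / N \<le> \<bar>minor I e fa\<bar> / N"
          using N \<open>\<psi> l / 2 ^ (d + 1) \<le> \<bar>minor I e fa\<bar>\<close> by (intro divide_right_mono) auto
        also have "\<dots> \<le> X * \<bar>minor I e f\<bar>" using f(2) unfolding m f(1) True by simp
        finally show ?thesis .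
      qed
      then have "\<psi> l / (2 ^ (d + 1) * N * X) \<le> \<bar>minor I e f\<bar>" using N X by (simp add: field_simps)
      then show ?thesis using f(1) thr(1) by (intro exI[of _ f]) simp
    qed
    then obtain f where f: "1 \<le> yrank I f" "real (yrank I f) \<le> thr"
      "\<psi> l / (2 ^ (d + 1) * N * X ^ yrank I f) \<le> \<bar>minor I e f\<bar>" by blast
    let ?c = "yrank I f"
    have "real ?c < real d + 1" using f(2) thr(2) by linarith
    then have cd: "?c \<le> d" by linarith
    have pos1: "0 < \<psi> l / (2 ^ (d + 1) * N * X ^ ?c)" using \<psi>0 X N by simp
    then have mf0: "minor I e f \<noteq> 0" using f(3) by auto
    have "n q \<le> C ^ (d + 1) * C powr \<beta> * ((q / \<psi> l) powr \<beta> * 2 powr (real l * T)) * real M powr E"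
      if q: "w \<le> (1 + N) * real M * q" for q
    proof -
      define \<rho> where "\<rho> = q / \<psi> l"
      have \<rho>: "0 < \<rho>" using q0[OF q] \<psi>0 by (simp add: \<rho>_def)
      have nc: "n q \<le> (C * \<rho> * X ^ ?c) ^ ?c"
      proof -
        have "n q \<le> (2 * N * (N + 3) * q / \<bar>minor I e f\<bar>) ^ ?c" by (rule n2[OF mf0 cd q])
        also have "\<dots> \<le> (2 * N * (N + 3) * q / (\<psi> l / (2 ^ (d + 1) * N * X ^ ?c))) ^ ?c"
        proof (intro power_mono divide_left_mono mult_pos_pos)
          show "0 < \<bar>minor I e f\<bar>" using mf0 by simp
          show "0 \<le> 2 * N * (N + 3) * q" using N q0[OF q] by simp
          then show "0 \<le> 2 * N * (N + 3) * q / \<bar>minor I e f\<bar>" by simp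
        qed (rule f(3), rule pos1)
        also have "2 * N * (N + 3) * q / (\<psi> l / (2 ^ (d + 1) * N * X ^ ?c)) = 2 * N * (N + 3) * (2 ^ (d + 1) * N) * \<rho> * X ^ ?c"
          by (simp add: \<rho>_def mult_ac)
        finally show ?thesis unfolding C(4) .
      qed
      have X2: "2 powr (real l * T) = X powr T" by (simp add: X_def powr_realpow[symmetric] powr_powr)
      have "n q \<le> C powr \<beta> * (\<rho> powr \<beta> * X powr T) * real M powr E"
        using branch
      proof
        assume br: "thr = 1 \<and> T = 1 \<and> E = \<beta> - 1"
        \<comment> \<open>The low minor has rank 0 and is unchanged by the dilation. Hence
          \<open>\<psi> l\<close> is at most a multiple of \<open>w\<close>, and
          \<open>\<rho>\<close> is at least of order \<open>1 / M\<close>, which again pays for the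
          power \<open>\<beta> - 1\<close>.\<close>
        have c1: "?c = 1" and a0: "?a = 0" using f br cross(3) by auto
        have "\<psi> l / 2 ^ (d + 1) \<le> w" using ma a0 minor_le_wnorm[of I e fa] by (simp add: w_def)
        also have "\<dots> \<le> (1 + N) * real M * q" by (rule q)
        finally have "1 \<le> 2 ^ (d + 1) * (1 + N) * (real M * \<rho>)" using \<psi>0 by (simp add: \<rho>_def field_simps)
        also have "\<dots> \<le> C * (real M * \<rho>)" using C(3) \<rho> by (intro mult_right_mono) auto
        finally have "1 \<le> (C * (real M * \<rho>)) powr (\<beta> - 1)" using \<beta> by (intro ge_one_powr_ge_zero) auto
        then have "(C * \<rho> * X) * 1 \<le> (C * \<rho> * X) * (C * (real M * \<rho>)) powr (\<beta> - 1)"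
          using C(1) \<rho> X by (intro mult_left_mono) auto
        also have "\<dots> = (C * C powr (\<beta> - 1)) * ((\<rho> * \<rho> powr (\<beta> - 1)) * X) * real M powr (\<beta> - 1)"
          using C(1) \<rho> by (simp add: powr_mult mult_ac)
        also have "C * C powr (\<beta> - 1) = C powr \<beta>" using C(1) by (simp add: powr_mult_base)
        also have "\<rho> * \<rho> powr (\<beta> - 1) = \<rho> powr \<beta>" using \<rho> by (simp add: powr_mult_base)
        finally have le: "(C * \<rho> * X) * 1 \<le> C powr \<beta> * (\<rho> powr \<beta> * X) * real M powr (\<beta> - 1)" .
        have "n q \<le> (C * \<rho> * X) * 1" using nc by (simp add: c1)
        from order_trans[OF this le] show ?thesis using br X by simp
      next
        assume br: "thr = real d + 1 - real d / \<beta> \<and> T = \<beta> * (real d + 1) - real d \<and> E = 0"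
        have "n q \<le> (C * \<rho>) powr \<beta> * X powr (\<beta> * (real d + 1) - real d)"
        proof (rule power_interpolation[where a = ?c and b = ?b])
          show "0 < C * \<rho>" "1 \<le> X" "1 \<le> ?c" "?c \<le> d" "?b \<le> d + 1" "0 < \<beta>" "n q \<le> 1" "n q \<le> (C * \<rho> * X ^ ?c) ^ ?c"
            using C(1) \<rho> X f(1) cd b \<beta> n1 nc by auto
          show "?c \<le> ?b" using f(2) cross(1) by linarith
          have "real d / \<beta> \<le> real d + 1 - ?c" using f(2) br by linarith
          then show "real d \<le> \<beta> * (real d + 1 - ?c)" using \<beta> by (simp add: field_simps)
          have "real d + 1 - ?b \<le> real d / \<beta>" using cross(1) br by linarith
          then show "\<beta> * (real d + 1 - ?b) \<le> real d" using \<beta> by (simp add: field_simps)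
          show "n q \<le> (C * \<rho> * X ^ ?b) ^ ?b" if "?b \<le> d"
          proof -
            have "n q \<le> (2 * N * (N + 3) * q / \<bar>minor I e fb\<bar>) ^ ?b" by (rule n2[OF mb0 that q])
            also have "2 * N * (N + 3) * q / \<bar>minor I e fb\<bar> = 2 * N * (N + 3) * (\<rho> * X ^ ?b)"
              unfolding mb by (simp add: \<rho>_def)
            also have "(2 * N * (N + 3) * (\<rho> * X ^ ?b)) ^ ?b \<le> (C * (\<rho> * X ^ ?b)) ^ ?b"
              using C(2) N \<rho> X by (intro power_mono mult_right_mono) auto
            finally show ?thesis by (simp add: mult.assoc)
          qed
          show "n q \<le> 0" if bd: "?b = d + 1" and lt: "C * \<rho> * X ^ (d + 1) < 1"
          proof (rule n3[OF mb0 bd])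
            have "1 * (\<rho> * X ^ (d + 1)) \<le> C * (\<rho> * X ^ (d + 1))" using C(1) \<rho> X by (intro mult_right_mono) auto
            then have "\<rho> * X ^ (d + 1) < 1" using lt by (simp add: mult.assoc)
            then show "q < \<bar>minor I e fb\<bar>" unfolding mb bd \<rho>_def using \<psi>0 X by (simp add: field_simps)
          qed
        qed
        also have "\<dots> = C powr \<beta> * (\<rho> powr \<beta> * X powr T) * real M powr E"
          using C(1) \<rho> br M by (simp add: powr_mult)
        finally show ?thesis .
      qed
      also have "\<dots> = 1 * (C powr \<beta> * (\<rho> powr \<beta> * X powr T) * real M powr E)" by simp
      also have "\<dots> \<le> C ^ (d + 1) * (C powr \<beta> * (\<rho> powr \<beta> * X powr T) * real M powr E)"
        using CC(1) by (intro mult_right_mono) (auto intro!: mult_nonneg_nonneg)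
      finally show ?thesis unfolding X2 \<rho>_def by (simp only: mult.assoc)
    qed
    then show ?thesis using red unfolding w_def by blast
  qed
qed

text \<open>Each dyadic range of values of \<open>Q\<close> contributes at most
  \<open>2 powr \<beta> * B\<close>; the number of ranges is the source of the factor log M.\<close>

lemma sum_dyadic_le:
  fixes Q :: "'a \<Rightarrow> real" and q0 U B \<beta> :: real
  assumes G: "finite G" and q0: "0 < q0" and U: "1 \<le> U" and \<beta>: "0 \<le> \<beta>"
    and Q: "\<And>j. j \<in> G \<Longrightarrow> q0 \<le> Q j" "\<And>j. j \<in> G \<Longrightarrow> Q j \<le> U * q0"
    and B: "\<And>q. q0 \<le> q \<Longrightarrow> real (card {j \<in> G. Q j \<le> q}) \<le> B * q powr \<beta>"
  shows "(\<Sum>j\<in>G. Q j powr (- \<beta>)) \<le> (log 2 U + 1) * (2 powr \<beta> * B)"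
proof -
  define t where "t j = nat \<lfloor>log 2 (Q j / q0)\<rfloor>" for j
  define n where "n = nat \<lfloor>log 2 U\<rfloor>"
  have t: "2 ^ t j * q0 \<le> Q j" "Q j \<le> 2 ^ (t j + 1) * q0" "t j \<le> n" if "j \<in> G" for j
  proof -
    have r: "1 \<le> Q j / q0" "Q j / q0 \<le> U" using Q[OF that] q0 by (auto simp: field_simps)
    have l0: "0 \<le> log 2 (Q j / q0)" using r by simp
    have tj: "real (t j) = of_int \<lfloor>log 2 (Q j / q0)\<rfloor>" using l0 by (simp add: t_def)
    have "real (t j) \<le> log 2 (Q j / q0)" "log 2 (Q j / q0) \<le> real (t j + 1)" unfolding of_nat_add tj by linarith+
    then have "2 powr real (t j) \<le> Q j / q0" "Q j / q0 \<le> 2 powr real (t j + 1)"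
      using r by (simp_all add: le_log_iff log_le_iff)
    then have "2 ^ t j \<le> Q j / q0" "Q j / q0 \<le> 2 ^ (t j + 1)" by (simp_all only: powr_realpow zero_less_numeral)
    then show "2 ^ t j * q0 \<le> Q j" "Q j \<le> 2 ^ (t j + 1) * q0" using q0 by (simp_all add: field_simps)
    have "log 2 (Q j / q0) \<le> log 2 U" using r by (intro log_mono) auto
    then show "t j \<le> n" unfolding t_def n_def by (intro nat_mono floor_mono)
  qed
  have "0 \<le> B * q0 powr \<beta>" using B[of q0] by (meson of_nat_0_le_iff order_trans order_refl)
  then have B0: "0 \<le> B" using q0 by (simp add: zero_le_mult_iff)
  have "(\<Sum>j\<in>G. Q j powr (- \<beta>)) = (\<Sum>k\<le>n. \<Sum>j\<in>{j \<in> G. t j = k}. Q j powr (- \<beta>))"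
    using t(3) by (intro sum.group[symmetric] G) auto
  also have "\<dots> \<le> (\<Sum>k\<le>n. 2 powr \<beta> * B)"
  proof (rule sum_mono)
    fix k
    let ?q = "2 ^ (k + 1) * q0"
    have q: "q0 \<le> ?q" "0 < ?q" using q0 mult_right_mono[of 1 "2 ^ (k + 1)" q0] one_le_power[of "2::real" "k + 1"] by auto
    have "(\<Sum>j\<in>{j \<in> G. t j = k}. Q j powr (- \<beta>)) \<le> (\<Sum>j\<in>{j \<in> G. t j = k}. (?q / 2) powr (- \<beta>))"
      using t(1) q0 \<beta> by (intro sum_mono powr_mono2') auto
    also have "\<dots> = real (card {j \<in> G. t j = k}) * (?q / 2) powr (- \<beta>)" by simp
    also have "\<dots> \<le> real (card {j \<in> G. Q j \<le> ?q}) * (?q / 2) powr (- \<beta>)"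
      using t(2) G by (intro mult_right_mono of_nat_mono card_mono) auto
    also have "\<dots> \<le> (B * ?q powr \<beta>) * (?q / 2) powr (- \<beta>)"
      by (intro mult_right_mono B q) auto
    also have "\<dots> = 2 powr \<beta> * B * (?q powr \<beta> * ?q powr (- \<beta>))"
    proof -
      have half: "(x / 2) powr (- \<beta>) = 2 powr \<beta> * x powr (- \<beta>)" if "0 < x" for x :: real
        using that by (simp add: powr_divide powr_minus divide_simps)
      show ?thesis unfolding half[OF q(2)] by (simp only: mult_ac)
    qed
    also have "?q powr \<beta> * ?q powr (- \<beta>) = 1"
      unfolding powr_add[symmetric] using q0 by simp
    finally show "(\<Sum>j\<in>{j \<in> G. t j = k}. Q j powr (- \<beta>)) \<le> 2 powr \<beta> * B" by simp
  qed
  also have "\<dots> = (real n + 1) * (2 powr \<beta> * B)" by simp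
  also have "\<dots> \<le> (log 2 U + 1) * (2 powr \<beta> * B)"
  proof (intro mult_right_mono)
    have "0 \<le> log 2 U" using U by simp
    then show "real n + 1 \<le> log 2 U + 1" by (simp add: n_def)
  qed (use B0 in auto)
  finally show ?thesis .
qed

text \<open>If the dominating rank stays below \<open>thr\<close> for all \<open>l\<close>, then
  \<open>\<psi> l\<close> grows at most like 2^(l A) with \<open>\<beta> * A < T\<close>, and the
  supremum is infinite. Otherwise the count available at one scale \<open>l\<close> is summed
  dyadically.\<close>

lemma grid_average:
  fixes I :: "('d::finite option + 'm::finite) set" and e :: "'d option + 'm \<Rightarrow> real ^ ('d option + 'm)"
    and M :: nat and \<beta> T E thr :: real
  defines "\<psi> \<equiv> \<lambda>l. wnorm I (ydil (2 ^ l) \<circ> e)" and "C \<equiv> grid_const TYPE('d) TYPE('m)"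
    and "d \<equiv> CARD('d)" and "N \<equiv> real CARD('d option + 'm)"
  assumes M: "1 \<le> M" and pos: "0 < wnorm I e" and \<beta>: "1 \<le> \<beta>"
    and branch: "(thr = 1 \<and> T = 1 \<and> E = \<beta> - 1) \<or> (thr = real d + 1 - real d / \<beta> \<and> T = \<beta> * (real d + 1) - real d \<and> E = 0)"
  shows "ennreal (\<Sum>j\<in>grid M. sheared_norm I e M j powr (- \<beta>))
    \<le> ennreal ((log 2 ((1 + N)\<^sup>2 * real M) + 1) * (2 powr \<beta> * (C ^ (d + 1) * C powr \<beta>)) * real M ^ d * real M powr E)
      * (SUP l. ennreal (2 powr (real l * T) * \<psi> l powr (- \<beta>)))"
proof -
  define w where "w = wnorm I e"
  have w: "0 < w" using pos by (simp add: w_def)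
  have N: "1 < N" using card_sum_rows_gt_1[where 'd = 'd and 'm = 'm] unfolding N_def by linarith
  have C1: "1 \<le> C" using grid_const_ge(1)[where 'd = 'd and 'm = 'm] by (simp add: C_def)
  define U where "U = (1 + N)\<^sup>2 * real M"
  have U1: "1 \<le> U"
  proof -
    have "1 * 1 \<le> (1 + N)\<^sup>2 * real M" using N M by (intro mult_mono one_le_power) auto
    then show ?thesis by (simp add: U_def)
  qed
  define c0 where "c0 = (log 2 U + 1) * (2 powr \<beta> * (C ^ (d + 1) * C powr \<beta>)) * real M ^ d * real M powr E"
  have c0: "0 < c0"
  proof -
    have "0 < log 2 U + 1" using U1 by (simp add: add_nonneg_pos)
    then show ?thesis unfolding c0_def using C1 M by (intro mult_pos_pos) auto
  qed
  have alt: "(\<forall>l. \<exists>f. real (yrank I f) < thr \<and> 2 ^ (l * yrank I f) * \<bar>minor I e f\<bar> = \<psi> l) \<or>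
    (\<exists>l. \<forall>q. w \<le> (1 + N) * real M * q \<longrightarrow> real (card {j \<in> grid M. sheared_norm I e M j \<le> q})
      \<le> C ^ (d + 1) * C powr \<beta> * ((q / \<psi> l) powr \<beta> * 2 powr (real l * T)) * real M ^ d * real M powr E)"
    unfolding \<psi>_def C_def d_def N_def w_def by (rule count_weighted[OF M pos \<beta> branch[unfolded d_def]])
  consider (low) "\<And>l. \<exists>f. real (yrank I f) < thr \<and> 2 ^ (l * yrank I f) * \<bar>minor I e f\<bar> = \<psi> l"
    | (good) l where "\<And>q. w \<le> (1 + N) * real M * q \<Longrightarrow> real (card {j \<in> grid M. sheared_norm I e M j \<le> q})
      \<le> C ^ (d + 1) * C powr \<beta> * ((q / \<psi> l) powr \<beta> * 2 powr (real l * T)) * real M ^ d * real M powr E"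
    using alt by blast
  then show ?thesis
  proof cases
    case low
    have \<psi>pos: "0 < \<psi> l" for l
    proof -
      obtain f where "minor I e f \<noteq> 0" using pos by (auto simp: wnorm_pos_iff)
      then have "minor I (ydil (2 ^ l) \<circ> e) f \<noteq> 0" by (simp add: minor_ydil)
      then show ?thesis unfolding \<psi>_def wnorm_pos_iff by blast
    qed
    have "\<exists>A. (\<forall>f. real (yrank I f) < thr \<longrightarrow> yrank I f \<le> A) \<and> \<beta> * real A < T"
    proof (cases "thr = 1 \<and> T = 1 \<and> E = \<beta> - 1")
      case True
      then show ?thesis by (intro exI[of _ 0]) auto
    next
      case False
      then have thr: "\<beta> * thr = T" using branch \<beta> by (auto simp: field_simps)
      have "1 \<le> thr"
      proof -
        have "real d / \<beta> \<le> real d / 1" using \<beta> by (intro divide_left_mono) auto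
        then show ?thesis using branch False by auto
      qed
      \<comment> \<open>The largest integer below \<open>thr\<close>. Ranks are integers, and
        \<open>\<beta> * thr = T\<close> in this branch, so a strict gap to \<open>T\<close>
        remains.\<close>
      define A where "A = nat (\<lceil>thr\<rceil> - 1)"
      have "0 \<le> \<lceil>thr\<rceil> - 1" using \<open>1 \<le> thr\<close> by linarith
      then have A: "real A = of_int \<lceil>thr\<rceil> - 1" by (simp add: A_def)
      then have "real A < thr" by linarith
      then have "\<beta> * real A < T" unfolding thr[symmetric] using \<beta> by simp
      moreover have "yrank I f \<le> A" if "real (yrank I f) < thr" for f
      proof -
        have "real (yrank I f) < real A + 1" using that A by linarith
        then show ?thesis by linarith
      qed
      ultimately show ?thesis by blast
    qed
    then obtain A where A: "\<And>f. real (yrank I f) < thr \<Longrightarrow> yrank I f \<le> A" "\<beta> * real A < T" by blast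
    have lower: "w powr (- \<beta>) * (2 powr (T - \<beta> * real A)) ^ l \<le> 2 powr (real l * T) * \<psi> l powr (- \<beta>)" for l
    proof -
      obtain f where f: "real (yrank I f) < thr" "2 ^ (l * yrank I f) * \<bar>minor I e f\<bar> = \<psi> l" using low by blast
      have "\<psi> l \<le> 2 ^ (l * A) * w"
        unfolding f(2)[symmetric] w_def using A(1)[OF f(1)]
        by (intro mult_mono power_increasing minor_le_wnorm) auto
      then have "(2 ^ (l * A) * w) powr (- \<beta>) \<le> \<psi> l powr (- \<beta>)" using \<psi>pos \<beta> by (intro powr_mono2') auto
      also have "(2 ^ (l * A) * w) powr (- \<beta>) = 2 powr (- (\<beta> * real l * real A)) * w powr (- \<beta>)"
        using w by (simp add: powr_mult powr_powr powr_realpow[symmetric] mult_ac)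
      finally have "2 powr (real l * T) * (2 powr (- (\<beta> * real l * real A)) * w powr (- \<beta>)) \<le> 2 powr (real l * T) * \<psi> l powr (- \<beta>)"
        by (intro mult_left_mono) auto
      moreover have "2 powr (real l * T) * (2 powr (- (\<beta> * real l * real A)) * w powr (- \<beta>)) = w powr (- \<beta>) * (2 powr (T - \<beta> * real A)) ^ l"
        by (simp add: powr_add[symmetric] powr_powr powr_realpow[symmetric] algebra_simps)
      ultimately show ?thesis by simp
    qed
    have top: "(SUP l. ennreal (2 powr (real l * T) * \<psi> l powr (- \<beta>))) = top"
    proof (rule ennreal_SUP_eq_top)
      fix n :: nat
      have "1 < 2 powr (T - \<beta> * real A)" using A(2) by simp
      then obtain l where "real n / w powr (- \<beta>) < (2 powr (T - \<beta> * real A)) ^ l" using real_arch_pow by blast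
      then have "real n < w powr (- \<beta>) * (2 powr (T - \<beta> * real A)) ^ l" using w by (simp add: field_simps)
      then have "real n \<le> 2 powr (real l * T) * \<psi> l powr (- \<beta>)" using lower[of l] by linarith
      then have "of_nat n \<le> ennreal (2 powr (real l * T) * \<psi> l powr (- \<beta>))"
        by (simp add: ennreal_of_nat_eq_real_of_nat ennreal_leI)
      then show "\<exists>l\<in>UNIV. of_nat n \<le> ennreal (2 powr (real l * T) * \<psi> l powr (- \<beta>))" by blast
    qed
    have "ennreal c0 * top = top" using c0 by (simp add: ennreal_mult_top)
    then show ?thesis unfolding top c0_def U_def by simp
  next
    case good
    define Z where "Z = 2 powr (real l * T) * \<psi> l powr (- \<beta>)"
    have Z: "0 \<le> Z" by (simp add: Z_def)
    define q0 where "q0 = w / ((1 + N) * real M)"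
    have q0: "0 < q0" using w N M by (simp add: q0_def)
    have bounds: "q0 \<le> sheared_norm I e M j" "sheared_norm I e M j \<le> U * q0" if "j \<in> grid M" for j
    proof -
      have "U * q0 = (1 + N) * w" using N M by (simp add: U_def q0_def power2_eq_square)
      then show "q0 \<le> sheared_norm I e M j" "sheared_norm I e M j \<le> U * q0"
        using sheared_norm_bounds[OF M that, of I e]
        by (simp_all only: q0_def w_def N_def of_nat_add of_nat_1)
    qed
    have "(\<Sum>j\<in>grid M. sheared_norm I e M j powr (- \<beta>))
      \<le> (log 2 U + 1) * (2 powr \<beta> * (C ^ (d + 1) * C powr \<beta> * Z * real M ^ d * real M powr E))"
    proof (rule sum_dyadic_le[OF finite_grid q0 U1])
      fix q assume "q0 \<le> q"
      have NM: "0 < (1 + N) * real M" using N M by simp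
      have q: "w \<le> (1 + N) * real M * q" "0 < q"
        using \<open>q0 \<le> q\<close> q0 pos_divide_le_eq[OF NM, of w q] by (auto simp: q0_def mult.commute)
      have "(q / \<psi> l) powr \<beta> = q powr \<beta> * \<psi> l powr (- \<beta>)"
        using q(2) wnorm_nonneg by (simp add: powr_divide powr_minus_divide \<psi>_def)
      then show "real (card {j \<in> grid M. sheared_norm I e M j \<le> q}) \<le> C ^ (d + 1) * C powr \<beta> * Z * real M ^ d * real M powr E * q powr \<beta>"
        using good[OF q(1)] by (simp add: Z_def mult_ac)
    qed (use \<beta> bounds in auto)
    also have "\<dots> = c0 * Z" by (simp add: c0_def mult_ac)
    finally have "ennreal (\<Sum>j\<in>grid M. sheared_norm I e M j powr (- \<beta>)) \<le> ennreal c0 * ennreal Z"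
      using c0 Z by (simp add: ennreal_mult[symmetric] ennreal_leI)
    also have "\<dots> \<le> ennreal c0 * (SUP l. ennreal (2 powr (real l * T) * \<psi> l powr (- \<beta>)))"
      unfolding Z_def by (intro mult_left_mono SUP_upper) auto
    finally show ?thesis unfolding c0_def U_def .
  qed
qed

subsection \<open>Contraction of the height function\<close>

text \<open>Sampled at integer times, so that heights along it can be summed; the scalar factor
  makes the determinant 1.\<close>

definition central :: "nat \<Rightarrow> real ^ ('d::finite option + 'm::finite) \<Rightarrow> real ^ ('d option + 'm)" where
  "central l v = 2 powr (- (real l * (real (CARD('d) + 1) / real CARD('d option + 'm)))) *\<^sub>R ydil (2 ^ l) v"

text \<open>One step of the flow, preceded by the shear that selects a subcube, and scaled to
  determinant 1.\<close>

definition gstep :: "nat \<Rightarrow> real ^ 'd \<Rightarrow> real ^ ('d::finite option + 'm::finite) \<Rightarrow> real ^ ('d option + 'm)" where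
  "gstep M s v = real M powr (- (1 / real CARD('d option + 'm))) *\<^sub>R topdil (real M) (shear s v)"

lemma rowdet_scale_const: "rowdet (\<lambda>r :: 'r::finite. c *\<^sub>R v r) = c ^ CARD('r) * rowdet v"
  by (simp add: rowdet_scale_all)

lemma powr_neg_inverse_power: "0 < x \<Longrightarrow> 0 < n \<Longrightarrow> (x powr (- (1 / real n))) ^ n = inverse (x :: real)"
proof -
  assume x: "0 < x" and n: "0 < n"
  have "(x powr (- (1 / real n))) ^ n = (x powr (- (1 / real n))) powr real n"
    by (rule powr_realpow[symmetric]) (use x in simp)
  also have "\<dots> = x powr (- 1)" using n by (simp only: powr_powr) simp
  finally show ?thesis using x by (simp add: powr_minus)
qed

lemma unimodular_gstep:
  assumes "1 \<le> M"
  shows "unimodular (gstep M s :: real ^ ('d::finite option + 'm::finite) \<Rightarrow> _)"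
proof -
  let ?N = "CARD('d option + 'm)"
  have lin: "linear (gstep M s :: real ^ ('d option + 'm) \<Rightarrow> _)"
  proof (rule linearI)
    show "gstep M s (x + y) = gstep M s x + gstep M s y" for x y :: "real ^ ('d option + 'm)"
      by (simp add: gstep_def topdil_def scaleR_add_right linear_add[OF linear_shear] linear_add[OF linear_diag_map])
    show "gstep M s (c *\<^sub>R x) = c *\<^sub>R gstep M s x" for c and x :: "real ^ ('d option + 'm)"
      by (simp add: gstep_def topdil_def linear_scale[OF linear_shear] linear_scale[OF linear_diag_map])
  qed
  have "rowdet (\<lambda>r :: 'd option + 'm. gstep M s (axis r 1))
    = (real M powr (- (1 / real ?N))) ^ ?N * rowdet (\<lambda>r :: 'd option + 'm. topdil (real M) (shear s (axis r 1)))"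
    unfolding gstep_def by (rule rowdet_scale_const)
  also have "(real M powr (- (1 / real ?N))) ^ ?N = inverse (real M)"
    using assms by (intro powr_neg_inverse_power) (auto simp: card_gt_0_iff)
  also have "rowdet (\<lambda>r :: 'd option + 'm. topdil (real M) (shear s (axis r 1))) = real M"
    unfolding topdil_def using rowdet_linear[OF linear_diag_map, of _ "\<lambda>r :: 'd option + 'm. shear s (axis r 1)"]
    by (simp only: rowdet_shear rowdet_diag_map prod_topdil mult_1)
  finally show ?thesis using assms lin by (simp add: unimodular_def)
qed

lemma unimodular_central: "unimodular (central l :: real ^ ('d::finite option + 'm::finite) \<Rightarrow> _)"
proof -
  define N where "N = CARD('d option + 'm)"
  have N: "0 < N" by (simp add: N_def card_gt_0_iff)
  have lin: "linear (central l :: real ^ ('d option + 'm) \<Rightarrow> _)"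
  proof (rule linearI)
    show "central l (x + y) = central l x + central l y" for x y :: "real ^ ('d option + 'm)"
      by (simp add: central_def ydil_def scaleR_add_right linear_add[OF linear_diag_map])
    show "central l (c *\<^sub>R x) = c *\<^sub>R central l x" for c and x :: "real ^ ('d option + 'm)"
      by (simp add: central_def ydil_def linear_scale[OF linear_diag_map])
  qed
  let ?c = "2 powr (- (real l * (real (CARD('d) + 1) / real N)))"
  have "rowdet (\<lambda>r :: 'd option + 'm. central l (axis r 1))
    = ?c ^ N * rowdet (\<lambda>r :: 'd option + 'm. ydil (2 ^ l) (axis r 1))"
    unfolding central_def N_def by (rule rowdet_scale_const)
  also have "rowdet (\<lambda>r :: 'd option + 'm. ydil (2 ^ l) (axis r 1)) = (2 ^ l) ^ (CARD('d) + 1)"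
    unfolding ydil_def by (simp only: rowdet_diag_map prod_case_sum)
  also have "?c ^ N = 2 powr (- (real l * real (CARD('d) + 1)))"
    using N by (simp add: powr_powr flip: powr_realpow)
  also have "(2 ^ l) ^ (CARD('d) + 1) = (2::real) powr (real l * real (CARD('d) + 1))"
    by (simp only: power_mult[symmetric] of_nat_mult[symmetric] powr_realpow zero_less_numeral)
  also have "2 powr (- (real l * real (CARD('d) + 1))) * 2 powr (real l * real (CARD('d) + 1)) = 1"
    by (simp only: powr_add[symmetric]) simp
  finally show ?thesis using lin by (simp add: unimodular_def)
qed

lemma central_0: "central 0 v = v"
  by (simp add: central_def ydil_def diag_map_def vec_eq_iff split: sum.split)

lemma central_add: "central k (central l v) = central (k + l) v"
proof -
  define c where "c i = 2 powr (- (real i * (real (CARD('a) + 1) / real CARD('a option + 'b))))" for i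
  have c: "c (k + l) = c k * c l"
    unfolding c_def powr_add[symmetric] of_nat_add[of k l] distrib_right[of "real k"] minus_add_distrib ..
  have cv: "central i w = c i *\<^sub>R ydil (2 ^ i) w" for i and w :: "real ^ ('a option + 'b)"
    by (simp only: central_def c_def)
  have "central k (central l v) $ r = central (k + l) v $ r" for r
    unfolding cv c by (cases r) (simp_all add: ydil_def diag_map_def power_add)
  then show ?thesis by (simp add: vec_eq_iff)
qed

lemma ydil_shear: "ydil X (shear s v) = shear s (ydil X v)"
proof -
  have "ydil X (shear s v) $ r = shear s (ydil X v) $ r" for r
    by (cases r) (simp_all add: ydil_def diag_map_def shear_def axis_def algebra_simps sum_distrib_left)
  then show ?thesis by (simp add: vec_eq_iff)
qed

lemma ydil_topdil: "ydil X (topdil Y v) = topdil Y (ydil X v)"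
  by (simp add: ydil_def topdil_def diag_map_def vec_eq_iff)

lemma central_shear: "central l (shear s v) = shear s (central l v)"
  by (simp add: central_def ydil_shear linear_scale[OF linear_shear])

lemma central_gstep: "central l (gstep M s v) = gstep M s (central l v)"
proof -
  have "ydil X (c *\<^sub>R v) = c *\<^sub>R ydil X v" "topdil X (c *\<^sub>R v) = c *\<^sub>R topdil X v" for X c and v :: "real ^ ('a option + 'b)"
    by (simp_all add: ydil_def topdil_def linear_scale[OF linear_diag_map])
  then show ?thesis by (simp add: central_def gstep_def linear_scale[OF linear_shear] ydil_shear ydil_topdil)
qed

lemma infnorm_shear_le:
  fixes v :: "real ^ ('d::finite option + 'm::finite)"
  assumes "\<And>a. \<bar>s $ a\<bar> \<le> B"
  shows "infnorm (shear s v) \<le> (1 + CARD('d) * B) * infnorm v"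
  unfolding infnorm_le_iff
proof
  have B: "0 \<le> B" using assms abs_ge_zero order_trans by blast
  fix r show "\<bar>shear s v $ r\<bar> \<le> (1 + CARD('d) * B) * infnorm v"
  proof (cases "r = top_row")
    case True
    have "\<bar>\<Sum>a\<in>UNIV. s $ a * v $ Inl (Some a)\<bar> \<le> (\<Sum>a\<in>(UNIV::'d set). B * infnorm v)"
    proof (rule order_trans[OF sum_abs], rule sum_mono)
      fix a show "\<bar>s $ a * v $ Inl (Some a)\<bar> \<le> B * infnorm v"
        unfolding abs_mult using assms B component_le_infnorm_cart by (intro mult_mono) auto
    qed
    then show ?thesis
      using True component_le_infnorm_cart[of v top_row] by (simp add: shear_top algebra_simps)
  next
    case False
    have "1 * infnorm v \<le> (1 + CARD('d) * B) * infnorm v"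
      using B by (intro mult_right_mono infnorm_pos_le) auto
    then show ?thesis using False component_le_infnorm_cart[of v r] by (simp add: shear_other)
  qed
qed

lemma gstep_lipschitz:
  fixes v :: "real ^ ('d::finite option + 'm::finite)"
  assumes M: "1 \<le> M" and s: "\<And>a. \<bar>s $ a\<bar> \<le> 1"
  shows "infnorm (gstep M s v) \<le> real M * (1 + CARD('d)) * infnorm v"
    and "infnorm v \<le> real M * (1 + CARD('d)) * infnorm (gstep M s v)"
proof -
  let ?c = "real M powr (- (1 / real CARD('d option + 'm)))"
  have c: "0 < ?c" using M by simp
  have "?c \<le> real M powr 0" using M by (intro powr_mono) auto
  then have c1: "?c \<le> 1" using M by simp
  have "real M powr (- 1) \<le> ?c"
    using M card_sum_rows_gt_1[where 'd = 'd and 'm = 'm] by (intro powr_mono) (auto simp: field_simps)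
  then have c2: "1 \<le> real M * ?c" using M by (simp add: powr_minus field_simps)
  have g: "infnorm (gstep M s v) = ?c * infnorm (topdil (real M) (shear s v))"
    by (simp add: gstep_def infnorm_mul)
  have t1: "infnorm (topdil (real M) w) \<le> real M * infnorm w" for w :: "real ^ ('d option + 'm)"
    unfolding infnorm_le_iff
  proof
    fix r
    have "1 * infnorm w \<le> real M * infnorm w" using M by (intro mult_right_mono infnorm_pos_le) auto
    then show "\<bar>topdil (real M) w $ r\<bar> \<le> real M * infnorm w"
      using component_le_infnorm_cart[of w r] M by (auto simp: topdil_def diag_map_def abs_mult mult_left_mono)
  qed
  have t2: "infnorm w \<le> infnorm (topdil (real M) w)" for w :: "real ^ ('d option + 'm)"
    unfolding infnorm_le_iff
  proof
    fix r
    have "1 * \<bar>w $ r\<bar> \<le> real M * \<bar>w $ r\<bar>" using M by (intro mult_right_mono) auto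
    then have "\<bar>w $ r\<bar> \<le> \<bar>topdil (real M) w $ r\<bar>" by (auto simp: topdil_def diag_map_def abs_mult)
    then show "\<bar>w $ r\<bar> \<le> infnorm (topdil (real M) w)" using component_le_infnorm_cart order_trans by blast
  qed
  have "infnorm (topdil (real M) (shear s v)) \<le> real M * ((1 + CARD('d)) * infnorm v)"
    using order_trans[OF t1[of "shear s v"] mult_left_mono[OF infnorm_shear_le[of s 1 v], of "real M"]] s by simp
  then show "infnorm (gstep M s v) \<le> real M * (1 + CARD('d)) * infnorm v"
    unfolding g using mult_mono[OF c1 _ zero_le_one infnorm_pos_le[of "topdil (real M) (shear s v)"]] by (simp add: mult_ac)
  have "infnorm v = infnorm (shear (- s) (shear s v))" by (simp add: shear_add shear_0)
  also have "\<dots> \<le> (1 + CARD('d)) * infnorm (shear s v)" using infnorm_shear_le[of "- s" 1 "shear s v"] s by simp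
  also have "\<dots> \<le> (1 + CARD('d)) * (infnorm (topdil (real M) (shear s v)) * (real M * ?c))"
  proof (intro mult_left_mono)
    have "infnorm (topdil (real M) (shear s v)) * 1 \<le> infnorm (topdil (real M) (shear s v)) * (real M * ?c)"
      using c2 by (intro mult_left_mono infnorm_pos_le)
    then show "infnorm (shear s v) \<le> infnorm (topdil (real M) (shear s v)) * (real M * ?c)"
      using t2[of "shear s v"] by linarith
  qed simp
  finally show "infnorm v \<le> real M * (1 + CARD('d)) * infnorm (gstep M s v)"
    unfolding g by (simp only: mult_ac)
qed

text \<open>The two linear pieces reflect that the height is governed by the shortest vectors of the lattice
  and of its dual; \<open>p\<close> is the growth of the height along \<^const>\<open>central\<close> that can be tolerated.\<close>

definition slice_weight :: "nat \<Rightarrow> nat \<Rightarrow> real \<Rightarrow> nat \<Rightarrow> real" where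
  "slice_weight d N p i = min (real i * (real (d + 1) / real N) / (1 + p))
     ((real (d + 1) - real i * (real (d + 1) / real N)) / (real d - p))"

text \<open>Among the ranks 1 to N - 1 the first piece of \<open>slice_weight\<close> is least at 1
  and the second at N - 1; these are the reciprocals of the two values.\<close>

definition slice_bound :: "nat \<Rightarrow> nat \<Rightarrow> real \<Rightarrow> real" where
  "slice_bound d N p = max ((1 + p) / (real (d + 1) / real N)) ((real d - p) / (real (d + 1) / real N))"

section \<open>Weights and exponents for a fixed growth rate \<open>p\<close>\<close>

locale slice =
  fixes L :: "(real ^ ('d::finite option + 'm::finite)) set" and p :: real
  assumes closed: "\<And>x y z. x \<in> L \<Longrightarrow> y \<in> L \<Longrightarrow> x + of_int z *\<^sub>R y \<in> L"
    and covol: "\<And>v. (\<And>k. v k \<in> L) \<Longrightarrow> rowdet v \<noteq> 0 \<Longrightarrow> 1 \<le> \<bar>rowdet v\<bar>"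
    and p: "0 < p" "p < real CARD('d)"
begin

definition d :: nat where "d = CARD('d)"
definition N :: nat where "N = CARD('d option + 'm)"
definition \<theta> :: real where "\<theta> = real (d + 1) / real N"
definition \<phi> :: "nat \<Rightarrow> real" where "\<phi> = slice_weight d N p"
definition b :: real where "b = slice_bound d N p"

lemma N_gt: "1 < N" "d + 1 \<le> N"
  using card_sum_rows_gt_1[where 'd = 'd and 'm = 'm] by (simp_all add: N_def d_def card_option)

lemma p': "p < real d" using p by (simp add: d_def)

lemma \<theta>: "0 < \<theta>" "real N * \<theta> = real d + 1"
  using N_gt by (simp_all add: \<theta>_def)

lemma \<phi>_eq: "\<phi> i = min (real i * \<theta> / (1 + p)) ((real d + 1 - real i * \<theta>) / (real d - p))"
  by (simp add: \<phi>_def slice_weight_def \<theta>_def add.commute)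

lemma b_eq: "b = max ((1 + p) / \<theta>) ((real d - p) / \<theta>)"
  by (simp add: b_def slice_bound_def \<theta>_def)

lemma b_pos: "0 < b"
  using \<theta>(1) p by (simp add: b_eq less_max_iff_disj)

lemma \<phi>_bounds:
  assumes "0 < i" "i < N"
  shows "0 < \<phi> i" "1 / \<phi> i \<le> b"
proof -
  have 1: "\<theta> \<le> real i * \<theta>" using assms(1) \<theta>(1) by (simp add: mult_le_cancel_right1)
  have "(real i + 1) * \<theta> \<le> real N * \<theta>" using assms(2) \<theta>(1) by (intro mult_right_mono) auto
  then have 2: "\<theta> \<le> real d + 1 - real i * \<theta>" unfolding \<theta>(2) by (simp add: algebra_simps)
  have "\<theta> / (1 + p) \<le> real i * \<theta> / (1 + p)" "\<theta> / (real d - p) \<le> (real d + 1 - real i * \<theta>) / (real d - p)"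
    using 1 2 p p' by (auto intro!: divide_right_mono)
  moreover have "0 < \<theta> / (1 + p)" "0 < \<theta> / (real d - p)" using \<theta>(1) p p' by simp_all
  ultimately have lo: "min (\<theta> / (1 + p)) (\<theta> / (real d - p)) \<le> \<phi> i" "0 < min (\<theta> / (1 + p)) (\<theta> / (real d - p))"
    unfolding \<phi>_eq by auto
  then show "0 < \<phi> i" by linarith
  have "1 / \<phi> i \<le> 1 / min (\<theta> / (1 + p)) (\<theta> / (real d - p))"
    using lo by (intro divide_left_mono) auto
  also have "\<dots> \<le> b" unfolding b_eq min_def by auto
  finally show "1 / \<phi> i \<le> b" .
qed

lemma \<phi>_le_1: "\<phi> i \<le> 1"
proof (cases "real i * \<theta> \<le> 1 + p")
  case True
  then have "real i * \<theta> / (1 + p) \<le> 1" using p by simp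
  then show ?thesis by (simp add: \<phi>_eq min_le_iff_disj)
next
  case False
  then have "(real d + 1 - real i * \<theta>) / (real d - p) \<le> 1" using p' by simp
  then show ?thesis by (simp add: \<phi>_eq min_le_iff_disj)
qed

lemma \<phi>_mid:
  assumes "0 < i"
  shows "\<phi> (i - 1) + \<phi> (i + 1) \<le> 2 * \<phi> i"
proof -
  define f where "f x = x * \<theta> / (1 + p)" for x
  define g where "g x = (real d + 1 - x * \<theta>) / (real d - p)" for x
  have i: "real (i - 1) = real i - 1" "real (i + 1) = real i + 1" using assms by auto
  have "f (real i - 1) + f (real i + 1) = 2 * f (real i)"
    by (simp add: f_def add_divide_distrib[symmetric] algebra_simps)
  moreover have "g (real i - 1) + g (real i + 1) = 2 * g (real i)"
    by (simp add: g_def add_divide_distrib[symmetric] algebra_simps)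
  moreover have \<phi>j: "\<phi> j = min (f (real j)) (g (real j))" for j by (simp only: \<phi>_eq f_def g_def)
  have "\<phi> (i - 1) = min (f (real i - 1)) (g (real i - 1))" "\<phi> (i + 1) = min (f (real i + 1)) (g (real i + 1))"
      "\<phi> i = min (f (real i)) (g (real i))"
    by (simp_all only: \<phi>j i)
  ultimately show ?thesis by linarith
qed

end

sublocale slice \<subseteq> height L "slice.\<phi> TYPE('d) TYPE('m) p" "slice.b TYPE('d) TYPE('m) p"
proof
  have "0 \<le> (real d + 1) / (real d - p)" using p' by (intro divide_nonneg_pos) auto
  then show "\<phi> 0 = 0" by (simp add: \<phi>_eq)
  show "\<phi> CARD('d option + 'm) = 0" using p \<theta> by (simp add: \<phi>_eq N_def[symmetric] del: card_sum)
qed (use closed covol \<phi>_bounds \<phi>_le_1 \<phi>_mid in \<open>auto simp: N_def\<close>)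

context slice
begin

text \<open>On each linear piece of the weight, \<open>\<beta>\<close> is the exponent for which
  \<open>T\<close> equals the rate \<open>\<theta> * i * \<beta>\<close>, caused by the scalar in
  \<open>central\<close>, minus the discount \<open>p\<close>. The first piece goes with the count
  by one condition, the second with the count by several, and both lead to the same power of
  \<open>M\<close>.\<close>

lemma branches:
  assumes i: "0 < i" "i < N"
  defines "\<beta> \<equiv> 1 / \<phi> i"
  obtains thr T E where "1 \<le> \<beta>" "\<beta> \<le> b" "T = \<theta> * real i * \<beta> - p"
    "(real i / real N - 1) * \<beta> + real d + E = real d - (real d - p) / (real d + 1)"
    "(thr = 1 \<and> T = 1 \<and> E = \<beta> - 1) \<or> (thr = real d + 1 - real d / \<beta> \<and> T = \<beta> * (real d + 1) - real d \<and> E = 0)"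
proof -
  note pos = \<phi>_bounds[OF i]
  have \<beta>: "1 \<le> \<beta>" "\<beta> \<le> b" "\<beta> * \<phi> i = 1"
    using pos \<phi>_le_1[of i] by (auto simp: \<beta>_def)
  have iN: "real i / real N = real i * \<theta> / (real d + 1)" 
  proof -
    have "\<theta> / (real d + 1) = 1 / real N" unfolding \<theta>_def by (simp add: add.commute)
    then show ?thesis by (metis mult.right_neutral times_divide_eq_right)
  qed
  have d1: "0 < real d + 1" by simp
  have "\<phi> i = real i * \<theta> / (1 + p) \<or> \<phi> i = (real d + 1 - real i * \<theta>) / (real d - p)"
    unfolding \<phi>_eq min_def by simp
  then consider "\<phi> i = real i * \<theta> / (1 + p)" | "\<phi> i = (real d + 1 - real i * \<theta>) / (real d - p)" by blast
  then show thesis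
  proof cases
    case 1
    then have "real i * \<theta> = \<phi> i * (1 + p)" using p by simp
    then have "\<theta> * real i * \<beta> = (\<beta> * \<phi> i) * (1 + p)" by (simp add: mult_ac)
    then have e: "\<theta> * real i * \<beta> = 1 + p" using \<beta>(3) by simp
    have "real i / real N * \<beta> = (1 + p) / (real d + 1)" unfolding iN using e by (simp add: mult_ac)
    then have "(real i / real N - 1) * \<beta> + real d + (\<beta> - 1) = (1 + p) / (real d + 1) + real d - 1"
      by (simp add: algebra_simps)
    also have "\<dots> = real d - (real d - p) / (real d + 1)" using d1 by (simp add: field_simps)
    finally show thesis using that[of 1 "\<beta> - 1" 1] \<beta> e by auto
  next
    case 2
    then have "real d + 1 - real i * \<theta> = \<phi> i * (real d - p)" using p' by simp
    then have "\<beta> * (real d + 1 - real i * \<theta>) = (\<beta> * \<phi> i) * (real d - p)" by simp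
    then have e: "\<beta> * (real d + 1 - real i * \<theta>) = real d - p" using \<beta>(3) by simp
    have "(real i / real N - 1) * \<beta> = - (\<beta> * (real d + 1 - real i * \<theta>)) / (real d + 1)"
      unfolding iN using d1 by (simp add: field_simps)
    then have "(real i / real N - 1) * \<beta> + real d + 0 = real d - (real d - p) / (real d + 1)"
      unfolding e by (simp add: minus_divide_left)
    moreover have "\<beta> * (real d + 1) - real d = \<theta> * real i * \<beta> - p" using e by (simp add: algebra_simps)
    ultimately show thesis using that[of "\<beta> * (real d + 1) - real d" 0] \<beta> by auto
  qed
qed

text \<open>Equal to (d^2 + p) / (d + 1), the bound that the counting of subcubes will give for the
  dimension.\<close>

definition dim_exp :: real where "dim_exp = real d - (real d - p) / (real d + 1)"

definition logf :: "nat \<Rightarrow> real" where "logf M = log 2 ((1 + real N)\<^sup>2 * real M) + 1"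

definition avg_const :: real where
  "avg_const = 2 powr b * (grid_const TYPE('d) TYPE('m) ^ (d + 1) * grid_const TYPE('d) TYPE('m) powr b)"

lemma logf_pos: "1 \<le> M \<Longrightarrow> 0 < logf M"
proof -
  assume M: "1 \<le> M"
  have "1 * 1 \<le> (1 + real N)\<^sup>2 * real M" using M by (intro mult_mono one_le_power) auto
  then show ?thesis by (simp add: logf_def add_nonneg_pos)
qed

text \<open>This is \<open>grid_average\<close> for the unimodular maps: the scalars in
  \<open>gstep\<close> and \<open>central\<close> become powers of \<open>M\<close> and of 2, and
  \<open>branches\<close> combines them into \<open>dim_exp\<close> and the discount
  \<open>p\<close>.\<close>

lemma average_wnorm:
  assumes h: "unimodular h" and M: "1 \<le> M" and K: "0 < K" and t: "indep_tuple I e"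
  shows "(\<Sum>j\<in>grid M. ennreal ((K ^ (card I * (N - card I)) * wnorm I (gstep M (grid_pt M j) \<circ> h \<circ> e)) powr (- (1 / \<phi> (card I)))))
    \<le> ennreal (avg_const * logf M * real M powr dim_exp) *
      (SUP l. ennreal (2 powr (- (real l * p))) *
        ennreal ((K ^ (card I * (N - card I)) * wnorm I (central l \<circ> h \<circ> e)) powr (- (1 / \<phi> (card I)))))"
proof -
  define i where "i = card I"
  define \<beta> where "\<beta> = 1 / \<phi> i"
  define k where "k = K ^ (i * (N - i))"
  have i: "0 < i" "i < N" using indep_tuple_card[OF t] by (simp_all add: i_def N_def)
  obtain thr T E where br: "1 \<le> \<beta>" "\<beta> \<le> b" "T = \<theta> * real i * \<beta> - p"
    "(real i / real N - 1) * \<beta> + real d + E = real d - (real d - p) / (real d + 1)"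
    "(thr = 1 \<and> T = 1 \<and> E = \<beta> - 1) \<or> (thr = real d + 1 - real d / \<beta> \<and> T = \<beta> * (real d + 1) - real d \<and> E = 0)"
    using branches[OF i] unfolding \<beta>_def by blast
  let ?v = "h \<circ> e"
  have k: "0 < k" using K by (simp add: k_def)
  have pos: "0 < wnorm I ?v" using t h by (simp add: indep_tuple_def wnorm_unimodular_pos)
  define S where "S j = sheared_norm I ?v M j" for j
  define \<psi> where "\<psi> l = wnorm I (ydil (2 ^ l) \<circ> ?v)" for l
  have M0: "0 < real M" using M by simp
  have g: "(k * wnorm I (gstep M (grid_pt M j) \<circ> h \<circ> e)) powr (- \<beta>)
    = k powr (- \<beta>) * real M powr ((real i / real N - 1) * \<beta>) * S j powr (- \<beta>)" for j
  proof -
    have "wnorm I (gstep M (grid_pt M j) \<circ> h \<circ> e)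
      = wnorm I (\<lambda>r. (real M powr (- (1 / real N))) *\<^sub>R (topdil (real M) \<circ> shear (grid_pt M j) \<circ> ?v) r)"
      by (rule wnorm_cong) (simp add: gstep_def N_def del: card_sum)
    also have "\<dots> = (real M powr (- (1 / real N))) ^ i * wnorm I (topdil (real M) \<circ> shear (grid_pt M j) \<circ> ?v)"
      unfolding wnorm_scaleR i_def by (simp only: abs_of_nonneg powr_ge_zero)
    also have "wnorm I (topdil (real M) \<circ> shear (grid_pt M j) \<circ> ?v) = real M * S j"
      using M unfolding S_def sheared_norm_def[OF M] by simp
    also have "(real M powr (- (1 / real N))) ^ i * (real M * S j) = real M powr (1 - real i / real N) * S j"
    proof -
      have "(real M powr (- (1 / real N))) ^ i = real M powr (- (1 / real N) * real i)"
        using M0 by (subst powr_realpow[symmetric]) (auto simp: powr_powr)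
      moreover have "real M powr (- (1 / real N) * real i) * real M powr 1 = real M powr (1 - real i / real N)"
        unfolding powr_add[symmetric] by simp
      ultimately show ?thesis using M0 by (simp add: mult_ac)
    qed
    finally have "k * wnorm I (gstep M (grid_pt M j) \<circ> h \<circ> e) = k * (real M powr (1 - real i / real N) * S j)" by (simp only:)
    moreover have "0 \<le> S j" unfolding S_def sheared_norm_def[OF M] by (simp add: wnorm_nonneg)
    ultimately have "(k * wnorm I (gstep M (grid_pt M j) \<circ> h \<circ> e)) powr (- \<beta>)
      = k powr (- \<beta>) * ((real M powr (1 - real i / real N)) powr (- \<beta>) * S j powr (- \<beta>))"
      using k by (simp only: powr_mult powr_ge_zero mult_nonneg_nonneg less_imp_le)
    also have "(real M powr (1 - real i / real N)) powr (- \<beta>) = real M powr ((real i / real N - 1) * \<beta>)"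
      unfolding powr_powr by (simp add: algebra_simps)
    finally show ?thesis by (simp only: mult_ac)
  qed
  have c: "k powr (- \<beta>) * (2 powr (real l * T) * \<psi> l powr (- \<beta>))
    = 2 powr (- (real l * p)) * (k * wnorm I (central l \<circ> h \<circ> e)) powr (- \<beta>)" for l
  proof -
    have "wnorm I (central l \<circ> h \<circ> e)
      = wnorm I (\<lambda>r. (2 powr (- (real l * \<theta>))) *\<^sub>R (ydil (2 ^ l) \<circ> ?v) r)"
      by (rule wnorm_cong) (simp add: central_def \<theta>_def d_def N_def del: card_sum)
    also have "\<dots> = (2 powr (- (real l * \<theta>))) ^ i * \<psi> l"
      unfolding wnorm_scaleR i_def \<psi>_def by (simp only: abs_of_nonneg powr_ge_zero)
    also have "(2 powr (- (real l * \<theta>))) ^ i = 2 powr (- (real l * \<theta>) * real i)"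
      by (subst powr_realpow[symmetric]) (auto simp: powr_powr)
    finally have e1: "(k * wnorm I (central l \<circ> h \<circ> e)) powr (- \<beta>)
      = k powr (- \<beta>) * ((2 powr (- (real l * \<theta>) * real i)) powr (- \<beta>) * \<psi> l powr (- \<beta>))"
      using k wnorm_nonneg unfolding \<psi>_def by (simp only: powr_mult powr_ge_zero mult_nonneg_nonneg less_imp_le)
    have e2: "2 powr (- (real l * p)) * (2 powr (- (real l * \<theta>) * real i)) powr (- \<beta>) = 2 powr (real l * T)"
      unfolding powr_powr powr_add[symmetric] br(3) by (simp add: algebra_simps)
    show ?thesis unfolding e1 e2[symmetric] by (simp only: mult_ac)
  qed
  define A where "A = (log 2 ((1 + real N)\<^sup>2 * real M) + 1) * (2 powr \<beta> * (grid_const TYPE('d) TYPE('m) ^ (d + 1) * grid_const TYPE('d) TYPE('m) powr \<beta>)) * real M ^ d * real M powr E"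
  have avg: "ennreal (\<Sum>j\<in>grid M. S j powr (- \<beta>)) \<le> ennreal A * (SUP l. ennreal (2 powr (real l * T) * \<psi> l powr (- \<beta>)))"
    unfolding S_def \<psi>_def A_def d_def N_def
    by (rule grid_average[OF M pos br(1) br(5)[unfolded d_def]])
  have gc: "1 \<le> grid_const TYPE('d) TYPE('m)" by (rule grid_const_ge(1))
  have A0: "0 \<le> A" unfolding A_def using gc logf_pos[OF M] M0 by (intro mult_nonneg_nonneg) (auto simp: logf_def)
  let ?m = "real M powr ((real i / real N - 1) * \<beta>)"
  have mA: "?m * A \<le> avg_const * logf M * real M powr dim_exp"
  proof -
    have me: "?m * (real M ^ d * real M powr E) = real M powr dim_exp"
    proof -
      have "?m * (real M powr real d * real M powr E) = real M powr dim_exp"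
        unfolding powr_add[symmetric] dim_exp_def br(4)[symmetric] by (simp only: add.assoc)
      then show ?thesis using M0 by (simp only: powr_realpow)
    qed
    have "?m * A = logf M * (2 powr \<beta> * (grid_const TYPE('d) TYPE('m) ^ (d + 1) * grid_const TYPE('d) TYPE('m) powr \<beta>)) * real M powr dim_exp"
      unfolding A_def logf_def me[symmetric] by (simp only: mult_ac)
    also have "\<dots> \<le> logf M * avg_const * real M powr dim_exp"
      unfolding avg_const_def using br(1,2) gc logf_pos[OF M]
      by (intro mult_right_mono mult_left_mono mult_mono powr_mono) auto
    finally show ?thesis by (simp only: mult_ac)
  qed
  have "(\<Sum>j\<in>grid M. ennreal ((k * wnorm I (gstep M (grid_pt M j) \<circ> h \<circ> e)) powr (- \<beta>)))
    = ennreal (k powr (- \<beta>) * ?m) * ennreal (\<Sum>j\<in>grid M. S j powr (- \<beta>))"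
    unfolding g by (simp add: ennreal_mult[symmetric] sum_nonneg sum_distrib_left)
  also have "\<dots> \<le> ennreal (k powr (- \<beta>) * ?m) * (ennreal A * (SUP l. ennreal (2 powr (real l * T) * \<psi> l powr (- \<beta>))))"
    by (rule mult_left_mono[OF avg]) simp
  also have "\<dots> = ennreal (?m * A) * (ennreal (k powr (- \<beta>)) * (SUP l. ennreal (2 powr (real l * T) * \<psi> l powr (- \<beta>))))"
    using A0 by (simp add: ennreal_mult mult_ac)
  also have "ennreal (k powr (- \<beta>)) * (SUP l. ennreal (2 powr (real l * T) * \<psi> l powr (- \<beta>)))
    = (SUP l. ennreal (2 powr (- (real l * p))) * ennreal ((k * wnorm I (central l \<circ> h \<circ> e)) powr (- \<beta>)))"
    unfolding SUP_mult_left_ennreal using c by (simp add: ennreal_mult[symmetric])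
  also have "ennreal (?m * A) * \<dots> \<le> ennreal (avg_const * logf M * real M powr dim_exp) * \<dots>"
    using mA by (intro mult_right_mono ennreal_leI) auto
  finally show ?thesis unfolding k_def \<beta>_def i_def .
qed

end

section \<open>Series of extended nonnegative reals\<close>

lemma ennreal_suminf_swap:
  fixes f :: "nat \<Rightarrow> nat \<Rightarrow> ennreal"
  shows "(\<Sum>i. \<Sum>j. f i j) = (\<Sum>j. \<Sum>i. f i j)"
proof -
  have "(\<Sum>i. \<Sum>j. f i j) = (\<integral>\<^sup>+i. (\<Sum>j. f i j) \<partial>count_space UNIV)"
    by (simp add: nn_integral_count_space_nat)
  also have "\<dots> = (\<Sum>j. \<integral>\<^sup>+i. f i j \<partial>count_space UNIV)"
    by (rule nn_integral_suminf) simp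
  finally show ?thesis by (simp add: nn_integral_count_space_nat)
qed

lemma ennreal_suminf_shift_le: "(\<Sum>i. f (i + k)) \<le> (\<Sum>i. f i :: ennreal)"
proof -
  have "(\<Sum>i. f i) = (\<Sum>i. f (i + k)) + (\<Sum>i<k. f i)"
    by (rule suminf_offset) simp
  then show ?thesis by simp
qed

lemma ennreal_SUP_le_suminf: "(SUP i. f i) \<le> (\<Sum>i. f i :: ennreal)"
proof (rule SUP_least)
  fix i
  have "f i = (\<Sum>j\<in>{i}. f j)" by simp
  also have "\<dots> \<le> (\<Sum>j. f j)" by (rule sum_le_suminf) auto
  finally show "f i \<le> (\<Sum>j. f j)" .
qed

definition geom :: "real \<Rightarrow> real" where "geom x = 1 / (1 - 2 powr (- x))"

lemma geom_pos: "0 < x \<Longrightarrow> 0 < geom x"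
  by (simp add: geom_def powr_less_one)

lemma suminf_geom: "0 < x \<Longrightarrow> (\<Sum>l. ennreal (2 powr (- (real l * x)))) = ennreal (geom x)"
proof -
  assume x: "0 < x"
  have eq: "2 powr (- (real l * x)) = (2 powr (- x)) ^ l" for l
    by (simp add: powr_powr powr_realpow[symmetric] mult.commute)
  have lt: "2 powr (- x) < 1" using x by (simp add: powr_less_one)
  show ?thesis unfolding eq geom_def
    using lt by (intro suminf_ennreal_eq geometric_sums) auto
qed

context slice
begin

section \<open>The averaged inequality for heights and for their sum\<close>

definition step_lip :: "nat \<Rightarrow> real" where "step_lip M = real M * (1 + real d)"

text \<open>Just above the threshold that \<open>dominating_tuples\<close> demands for maps with
  Lipschitz constant \<open>step_lip M\<close>. The weight thus depends on \<open>M\<close>, but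
  \<open>mult_const\<close> below does not involve it.\<close>

definition height_scale :: "nat \<Rightarrow> real" where
  "height_scale M = fact N * (2 * step_lip M powr (2 * (real N * b))) + 1"

definition add_const :: "nat \<Rightarrow> real" where "add_const M = step_lip M powr (real N * b) * real M ^ d"

definition mult_const :: "nat \<Rightarrow> real" where
  "mult_const M = real N * (2 * fact N powr b) * 3 powr (real N * real N * b) * (avg_const * logf M * real M powr dim_exp)"

lemma step_lip_ge: "1 \<le> M \<Longrightarrow> 1 \<le> step_lip M"
  unfolding step_lip_def using mult_mono[of 1 "real M" 1 "1 + real d"] by simp

lemma height_scale_pos: "0 < height_scale M"
  unfolding height_scale_def by (intro add_nonneg_pos mult_nonneg_nonneg) auto

lemma avg_const_pos: "0 < avg_const"
  unfolding avg_const_def using grid_const_ge(1)[where 'd = 'd and 'm = 'm] by (intro mult_pos_pos) auto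

lemma mult_const_pos: "1 \<le> M \<Longrightarrow> 0 < mult_const M"
  unfolding mult_const_def using N_gt avg_const_pos logf_pos by (intro mult_pos_pos) auto

text \<open>If the height of \<open>h\<close> is infinite, so is the term \<open>l = 0\<close> of
  the supremum. Otherwise one tuple per rank is averaged, and \<open>wnorm_le_lat_height\<close>
  leads from its covolumes back to heights.\<close>

lemma lat_height_average:
  assumes h: "unimodular h" and M: "1 \<le> M"
  defines "K \<equiv> height_scale M"
  shows "(\<Sum>j\<in>grid M. lat_height K (gstep M (grid_pt M j) \<circ> h))
    \<le> ennreal (add_const M) + ennreal (mult_const M) * (SUP l. ennreal (2 powr (- (real l * p))) * lat_height K (central l \<circ> h))"
proof -
  let ?S = "SUP l. ennreal (2 powr (- (real l * p))) * lat_height K (central l \<circ> h)"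
  have K0: "0 < K" unfolding K_def by (rule height_scale_pos)
  show ?thesis
  proof (cases "lat_height K h < top")
    case False
    then have top: "lat_height K h = top" using less_top by blast
    have "ennreal (2 powr (- (real 0 * p))) * lat_height K (central 0 \<circ> h) \<le> ?S" by (rule SUP_upper) simp
    moreover have "central 0 \<circ> h = h" by (simp add: fun_eq_iff central_0)
    ultimately have St: "?S = top" using top by (simp add: top_unique)
    have "ennreal (mult_const M) * top = top" using mult_const_pos[OF M] by (simp add: ennreal_mult_top)
    then show ?thesis unfolding St by simp
  next
    case True
    let ?g = "\<lambda>j. gstep M (grid_pt M j) :: real ^ ('d option + 'm) \<Rightarrow> _"
    have lip: "infnorm (?g j x) \<le> step_lip M * infnorm x" "infnorm x \<le> step_lip M * infnorm (?g j x)" if "j \<in> grid M" for j x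
      using gstep_lipschitz[OF M, of "grid_pt M j" x] grid_pt_abs_le[OF that] by (simp_all add: step_lip_def d_def)
    have "fact CARD('d option + 'm) * (2 * step_lip M powr (2 * (CARD('d option + 'm) * b))) < K"
      unfolding K_def height_scale_def N_def by simp
    note K_gt = this
    have "\<exists>R I e. R \<subseteq> {0<..<N} \<and> (\<forall>i\<in>R. card (I i) = i \<and> indep_tuple (I i) (e i)) \<and>
      (\<forall>j\<in>grid M. lat_height K (?g j \<circ> h) \<le> ennreal (step_lip M powr (N * b)) +
        (\<Sum>i\<in>R. ennreal (2 * fact N powr b * (K ^ (i * (N - i)) * wnorm (I i) (?g j \<circ> h \<circ> e i)) powr (- (1 / \<phi> i)))))"
      unfolding N_def
      by (rule dominating_tuples[OF h finite_grid unimodular_gstep[OF M] step_lip_ge[OF M] lip less_imp_le[OF b_pos] K_gt True])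
    then obtain R I e where R0: "R \<subseteq> {0<..<N}" "\<forall>i\<in>R. card (I i) = i \<and> indep_tuple (I i) (e i)"
      and le0: "\<forall>j\<in>grid M. lat_height K (?g j \<circ> h) \<le> ennreal (step_lip M powr (N * b)) +
        (\<Sum>i\<in>R. ennreal (2 * fact N powr b * (K ^ (i * (N - i)) * wnorm (I i) (?g j \<circ> h \<circ> e i)) powr (- (1 / \<phi> i))))"
      by (elim exE conjE)
    note R = R0(1) conjunct1[OF bspec[OF R0(2)]] conjunct2[OF bspec[OF R0(2)]]
    note le = bspec[OF le0]
    let ?c = "2 * fact N powr b"
    let ?x = "\<lambda>i j. (K ^ (i * (N - i)) * wnorm (I i) (?g j \<circ> h \<circ> e i)) powr (- (1 / \<phi> i))"
    let ?a = "avg_const * logf M * real M powr dim_exp"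
    have a0: "0 \<le> ?a" using avg_const_pos logf_pos[OF M] by simp
    have finR: "finite R" using R(1) by (rule finite_subset) simp
    have cardR: "card R \<le> N" using card_mono[OF _ R(1)] by simp
    have each: "(\<Sum>j\<in>grid M. ennreal (?x i j)) \<le> ennreal ?a * (ennreal (3 powr (real N * real N * b)) * ?S)" if i: "i \<in> R" for i
    proof -
      have "(\<Sum>j\<in>grid M. ennreal (?x i j)) \<le> ennreal ?a * (SUP l. ennreal (2 powr (- (real l * p))) *
          ennreal ((K ^ (i * (N - i)) * wnorm (I i) (central l \<circ> h \<circ> e i)) powr (- (1 / \<phi> i))))"
        using average_wnorm[OF h M K0 R(3)[OF i]] unfolding R(2)[OF i] .
      also have "\<dots> \<le> ennreal ?a * (SUP l. ennreal (3 powr (real N * real N * b)) * (ennreal (2 powr (- (real l * p))) * lat_height K (central l \<circ> h)))"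
      proof (intro mult_left_mono SUP_mono')
        fix l
        have "ennreal ((K ^ (i * (N - i)) * wnorm (I i) (central l \<circ> h \<circ> e i)) powr (- (1 / \<phi> i)))
          \<le> ennreal (3 powr (real N * real N * b)) * lat_height K (central l \<circ> h)"
          using wnorm_le_lat_height[OF unimodular_comp[OF unimodular_central h] K0 R(3)[OF i], of l]
          unfolding R(2)[OF i] N_def by (simp only: of_nat_mult)
        then have "ennreal (2 powr (- (real l * p))) * ennreal ((K ^ (i * (N - i)) * wnorm (I i) (central l \<circ> h \<circ> e i)) powr (- (1 / \<phi> i)))
          \<le> ennreal (2 powr (- (real l * p))) * (ennreal (3 powr (real N * real N * b)) * lat_height K (central l \<circ> h))"
          by (rule mult_left_mono) simp
        then show "ennreal (2 powr (- (real l * p))) * ennreal ((K ^ (i * (N - i)) * wnorm (I i) (central l \<circ> h \<circ> e i)) powr (- (1 / \<phi> i)))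
          \<le> ennreal (3 powr (real N * real N * b)) * (ennreal (2 powr (- (real l * p))) * lat_height K (central l \<circ> h))"
          by (simp only: mult_ac)
      qed simp
      also have "(SUP l. ennreal (3 powr (real N * real N * b)) * (ennreal (2 powr (- (real l * p))) * lat_height K (central l \<circ> h)))
        = ennreal (3 powr (real N * real N * b)) * ?S"
        by (simp only: SUP_mult_left_ennreal)
      finally show ?thesis .
    qed
    have "(\<Sum>j\<in>grid M. lat_height K (?g j \<circ> h))
      \<le> (\<Sum>j\<in>grid M. ennreal (step_lip M powr (N * b)) + (\<Sum>i\<in>R. ennreal ?c * ennreal (?x i j)))"
      using le by (intro sum_mono) (simp add: ennreal_mult)
    also have "\<dots> = (\<Sum>j\<in>(grid M :: ('d \<Rightarrow> nat) set). ennreal (step_lip M powr (N * b))) + (\<Sum>i\<in>R. ennreal ?c * (\<Sum>j\<in>grid M. ennreal (?x i j)))"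
      unfolding sum.distrib sum.swap[of _ R] sum_distrib_left ..
    also have "(\<Sum>j\<in>(grid M :: ('d \<Rightarrow> nat) set). ennreal (step_lip M powr (N * b))) = ennreal (add_const M)"
      by (simp add: add_const_def card_grid d_def ennreal_mult mult.commute ennreal_of_nat_eq_real_of_nat)
    also have "(\<Sum>i\<in>R. ennreal ?c * (\<Sum>j\<in>grid M. ennreal (?x i j)))
      \<le> (\<Sum>i\<in>R. ennreal ?c * (ennreal ?a * (ennreal (3 powr (real N * real N * b)) * ?S)))"
      by (intro sum_mono mult_left_mono each) auto
    also have "\<dots> = of_nat (card R) * (ennreal ?c * (ennreal ?a * (ennreal (3 powr (real N * real N * b)) * ?S)))" by simp
    also have "\<dots> \<le> of_nat N * (ennreal ?c * (ennreal ?a * (ennreal (3 powr (real N * real N * b)) * ?S)))"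
      using cardR by (intro mult_right_mono) auto
    also have "\<dots> = ennreal (real N) * (ennreal ?c * (ennreal ?a * (ennreal (3 powr (real N * real N * b)) * ?S)))"
      by (simp add: ennreal_of_nat_eq_real_of_nat)
    also have "\<dots> = ennreal (mult_const M) * ?S"
    proof -
      have "ennreal (mult_const M) = ennreal (real N) * (ennreal ?c * (ennreal (3 powr (real N * real N * b)) * ennreal ?a))"
        unfolding mult_const_def using a0 by (simp only: ennreal_mult[symmetric] mult_nonneg_nonneg powr_ge_zero of_nat_0_le_iff mult.assoc zero_le_numeral)
      then show ?thesis by (simp only: mult_ac)
    qed
    finally show ?thesis by (simp add: add_left_mono del: o_apply)
  qed
qed

definition total_height :: "real \<Rightarrow> real \<Rightarrow> (real ^ ('d option + 'm) \<Rightarrow> real ^ ('d option + 'm)) \<Rightarrow> ennreal" where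
  "total_height K q h = (\<Sum>l. ennreal (2 powr (- (real l * q))) * lat_height K (central l \<circ> h))"

text \<open>Bounding the supremum by a sum turns the one-step inequality into a convolution along
  the group. A term at distance \<open>x\<close> keeps the factor 2^(-x (p - q)), whose series
  converges, so the summed height bounds its own average.\<close>

lemma total_height_average:
  assumes h: "unimodular h" and M: "1 \<le> M" and q: "0 < q" "q < p"
  defines "K \<equiv> height_scale M"
  shows "(\<Sum>j\<in>grid M. total_height K q (gstep M (grid_pt M j) \<circ> h))
    \<le> ennreal (add_const M * geom q) + ennreal (mult_const M * geom (p - q)) * total_height K q h"
proof -
  define a where "a l = ennreal (2 powr (- (real l * q)))" for l
  define F where "F l = lat_height K (central l \<circ> h)" for l
  have "central l \<circ> (gstep M s \<circ> h) = gstep M s \<circ> (central l \<circ> h)" for l s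
    by (simp add: fun_eq_iff central_gstep)
  then have "(\<Sum>j\<in>grid M. total_height K q (gstep M (grid_pt M j) \<circ> h))
    = (\<Sum>j\<in>grid M. \<Sum>l. a l * lat_height K (gstep M (grid_pt M j) \<circ> (central l \<circ> h)))"
    by (simp add: total_height_def a_def)
  also have "\<dots> = (\<Sum>l. \<Sum>j\<in>grid M. a l * lat_height K (gstep M (grid_pt M j) \<circ> (central l \<circ> h)))"
    by (rule suminf_sum[symmetric]) simp
  also have "\<dots> = (\<Sum>l. a l * (\<Sum>j\<in>grid M. lat_height K (gstep M (grid_pt M j) \<circ> (central l \<circ> h))))"
    by (simp only: sum_distrib_left)
  also have "\<dots> \<le> (\<Sum>l. a l * ennreal (add_const M) + ennreal (mult_const M) * (\<Sum>x. a l * (ennreal (2 powr (- (real x * p))) * F (l + x))))"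
  proof (rule suminf_le)
    fix l
    have u: "unimodular (central l \<circ> h)" by (rule unimodular_comp[OF unimodular_central h])
    have "central x \<circ> (central l \<circ> h) = central (l + x) \<circ> h" for x
      by (simp add: fun_eq_iff central_add add.commute)
    then have "(\<Sum>j\<in>grid M. lat_height K (gstep M (grid_pt M j) \<circ> (central l \<circ> h)))
      \<le> ennreal (add_const M) + ennreal (mult_const M) * (SUP x. ennreal (2 powr (- (real x * p))) * F (l + x))"
      using lat_height_average[OF u M] by (simp add: K_def F_def)
    also have "\<dots> \<le> ennreal (add_const M) + ennreal (mult_const M) * (\<Sum>x. ennreal (2 powr (- (real x * p))) * F (l + x))"
      by (intro add_left_mono mult_left_mono ennreal_SUP_le_suminf) simp
    finally have "a l * (\<Sum>j\<in>grid M. lat_height K (gstep M (grid_pt M j) \<circ> (central l \<circ> h)))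
      \<le> a l * (ennreal (add_const M) + ennreal (mult_const M) * (\<Sum>x. ennreal (2 powr (- (real x * p))) * F (l + x)))"
      by (rule mult_left_mono) simp
    also have "\<dots> = a l * ennreal (add_const M) + ennreal (mult_const M) * (\<Sum>x. a l * (ennreal (2 powr (- (real x * p))) * F (l + x)))"
      by (simp only: distrib_left ennreal_suminf_cmult mult.left_commute)
    finally show "a l * (\<Sum>j\<in>grid M. lat_height K (gstep M (grid_pt M j) \<circ> (central l \<circ> h)))
      \<le> a l * ennreal (add_const M) + ennreal (mult_const M) * (\<Sum>x. a l * (ennreal (2 powr (- (real x * p))) * F (l + x)))" .
  qed auto
  also have "\<dots> = (\<Sum>l. a l) * ennreal (add_const M) + ennreal (mult_const M) * (\<Sum>l. \<Sum>x. a l * (ennreal (2 powr (- (real x * p))) * F (l + x)))"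
    by (simp only: suminf_add[OF summableI summableI, symmetric] ennreal_suminf_cmult ennreal_suminf_multc)
  also have "(\<Sum>l. \<Sum>x. a l * (ennreal (2 powr (- (real x * p))) * F (l + x))) = (\<Sum>x. \<Sum>l. a l * (ennreal (2 powr (- (real x * p))) * F (l + x)))"
    by (rule ennreal_suminf_swap)
  also have "\<dots> = (\<Sum>x. ennreal (2 powr (- (real x * (p - q)))) * (\<Sum>l. a (l + x) * F (l + x)))"
  proof -
    \<comment> \<open>Part of the discount \<open>p\<close> moves the weight from time
      \<open>l\<close> to time \<open>l + x\<close>; the remainder \<open>p - q\<close> is summable
      in \<open>x\<close>.\<close>
    have "a l * ennreal (2 powr (- (real x * p))) = ennreal (2 powr (- (real x * (p - q)))) * a (l + x)" for l x
      unfolding a_def by (simp add: ennreal_mult[symmetric] powr_add[symmetric] algebra_simps)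
    then have "a l * (ennreal (2 powr (- (real x * p))) * F (l + x)) = ennreal (2 powr (- (real x * (p - q)))) * (a (l + x) * F (l + x))" for l x
      by (simp only: mult.assoc[symmetric])
    then show ?thesis by (simp only: ennreal_suminf_cmult)
  qed
  also have "\<dots> \<le> (\<Sum>x. ennreal (2 powr (- (real x * (p - q)))) * total_height K q h)"
  proof (rule suminf_le)
    fix x
    have "(\<Sum>l. a (l + x) * F (l + x)) \<le> (\<Sum>l. a l * F l)"
      by (rule ennreal_suminf_shift_le[of "\<lambda>l. a l * F l"])
    then show "ennreal (2 powr (- (real x * (p - q)))) * (\<Sum>l. a (l + x) * F (l + x)) \<le> ennreal (2 powr (- (real x * (p - q)))) * total_height K q h"
      unfolding total_height_def a_def F_def by (rule mult_left_mono) simp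
  qed auto
  also have "\<dots> = ennreal (geom (p - q)) * total_height K q h"
    using suminf_geom[of "p - q"] q by (simp only: ennreal_suminf_multc diff_gt_0_iff_gt)
  also have "(\<Sum>l. a l) = ennreal (geom q)" unfolding a_def by (rule suminf_geom[OF q(1)])
  also have "ennreal (geom q) * ennreal (add_const M) + ennreal (mult_const M) * (ennreal (geom (p - q)) * total_height K q h)
    = ennreal (add_const M * geom q) + ennreal (mult_const M * geom (p - q)) * total_height K q h"
    using geom_pos[of q] geom_pos[of "p - q"] q mult_const_pos[OF M]
    by (simp add: ennreal_mult add_const_def mult_ac)
  finally show ?thesis by (simp add: add_left_mono mult_left_mono del: o_apply)
qed

end

subsection \<open>The renormalisation flow and the tree of cubes\<close>

text \<open>The shear comes first and the iterated step is without shear; hence changing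
  \<open>s\<close> by \<open>t / M ^ k\<close> is a shear by \<open>t\<close> after time
  \<open>k\<close>, as \<open>flow_add\<close> shows.\<close>

definition flow :: "nat \<Rightarrow> nat \<Rightarrow> real ^ 'd \<Rightarrow> real ^ ('d::finite option + 'm::finite) \<Rightarrow> real ^ ('d option + 'm)" where
  "flow M k s v = (gstep M 0 ^^ k) (shear s v)"

text \<open>The lower corner of the half-open cube of side \<open>1 / M ^ k\<close> containing
  \<open>s\<close>. Corners serve as the vertices of the tree of cubes.\<close>

definition corner :: "nat \<Rightarrow> nat \<Rightarrow> real ^ 'd \<Rightarrow> real ^ 'd::finite" where
  "corner M k s = (\<chi> a. of_int \<lfloor>real M ^ k * s $ a\<rfloor> / real M ^ k)"

lemma unimodular_shear: "unimodular (shear s :: real ^ ('d::finite option + 'm::finite) \<Rightarrow> _)"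
  by (simp add: unimodular_def linear_shear rowdet_shear)

lemma unimodular_flow:
  assumes "1 \<le> M"
  shows "unimodular (flow M k s :: real ^ ('d::finite option + 'm::finite) \<Rightarrow> _)"
proof (induction k)
  case 0
  have "flow M 0 s = (shear s :: real ^ ('d option + 'm) \<Rightarrow> _)" by (simp add: flow_def fun_eq_iff)
  then show ?case by (simp only: unimodular_shear)
next
  case (Suc k)
  have "flow M (Suc k) s = gstep M 0 \<circ> (flow M k s :: real ^ ('d option + 'm) \<Rightarrow> _)" by (simp add: flow_def fun_eq_iff)
  then show ?case using unimodular_comp[OF unimodular_gstep[OF assms] Suc] by (simp only:)
qed

lemma topdil_shear: "topdil Y (shear s v) = shear (Y *\<^sub>R s) (topdil Y v)"
proof -
  have "topdil Y (shear s v) $ r = shear (Y *\<^sub>R s) (topdil Y v) $ r" for r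
    by (cases "r = top_row") (simp_all add: topdil_def diag_map_def shear_def axis_def algebra_simps sum_distrib_left)
  then show ?thesis by (simp add: vec_eq_iff)
qed

lemma shear_gstep_0: "1 \<le> M \<Longrightarrow> shear s (gstep M 0 v) = gstep M 0 (shear ((1 / real M) *\<^sub>R s) v)"
  by (simp add: gstep_def linear_scale[OF linear_shear] shear_0 topdil_shear)

lemma flow_add:
  assumes "1 \<le> M"
  shows "flow M k (s + (1 / real M ^ k) *\<^sub>R t) v = shear t (flow M k s v)"
proof (induction k arbitrary: t)
  case 0
  show ?case by (simp add: flow_def shear_add add.commute)
next
  case (Suc k)
  have "(1 / real M ^ Suc k) *\<^sub>R t = (1 / real M ^ k) *\<^sub>R ((1 / real M) *\<^sub>R t)" by (simp add: mult.commute)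
  then have "flow M (Suc k) (s + (1 / real M ^ Suc k) *\<^sub>R t) v = gstep M 0 (shear ((1 / real M) *\<^sub>R t) (flow M k s v))"
    using Suc[of "(1 / real M) *\<^sub>R t"] by (simp only: flow_def funpow.simps o_apply)
  also have "\<dots> = shear t (flow M (Suc k) s v)" using assms by (simp add: shear_gstep_0 flow_def)
  finally show ?case .
qed

lemma gstep_flow:
  assumes "1 \<le> M"
  shows "gstep M t (flow M k s v) = flow M (Suc k) (s + (1 / real M ^ k) *\<^sub>R t) v"
proof -
  have "gstep M t w = gstep M 0 (shear t w)" for w :: "real ^ ('a option + 'b)"
    by (simp add: gstep_def shear_0)
  then have "gstep M t (flow M k s v) = gstep M 0 (flow M k (s + (1 / real M ^ k) *\<^sub>R t) v)"
    using assms by (simp add: flow_add)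
  then show ?thesis by (simp add: flow_def)
qed

lemma flow_nth:
  fixes v :: "real ^ ('d::finite option + 'm::finite)"
  assumes "1 \<le> M"
  shows "flow M k s v $ r = (real M powr (- (1 / real CARD('d option + 'm)))) ^ k *
    (if r = top_row then real M ^ k * shear s v $ r else v $ r)"
proof (induction k)
  case 0
  show ?case by (simp add: flow_def shear_other)
next
  case (Suc k)
  have "flow M (Suc k) s v = gstep M 0 (flow M k s v)" by (simp add: flow_def)
  then show ?case using Suc
    by (simp add: gstep_def shear_0 topdil_def diag_map_def mult_ac del: card_sum)
qed

text \<open>The child is given by the next base-M digits,
  \<open>\<lfloor>M * x\<rfloor> - M * \<lfloor>x\<rfloor>\<close> in each coordinate, which lie
  between 0 and \<open>M - 1\<close>.\<close>

lemma corner_Suc: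
  fixes s :: "real ^ 'd::finite"
  assumes M: "1 \<le> M"
  obtains j where "j \<in> grid M" "corner M (Suc k) s = corner M k s + (1 / real M ^ k) *\<^sub>R grid_pt M j"
proof -
  define x where "x a = real M ^ k * s $ a" for a
  define z where "z a = \<lfloor>real M * x a\<rfloor> - int M * \<lfloor>x a\<rfloor>" for a
  have z: "0 \<le> z a" "z a < int M" for a
  proof -
    have "real M * of_int \<lfloor>x a\<rfloor> \<le> real M * x a" by (intro mult_left_mono) auto
    then have "int M * \<lfloor>x a\<rfloor> \<le> \<lfloor>real M * x a\<rfloor>" by (simp add: le_floor_iff)
    then show "0 \<le> z a" by (simp add: z_def)
    have "real M * x a < real M * (of_int \<lfloor>x a\<rfloor> + 1)" using M by (intro mult_strict_left_mono) linarith+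
    then have "\<lfloor>real M * x a\<rfloor> < int M * (\<lfloor>x a\<rfloor> + 1)" by (simp add: floor_less_iff)
    then show "z a < int M" by (simp add: z_def algebra_simps)
  qed
  show thesis
  proof
    show "(\<lambda>a. nat (z a)) \<in> grid M" using z by (simp add: grid_iff nat_less_iff)
    show "corner M (Suc k) s = corner M k s + (1 / real M ^ k) *\<^sub>R grid_pt M (\<lambda>a. nat (z a))"
      unfolding vec_eq_iff
    proof
      fix a
      have e: "real M ^ Suc k * s $ a = real M * x a" "real M ^ k * s $ a = x a" by (simp_all add: x_def)
      have "real (nat (z a)) = of_int \<lfloor>real M * x a\<rfloor> - real M * of_int \<lfloor>x a\<rfloor>"
        using z(1)[of a] by (simp add: z_def)
      then show "corner M (Suc k) s $ a = (corner M k s + (1 / real M ^ k) *\<^sub>R grid_pt M (\<lambda>a. nat (z a))) $ a"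
        using M unfolding corner_def grid_pt_def vec_lambda_beta vector_add_component vector_scaleR_component e
        by (simp add: field_simps)
    qed
  qed
qed

lemma corner_dist:
  assumes "1 \<le> M"
  shows "\<bar>s $ a - corner M k s $ a\<bar> \<le> 1 / real M ^ k"
proof -
  have pos: "0 < real M ^ k" using assms by simp
  have "\<bar>real M ^ k * s $ a - of_int \<lfloor>real M ^ k * s $ a\<rfloor>\<bar> \<le> 1" by linarith
  then have "\<bar>real M ^ k * s $ a - of_int \<lfloor>real M ^ k * s $ a\<rfloor>\<bar> / real M ^ k \<le> 1 / real M ^ k"
    using pos by (intro divide_right_mono) auto
  also have "\<bar>real M ^ k * s $ a - of_int \<lfloor>real M ^ k * s $ a\<rfloor>\<bar> / real M ^ k = \<bar>s $ a - corner M k s $ a\<bar>"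
  proof -
    have "s $ a - corner M k s $ a = (real M ^ k * s $ a - of_int \<lfloor>real M ^ k * s $ a\<rfloor>) / real M ^ k"
      using pos by (simp add: corner_def diff_divide_distrib)
    then show ?thesis using pos by (simp add: abs_divide)
  qed
  finally show ?thesis .
qed

lemma finite_corner_0:
  fixes S :: "(real ^ 'd::finite) set"
  assumes "bounded S"
  shows "finite (corner M 0 ` S)"
proof -
  obtain B where B: "\<And>s. s \<in> S \<Longrightarrow> norm s \<le> B" using assms bounded_iff by blast
  have "corner M 0 ` S \<subseteq> (\<lambda>f. \<chi> a. of_int (f a)) ` (UNIV \<rightarrow>\<^sub>E {-\<lceil>B\<rceil>-1..\<lceil>B\<rceil>})"
  proof
    fix t assume "t \<in> corner M 0 ` S"
    then obtain s where s: "s \<in> S" "t = corner M 0 s" by blast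
    have "\<lfloor>s $ a\<rfloor> \<in> {-\<lceil>B\<rceil>-1..\<lceil>B\<rceil>}" for a
      using order_trans[OF component_le_norm_cart[of s a] B[OF s(1)]] by auto linarith+
    then show "t \<in> (\<lambda>f. \<chi> a. of_int (f a)) ` (UNIV \<rightarrow>\<^sub>E {-\<lceil>B\<rceil>-1..\<lceil>B\<rceil>})"
      by (intro image_eqI[of _ _ "\<lambda>a. \<lfloor>s $ a\<rfloor>"]) (auto simp: s(2) corner_def vec_eq_iff)
  qed
  then show ?thesis by (rule finite_subset) (intro finite_imageI finite_PiE, auto)
qed

context slice
begin

text \<open>Shears commute with \<open>central\<close>, so one Lipschitz constant serves all
  \<open>l\<close>. This starts the iteration at the corners of level 0.\<close>

lemma total_height_shear_finite:
  assumes K: "0 < K" and fin: "total_height K q id < top"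
  shows "total_height K q (shear t) < top"
proof -
  define B where "B = nat \<lceil>infnorm t\<rceil>"
  define \<Lambda> where "\<Lambda> = 1 + real CARD('d) * B"
  have \<Lambda>: "1 \<le> \<Lambda>" by (simp add: \<Lambda>_def)
  let ?c = "ennreal (\<Lambda> powr (CARD('d option + 'm) * b))"
  have step: "lat_height K (central l \<circ> shear t) \<le> ?c * lat_height K (central l \<circ> id)" for l
  proof (rule lat_height_lipschitz[OF _ _ \<Lambda> _ K])
    show "unimodular (central l \<circ> id :: real ^ ('d option + 'm) \<Rightarrow> _)" by (simp add: unimodular_central)
    show "unimodular (central l \<circ> shear t :: real ^ ('d option + 'm) \<Rightarrow> _)" 
      by (rule unimodular_comp[OF unimodular_central unimodular_shear])
    fix x :: "real ^ ('d option + 'm)"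
    have "infnorm (central l x) = infnorm (shear (- t) (central l (shear t x)))"
      by (simp add: central_shear shear_add shear_0)
    also have "\<dots> \<le> (1 + real CARD('d) * B) * infnorm (central l (shear t x))"
    proof -
      have "\<bar>(- t) $ a\<bar> \<le> real B" for a
        using order_trans[OF component_le_infnorm_cart[of t a] real_nat_ceiling_ge] by (simp add: B_def)
      then show ?thesis using infnorm_shear_le[where s = "- t" and B = B and v = "central l (shear t x)"] by simp
    qed
    finally show "infnorm ((central l \<circ> id) x) \<le> \<Lambda> * infnorm ((central l \<circ> shear t) x)"
      by (simp add: \<Lambda>_def)
  qed
  have "total_height K q (shear t) \<le> (\<Sum>l. ?c * (ennreal (2 powr (- (real l * q))) * lat_height K (central l \<circ> id)))"
    unfolding total_height_def
  proof (rule suminf_le)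
    fix l
    have "ennreal (2 powr (- (real l * q))) * lat_height K (central l \<circ> shear t)
      \<le> ennreal (2 powr (- (real l * q))) * (?c * lat_height K (central l \<circ> id))"
      by (rule mult_left_mono[OF step]) simp
    then show "ennreal (2 powr (- (real l * q))) * lat_height K (central l \<circ> shear t)
      \<le> ?c * (ennreal (2 powr (- (real l * q))) * lat_height K (central l \<circ> id))"
      by (simp only: mult.left_commute)
  qed auto
  also have "\<dots> = ?c * total_height K q id" by (simp only: total_height_def ennreal_suminf_cmult)
  also have "\<dots> < top" unfolding ennreal_mult_less_top using fin by simp
  finally show ?thesis .
qed

text \<open>A single nonzero lattice vector is a tuple of rank 1, and the term \<open>l = 0\<close>
  of the sum records it.\<close>

lemma short_vector_height:
  assumes v: "v \<in> L" "v \<noteq> 0" and h: "unimodular h" and K: "0 < K"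
    and le: "K ^ (N - 1) * infnorm (h v) \<le> x"
  shows "ennreal (x powr (- (1 / \<phi> 1))) \<le> total_height K q h"
proof -
  obtain r where r: "v $ r \<noteq> 0" using v(2) by (auto simp: vec_eq_iff)
  have "v = (\<Sum>k\<in>UNIV. rowdet (upd (\<lambda>k. axis k 1) k v) *\<^sub>R axis k 1)"
    using rowdet_expand[of "\<lambda>k. axis k 1" v] by (simp add: rowdet_axis)
  then have "v $ r = (\<Sum>k\<in>UNIV. rowdet (upd (\<lambda>k. axis k 1) k v) *\<^sub>R axis k 1) $ r" by simp
  also have "\<dots> = (\<Sum>k\<in>UNIV. if k = r then rowdet (upd (\<lambda>k. axis k 1) k v) else 0)"
    unfolding sum_component by (intro sum.cong) (auto simp: axis_def)
  also have "\<dots> = rowdet (upd (\<lambda>k. axis k 1) r v)" by simp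
  also have "upd (\<lambda>k. axis k 1) r v = padded {r} (\<lambda>_. v) id" by (intro ext) (auto simp: padded_def upd_apply)
  finally have "minor {r} (\<lambda>_. v) id \<noteq> 0" using r by (simp add: minor_def)
  then have w: "0 < wnorm {r} (\<lambda>_. v)" unfolding wnorm_pos_iff by blast
  have "{r} \<noteq> UNIV"
  proof
    assume "{r} = UNIV"
    then have "N = 1" unfolding N_def by (metis card_1_singleton_iff One_nat_def)
    then show False using N_gt(1) by simp
  qed
  then have t: "indep_tuple {r} (\<lambda>_. v)" using v w by (simp add: indep_tuple_def)
  have "0 < (\<Prod>k\<in>{r}. infnorm ((h \<circ> (\<lambda>_. v)) k))"
    by (rule prod_infnorm_pos[OF wnorm_unimodular_pos[OF h w]])
  then have "0 < K ^ (N - 1) * infnorm (h v)" using K by simp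
  then have "x powr (- (1 / \<phi> 1)) \<le> (K ^ (N - 1) * infnorm (h v)) powr (- (1 / \<phi> 1))"
    using le \<phi>_bounds(1)[of 1] N_gt(1) by (intro powr_mono2') auto
  also have "\<dots> = tuple_height K {r} (h \<circ> (\<lambda>_. v))" by (simp add: tuple_height_def N_def del: card_sum)
  finally have "ennreal (x powr (- (1 / \<phi> 1))) \<le> lat_height K h"
    using order_trans[OF ennreal_leI tuple_height_le[OF t]] by blast
  also have "lat_height K h = (\<Sum>l\<in>{0}. ennreal (2 powr (- (real l * q))) * lat_height K (central l \<circ> h))"
  proof -
    have "central 0 \<circ> h = h" by (simp add: fun_eq_iff central_0)
    then show ?thesis by simp
  qed
  also have "\<dots> \<le> total_height K q h" unfolding total_height_def by (rule sum_le_suminf) auto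
  finally show ?thesis .
qed

text \<open>A lattice vector of length at most \<open>\<epsilon>\<close> at time \<open>k\<close>
  forces the height at the corner of its cube to be at least \<open>B\<close>, where the additive
  constant is at most \<open>mult\<close> times the height. From time \<open>k0\<close> on, the sum
  of the heights over the corners grows by at most \<open>2 * mult\<close> in each step, and every
  corner contributes at least 1. As \<open>\<epsilon>\<close> does not depend on \<open>S\<close>
  and \<open>k0\<close>, it serves all pieces of a countable decomposition.\<close>

lemma cover_count:
  assumes M: "1 \<le> M" and q: "0 < q" "q < p"
    and fin: "total_height (height_scale M) q id < top"
  obtains \<epsilon> where "0 < \<epsilon>"
    "\<forall>S k0. bounded S \<longrightarrow> (\<forall>s\<in>S. \<forall>k\<ge>k0. \<exists>v\<in>L. v \<noteq> 0 \<and> infnorm (flow M k s v) \<le> \<epsilon>) \<longrightarrow>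
      (\<exists>C. \<forall>k\<ge>k0. finite (corner M k ` S) \<and> real (card (corner M k ` S)) \<le> C * (2 * (mult_const M * geom (p - q))) ^ (k - k0))"
proof -
  let ?K = "height_scale M"
  define add where "add = add_const M * geom q"
  define mult where "mult = mult_const M * geom (p - q)"
  have mult: "0 < mult" unfolding mult_def using mult_const_pos[OF M] geom_pos q by simp
  define B where "B = max 1 (add / mult)"
  have B: "1 \<le> B" "add \<le> mult * B" using mult by (auto simp: B_def max_def field_simps)
  have K: "0 < ?K" by (rule height_scale_pos)
  have \<phi>1: "0 < \<phi> 1" using \<phi>_bounds(1)[of 1] N_gt(1) by simp
  \<comment> \<open>The factor \<open>1 + real d\<close> pays for moving from \<open>s\<close> to
    its corner, which at time \<open>k\<close> is a shear with entries at most 1.\<close>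
  define \<epsilon> where "\<epsilon> = B powr (- \<phi> 1) / (?K ^ (N - 1) * (1 + real d))"
  have \<epsilon>: "0 < \<epsilon>" using K B by (simp add: \<epsilon>_def)
  define T where "T k t = total_height ?K q (flow M k t)" for k t
  have avg: "(\<Sum>j\<in>grid M. T (Suc k) (t + (1 / real M ^ k) *\<^sub>R grid_pt M j)) \<le> ennreal add + ennreal mult * T k t" for k t
  proof -
    have "flow M (Suc k) (t + (1 / real M ^ k) *\<^sub>R grid_pt M j) = (gstep M (grid_pt M j) \<circ> flow M k t :: real ^ ('d option + 'm) \<Rightarrow> _)" for j
      using M by (simp add: fun_eq_iff gstep_flow)
    then show ?thesis
      using total_height_average[OF unimodular_flow[OF M] M q] by (simp only: T_def add_def mult_def)
  qed
  show thesis
  proof (rule that[OF \<epsilon>], intro allI impI)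
    fix S :: "(real ^ 'd) set" and k0
    assume S: "bounded S" and short0: "\<forall>s\<in>S. \<forall>k\<ge>k0. \<exists>v\<in>L. v \<noteq> 0 \<and> infnorm (flow M k s v) \<le> \<epsilon>"
    note short = short0[rule_format]
    define X where "X k = corner M k ` S" for k
    define Y where "Y k = (\<lambda>(t, j). t + (1 / real M ^ k) *\<^sub>R grid_pt M j) ` (X k \<times> grid M)" for k
    have XY: "X (Suc k) \<subseteq> Y k" for k
    proof
      fix t assume "t \<in> X (Suc k)"
      then obtain s where s: "s \<in> S" "t = corner M (Suc k) s" by (auto simp: X_def)
      obtain j where "j \<in> grid M" "corner M (Suc k) s = corner M k s + (1 / real M ^ k) *\<^sub>R grid_pt M j"
        by (rule corner_Suc[OF M])
      then show "t \<in> Y k" using s by (force simp: Y_def X_def)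
    qed
    have finX: "finite (X k)" for k
    proof (induction k)
      case 0 then show ?case unfolding X_def by (rule finite_corner_0[OF S])
    next
      case (Suc k)
      then have "finite (Y k)" unfolding Y_def by (intro finite_imageI finite_cartesian_product finite_grid)
      then show ?case using XY by (rule finite_subset[rotated])
    qed
    define Z where "Z k = (\<Sum>t\<in>X k. T k t)" for k
    have ZS: "Z (Suc k) \<le> (\<Sum>t\<in>X k. ennreal add + ennreal mult * T k t)" for k
    proof -
      have "Z (Suc k) \<le> (\<Sum>t\<in>Y k. T (Suc k) t)"
        unfolding Z_def using finX finite_grid[of M] by (intro sum_mono2 XY) (auto simp: Y_def)
      also have "\<dots> \<le> (\<Sum>x\<in>X k \<times> grid M. T (Suc k) (case x of (t, j) \<Rightarrow> t + (1 / real M ^ k) *\<^sub>R grid_pt M j))"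
        unfolding Y_def
      proof (rule order_trans[OF sum_image_le])
        show "finite (X k \<times> grid M)" using finX finite_grid by (rule finite_cartesian_product)
      qed (simp_all only: zero_le o_def order_refl)
      also have "\<dots> = (\<Sum>t\<in>X k. \<Sum>j\<in>grid M. T (Suc k) (t + (1 / real M ^ k) *\<^sub>R grid_pt M j))"
        by (simp add: sum.cartesian_product split_def)
      also have "\<dots> \<le> (\<Sum>t\<in>X k. ennreal add + ennreal mult * T k t)"
        by (intro sum_mono avg)
      finally show ?thesis .
    qed
    \<comment> \<open>The constant in the final count is \<open>Z k0\<close>, so its finiteness has
      to be carried along.\<close>
    have finZ: "Z k < top" for k
    proof (induction k)
      case 0
      have "flow M 0 t = (shear t :: real ^ ('d option + 'm) \<Rightarrow> _)" for t by (simp add: flow_def fun_eq_iff)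
      then have "T 0 t < top" for t using total_height_shear_finite[OF K fin] by (simp add: T_def)
      then show ?case using finX by (simp add: Z_def less_top[symmetric])
    next
      case (Suc k)
      have "T k t < top" if "t \<in> X k" for t
        using Suc that finX by (auto simp: Z_def less_top[symmetric])
      then have "(\<Sum>t\<in>X k. ennreal add + ennreal mult * T k t) < top"
        using finX by (auto simp: less_top[symmetric] ennreal_mult_eq_top_iff)
      then show ?case using ZS[of k] by (rule le_less_trans[rotated])
    qed
    have low: "ennreal B \<le> T k t" if t: "t \<in> X k" and k: "k0 \<le> k" for k t
    proof -
      obtain s where s: "s \<in> S" "t = corner M k s" using t by (auto simp: X_def)
      obtain v where v: "v \<in> L" "v \<noteq> 0" "infnorm (flow M k s v) \<le> \<epsilon>" using short[OF s(1) k] by blast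
      define u where "u = real M ^ k *\<^sub>R (t - s)"
      have M0: "0 < real M ^ k" using M by simp
      have "flow M k t v = shear u (flow M k s v)"
      proof -
        have "(1 / real M ^ k) *\<^sub>R u = t - s" unfolding u_def scaleR_scaleR using M by simp
        then show ?thesis using flow_add[OF M, of k s u v] by simp
      qed
      moreover have "\<bar>u $ a\<bar> \<le> 1" for a
      proof -
        have "\<bar>u $ a\<bar> = real M ^ k * \<bar>s $ a - corner M k s $ a\<bar>"
          by (simp add: u_def s(2) abs_mult abs_minus_commute)
        also have "\<dots> \<le> real M ^ k * (1 / real M ^ k)"
          using M0 by (intro mult_left_mono corner_dist[OF M]) simp
        finally show ?thesis using M by simp
      qed
      ultimately have "infnorm (flow M k t v) \<le> (1 + real CARD('d) * 1) * infnorm (flow M k s v)"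
        using infnorm_shear_le[where s = u and B = 1 and v = "flow M k s v"] by simp
      also have "\<dots> \<le> (1 + real d) * \<epsilon>" using v(3) by (simp add: d_def)
      finally have "?K ^ (N - 1) * infnorm (flow M k t v) \<le> ?K ^ (N - 1) * ((1 + real d) * \<epsilon>)"
        using K by (intro mult_left_mono) auto
      also have "\<dots> = B powr (- \<phi> 1)" using K by (simp add: \<epsilon>_def field_simps add_nonneg_eq_0_iff)
      finally have "ennreal ((B powr (- \<phi> 1)) powr (- (1 / \<phi> 1))) \<le> T k t"
        unfolding T_def using v by (intro short_vector_height unimodular_flow M K)
      then show ?thesis using \<phi>1 B by (simp add: powr_powr)
    qed
    have ZS2: "Z (Suc k) \<le> ennreal (2 * mult) * Z k" if "k0 \<le> k" for k
    proof -
      have "ennreal add + ennreal mult * T k t \<le> ennreal (2 * mult) * T k t" if "t \<in> X k" for t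
      proof -
        have "ennreal add \<le> ennreal (mult * B)" using B(2) by (rule ennreal_leI)
        also have "\<dots> = ennreal mult * ennreal B" using mult B by (simp add: ennreal_mult)
        also have "\<dots> \<le> ennreal mult * T k t" by (intro mult_left_mono low that \<open>k0 \<le> k\<close>) simp
        finally have "ennreal add + ennreal mult * T k t \<le> ennreal mult * T k t + ennreal mult * T k t"
          by (rule add_right_mono)
        also have "\<dots> = ennreal (2 * mult) * T k t"
          using mult by (simp only: distrib_right[symmetric] ennreal_plus[symmetric] less_imp_le mult_2)
        finally show ?thesis .
      qed
      then show ?thesis using order_trans[OF ZS sum_mono, of k] by (simp only: Z_def sum_distrib_left)
    qed
    have Zk: "Z (k0 + k) \<le> ennreal ((2 * mult) ^ k) * Z k0" for k
    proof (induction k)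
      case (Suc k)
      have "Z (k0 + Suc k) \<le> ennreal (2 * mult) * Z (k0 + k)" using ZS2[of "k0 + k"] by simp
      also have "\<dots> \<le> ennreal (2 * mult) * (ennreal ((2 * mult) ^ k) * Z k0)"
        by (intro mult_left_mono Suc) simp
      also have "\<dots> = ennreal ((2 * mult) ^ Suc k) * Z k0"
        using mult by (simp add: ennreal_mult mult.assoc)
      finally show ?case .
    qed simp
    have "real (card (X k)) \<le> enn2real (Z k0) * (2 * mult) ^ (k - k0)" if k: "k0 \<le> k" for k
    proof -
      have "of_nat (card (X k)) = (\<Sum>t\<in>X k. (1 :: ennreal))" by simp
      also have "\<dots> \<le> Z k"
        unfolding Z_def
      proof (rule sum_mono)
        fix t assume t: "t \<in> X k"
        have "1 \<le> ennreal B" using B(1) by simp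
        then show "1 \<le> T k t" using low[OF t k] by (rule order_trans)
      qed
      also have "\<dots> \<le> ennreal ((2 * mult) ^ (k - k0)) * Z k0" using Zk[of "k - k0"] k by simp
      also have "\<dots> = ennreal ((2 * mult) ^ (k - k0) * enn2real (Z k0))"
        using mult finZ[of k0] by (simp add: ennreal_mult)
      finally have "ennreal (real (card (X k))) \<le> ennreal ((2 * mult) ^ (k - k0) * enn2real (Z k0))"
        by (simp only: ennreal_of_nat_eq_real_of_nat)
      then show ?thesis using mult by (subst (asm) ennreal_le_iff) (auto simp: mult.commute)
    qed
    then show "\<exists>C. \<forall>k\<ge>k0. finite (corner M k ` S) \<and> real (card (corner M k ` S)) \<le> C * (2 * (mult_const M * geom (p - q))) ^ (k - k0)"
      using finX unfolding X_def mult_def by blast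
  qed
qed

end

subsection \<open>Hausdorff measure zero from covers\<close>

text \<open>Null sets are handled through covers of arbitrarily small total at every scale, which
  removes the supremum and the infimum of the definitions.\<close>

lemma hausdorff_measure_eq_0_iff:
  "hausdorff_measure s E = 0 \<longleftrightarrow> (\<forall>\<delta>>0. \<forall>e>0. \<exists>U :: nat \<Rightarrow> 'a::metric_space set.
    (\<forall>i. bounded (U i) \<and> diameter (U i) \<le> \<delta>) \<and> E \<subseteq> (\<Union>i. U i) \<and> (\<Sum>i. ennreal (diam_powr s (U i))) < ennreal e)"
proof -
  have "hausdorff_measure s E = 0 \<longleftrightarrow> (\<forall>\<delta>>0. hausdorff_premeasure s \<delta> E = 0)"
    unfolding hausdorff_measure_def bot_ennreal[symmetric] SUP_bot_conv by auto
  moreover have "hausdorff_premeasure s \<delta> E = 0 \<longleftrightarrow> (\<forall>e>0. \<exists>U :: nat \<Rightarrow> 'a set.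
      (\<forall>i. bounded (U i) \<and> diameter (U i) \<le> \<delta>) \<and> E \<subseteq> (\<Union>i. U i) \<and> (\<Sum>i. ennreal (diam_powr s (U i))) < ennreal e)" for \<delta>
  proof
    assume z: "hausdorff_premeasure s \<delta> E = 0"
    show "\<forall>e>0. \<exists>U :: nat \<Rightarrow> 'a set. (\<forall>i. bounded (U i) \<and> diameter (U i) \<le> \<delta>) \<and> E \<subseteq> (\<Union>i. U i) \<and> (\<Sum>i. ennreal (diam_powr s (U i))) < ennreal e"
    proof (intro allI impI)
      fix e :: real assume "0 < e"
      then have "hausdorff_premeasure s \<delta> E < ennreal e" using z by simp
      then show "\<exists>U :: nat \<Rightarrow> 'a set. (\<forall>i. bounded (U i) \<and> diameter (U i) \<le> \<delta>) \<and> E \<subseteq> (\<Union>i. U i) \<and> (\<Sum>i. ennreal (diam_powr s (U i))) < ennreal e"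
        unfolding hausdorff_premeasure_def INF_less_iff by (simp only: Bex_def mem_Collect_eq conj_assoc)
    qed
  next
    assume r: "\<forall>e>0. \<exists>U :: nat \<Rightarrow> 'a set. (\<forall>i. bounded (U i) \<and> diameter (U i) \<le> \<delta>) \<and> E \<subseteq> (\<Union>i. U i) \<and> (\<Sum>i. ennreal (diam_powr s (U i))) < ennreal e"
    have "hausdorff_premeasure s \<delta> E \<le> 0 + ennreal e" if e: "0 < e" for e :: real
    proof -
      obtain U :: "nat \<Rightarrow> 'a set" where U: "\<forall>i. bounded (U i) \<and> diameter (U i) \<le> \<delta>" "E \<subseteq> (\<Union>i. U i)"
          "(\<Sum>i. ennreal (diam_powr s (U i))) < ennreal e" using r[rule_format, OF e] by (elim exE conjE)
      have "hausdorff_premeasure s \<delta> E \<le> (\<Sum>i. ennreal (diam_powr s (U i)))"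
        unfolding hausdorff_premeasure_def by (rule INF_lower) (use U in simp)
      then show ?thesis using U(3) by simp
    qed
    then have "hausdorff_premeasure s \<delta> E \<le> 0" by (rule ennreal_le_epsilon)
    then show "hausdorff_premeasure s \<delta> E = 0" by simp
  qed
  ultimately show ?thesis by (simp only:)
qed

lemma hausdorff_measure_UN_eq_0:
  fixes E :: "nat \<Rightarrow> 'a::metric_space set"
  assumes "\<And>i. hausdorff_measure s (E i) = 0"
  shows "hausdorff_measure s (\<Union>i. E i) = 0"
  unfolding hausdorff_measure_eq_0_iff
proof (intro allI impI)
  fix \<delta> e :: real assume \<delta>: "0 < \<delta>" and e: "0 < e"
  have "\<exists>U :: nat \<Rightarrow> 'a set. (\<forall>j. bounded (U j) \<and> diameter (U j) \<le> \<delta>) \<and> E i \<subseteq> (\<Union>j. U j) \<and>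
      (\<Sum>j. ennreal (diam_powr s (U j))) < ennreal (e / 2 * (1/2) ^ Suc i)" for i
  proof -
    have "0 < e / 2 * (1/2) ^ Suc i" using e by simp
    then show ?thesis using assms[of i] \<delta> unfolding hausdorff_measure_eq_0_iff by simp
  qed
  then obtain U :: "nat \<Rightarrow> nat \<Rightarrow> 'a set" where U: "\<And>i j. bounded (U i j) \<and> diameter (U i j) \<le> \<delta>" "\<And>i. E i \<subseteq> (\<Union>j. U i j)"
      "\<And>i. (\<Sum>j. ennreal (diam_powr s (U i j))) < ennreal (e / 2 * (1/2) ^ Suc i)" by metis
  define V where "V n = (case prod_decode n of (i, j) \<Rightarrow> U i j)" for n
  have "(\<Sum>n. ennreal (diam_powr s (V n))) = (\<Sum>i. \<Sum>j. ennreal (diam_powr s (U i j)))"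
    using suminf_ennreal_2dimen[of "\<lambda>i. \<Sum>j. ennreal (diam_powr s (U i j))" "\<lambda>(i, j). ennreal (diam_powr s (U i j))"]
    by (simp add: V_def split_def)
  also have "\<dots> \<le> (\<Sum>i. ennreal (e / 2 * (1/2) ^ Suc i))"
    by (rule suminf_le) (use U(3) in \<open>auto intro: less_imp_le\<close>)
  also have "\<dots> = ennreal (e / 2)"
    using e sums_mult[OF power_half_series, of "e / 2"] by (intro suminf_ennreal_eq) auto
  also have "\<dots> < ennreal e" using e by (intro ennreal_lessI) auto
  finally have "(\<Sum>n. ennreal (diam_powr s (V n))) < ennreal e" .
  moreover have "(\<Union>i. E i) \<subseteq> (\<Union>n. V n)"
  proof
    fix x assume "x \<in> (\<Union>i. E i)"
    then obtain i j where "x \<in> U i j" using U(2) by blast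
    then have "x \<in> V (prod_encode (i, j))" by (simp add: V_def)
    then show "x \<in> (\<Union>n. V n)" by blast
  qed
  moreover have "bounded (V n) \<and> diameter (V n) \<le> \<delta>" for n
    using U(1) by (simp add: V_def split: prod.split)
  ultimately show "\<exists>V :: nat \<Rightarrow> 'a set. (\<forall>i. bounded (V i) \<and> diameter (V i) \<le> \<delta>) \<and> (\<Union>i. E i) \<subseteq> (\<Union>i. V i) \<and>
      (\<Sum>i. ennreal (diam_powr s (V i))) < ennreal e" by blast
qed

lemma hausdorff_measure_mono_0:
  fixes E :: "'a::metric_space set"
  shows
  "hausdorff_measure s E = 0 \<Longrightarrow> E' \<subseteq> E \<Longrightarrow> hausdorff_measure s E' = 0"
  unfolding hausdorff_measure_eq_0_iff
proof (intro allI impI)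
  fix \<delta> e :: real
  assume *: "\<forall>\<delta>>0. \<forall>e>0. \<exists>U :: nat \<Rightarrow> 'a set. (\<forall>i. bounded (U i) \<and> diameter (U i) \<le> \<delta>) \<and> E \<subseteq> (\<Union>i. U i) \<and>
      (\<Sum>i. ennreal (diam_powr s (U i))) < ennreal e" "E' \<subseteq> E" "0 < \<delta>" "0 < e"
  from *(1)[rule_format, OF *(3,4)] obtain U :: "nat \<Rightarrow> 'a set" where
    "(\<forall>i. bounded (U i) \<and> diameter (U i) \<le> \<delta>)" "E \<subseteq> (\<Union>i. U i)" "(\<Sum>i. ennreal (diam_powr s (U i))) < ennreal e" by (elim exE conjE)
  with *(2) show "\<exists>U :: nat \<Rightarrow> 'a set. (\<forall>i. bounded (U i) \<and> diameter (U i) \<le> \<delta>) \<and> E' \<subseteq> (\<Union>i. U i) \<and>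
      (\<Sum>i. ennreal (diam_powr s (U i))) < ennreal e" by (intro exI[of _ U] conjI) auto
qed

text \<open>A finite cover is continued by empty sets, which cost 0 by the convention in
  \<open>diam_powr\<close>.\<close>

lemma hausdorff_measure_eq_0I:
  fixes E :: "'a::metric_space set"
  assumes s: "0 < s"
    and cover: "\<And>\<delta> e. 0 < \<delta> \<Longrightarrow> 0 < e \<Longrightarrow> \<exists>F r. finite F \<and> r \<le> \<delta> \<and> E \<subseteq> \<Union>F \<and>
      (\<forall>U\<in>F. bounded U \<and> diameter U \<le> r) \<and> real (card F) * r powr s < e"
  shows "hausdorff_measure s E = 0"
  unfolding hausdorff_measure_eq_0_iff
proof (intro allI impI)
  fix \<delta> e :: real assume \<delta>: "0 < \<delta>" and e: "0 < e"
  obtain F r where F: "finite F" "r \<le> \<delta>" "E \<subseteq> \<Union>F" "\<And>U. U \<in> F \<Longrightarrow> bounded U \<and> diameter U \<le> r"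
      "real (card F) * r powr s < e" using cover[OF \<delta> e] by blast
  obtain f where f: "bij_betw f {0..<card F} F" using ex_bij_betw_nat_finite[OF F(1)] by blast
  define U where "U i = (if i < card F then f i else {})" for i
  have fF: "f i \<in> F" if "i < card F" for i using f that by (auto simp: bij_betw_def)
  have "(\<Sum>i. ennreal (diam_powr s (U i))) = (\<Sum>i\<in>{..<card F}. ennreal (diam_powr s (U i)))"
    by (rule suminf_finite) (auto simp: U_def diam_powr_def)
  also have "\<dots> \<le> (\<Sum>i\<in>{..<card F}. ennreal (r powr s))"
  proof (rule sum_mono)
    fix i assume "i \<in> {..<card F}"
    then have "bounded (U i)" "diameter (U i) \<le> r" using F(4) fF by (auto simp: U_def)
    then have "diam_powr s (U i) \<le> r powr s"
      using s by (auto simp: diam_powr_def diameter_ge_0 intro!: powr_mono2)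
    then show "ennreal (diam_powr s (U i)) \<le> ennreal (r powr s)" by (rule ennreal_leI)
  qed
  also have "\<dots> = ennreal (real (card F) * r powr s)" by (simp add: ennreal_mult ennreal_of_nat_eq_real_of_nat)
  also have "\<dots> < ennreal e" using F(5) e by (intro ennreal_lessI)
  finally have "(\<Sum>i. ennreal (diam_powr s (U i))) < ennreal e" .
  moreover have "E \<subseteq> (\<Union>i. U i)"
  proof
    fix x assume "x \<in> E"
    then obtain V where V: "V \<in> F" "x \<in> V" using F(3) by blast
    then have "V \<in> f ` {0..<card F}" using f by (simp add: bij_betw_def)
    then obtain i where "i < card F" "f i = V" by auto
    then have "x \<in> U i" using V by (simp add: U_def)
    then show "x \<in> (\<Union>i. U i)" by blast
  qed
  moreover have "bounded (U i) \<and> diameter (U i) \<le> \<delta>" for i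
    using F(2) F(4)[OF fF[of i]] \<delta> by (auto simp: U_def)
  ultimately show "\<exists>U :: nat \<Rightarrow> 'a set. (\<forall>i. bounded (U i) \<and> diameter (U i) \<le> \<delta>) \<and> E \<subseteq> (\<Union>i. U i) \<and>
      (\<Sum>i. ennreal (diam_powr s (U i))) < ennreal e" by blast
qed

lemma hausdorff_dim_leI:
  assumes "0 \<le> c" "\<And>s. c < s \<Longrightarrow> hausdorff_measure s E = 0"
  shows "hausdorff_dim E \<le> ereal c"
proof (rule dense_ge)
  fix x assume x: "ereal c < x"
  show "hausdorff_dim E \<le> x"
  proof (cases x)
    case (real s)
    then have "s \<in> {s. 0 \<le> s \<and> hausdorff_measure s E = 0}" using x assms by auto
    then show ?thesis unfolding hausdorff_dim_def real by (rule INF_lower)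
  qed (use x in auto)
qed

text \<open>At level \<open>k\<close> the cubes have diameter of order \<open>1 / M ^ k\<close>, so
  the total is of order \<open>(D / M powr s) ^ (k - k0)\<close>, which tends to 0.\<close>

lemma hausdorff_measure_corner_eq_0:
  fixes S :: "(real ^ 'd::finite) set"
  assumes s: "0 < s" and M: "2 \<le> M" and D: "0 < D" "D < real M powr s"
    and count: "\<And>k. k0 \<le> k \<Longrightarrow> finite (corner M k ` S) \<and> real (card (corner M k ` S)) \<le> C * D ^ (k - k0)"
  shows "hausdorff_measure s S = 0"
proof (rule hausdorff_measure_eq_0I[OF s])
  fix \<delta> e :: real assume \<delta>: "0 < \<delta>" and e: "0 < e"
  define r where "r k = 2 * real CARD('d) * (1 / real M) ^ k" for k
  define \<rho> where "\<rho> = D / real M powr s"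
  define C' where "C' = C * (2 * real CARD('d)) powr s * (1 / real M powr s) ^ k0"
  have M1: "\<bar>1 / real M\<bar> < 1" using M by simp
  have "r \<longlonglongrightarrow> 2 * real CARD('d) * 0"
    unfolding r_def using M1 by (intro tendsto_mult tendsto_const LIMSEQ_power_zero) auto
  then have "eventually (\<lambda>k. r k < \<delta>) sequentially" using \<delta> by (intro order_tendstoD) auto
  moreover have "eventually (\<lambda>k. C' * \<rho> ^ (k - k0) < e) sequentially"
  proof -
    have "\<bar>\<rho>\<bar> < 1" using D M by (simp add: \<rho>_def)
    then have "(\<lambda>k. C' * \<rho> ^ k) \<longlonglongrightarrow> C' * 0"
      by (intro tendsto_mult tendsto_const LIMSEQ_power_zero) auto
    then have ev: "eventually (\<lambda>k. C' * \<rho> ^ k < e) sequentially" using e by (intro order_tendstoD) auto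
    show ?thesis
      by (rule eventually_compose_filterlim[OF ev]) (simp add: filterlim_minus_const_nat_at_top)
  qed
  ultimately have "eventually (\<lambda>k. r k < \<delta> \<and> C' * \<rho> ^ (k - k0) < e \<and> k0 \<le> k) sequentially"
    using eventually_ge_at_top[of k0] by eventually_elim auto
  then obtain k where k: "r k < \<delta>" "C' * \<rho> ^ (k - k0) < e" "k0 \<le> k" by (auto simp: eventually_sequentially)
  \<comment> \<open>Centred at the corner: the symmetric cube contains the half-open one and costs
    only a factor 2 in the diameter.\<close>
  define cube where "cube t = {x. \<forall>a. \<bar>x $ a - t $ a\<bar> \<le> (1 / real M) ^ k}" for t :: "real ^ 'd"
  define F where "F = cube ` corner M k ` S"
  have near: "norm (x - y) \<le> r k" if "x \<in> cube t" "y \<in> cube t" for x y t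
  proof -
    have "norm (x - y) \<le> (\<Sum>a\<in>UNIV. \<bar>(x - y) $ a\<bar>)" by (rule norm_le_l1_cart)
    also have "\<dots> \<le> (\<Sum>a\<in>(UNIV::'d set). 2 * (1 / real M) ^ k)"
    proof (rule sum_mono)
      fix a
      have "\<bar>x $ a - t $ a\<bar> \<le> (1 / real M) ^ k" "\<bar>y $ a - t $ a\<bar> \<le> (1 / real M) ^ k"
        using that by (simp_all add: cube_def)
      then show "\<bar>(x - y) $ a\<bar> \<le> 2 * (1 / real M) ^ k" unfolding vector_minus_component by linarith
    qed
    finally show ?thesis by (simp add: r_def)
  qed
  have r0: "0 < r k" using M by (simp add: r_def)
  have "bounded U \<and> diameter U \<le> r k" if U: "U \<in> F" for U
  proof -
    obtain t where t: "U = cube t" using U by (auto simp: F_def)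
    have "t \<in> cube t" by (simp add: cube_def)
    then have "U \<subseteq> cball t (r k)" using near[of t t] by (auto simp: t dist_norm)
    then have "bounded U" using bounded_subset bounded_cball by blast
    moreover have "diameter U \<le> r k" using near r0 by (intro diameter_le) (auto simp: t)
    ultimately show ?thesis by simp
  qed
  moreover have "S \<subseteq> \<Union>F"
  proof
    fix x assume x: "x \<in> S"
    have "x \<in> cube (corner M k x)" using corner_dist[of M x _ k] M by (simp add: cube_def power_one_over)
    then show "x \<in> \<Union>F" using x by (auto simp: F_def)
  qed
  moreover have "finite F" using count[OF k(3)] by (simp add: F_def)
  moreover have "real (card F) * r k powr s < e"
  proof -
    have "card F \<le> card (corner M k ` S)" unfolding F_def using count[OF k(3)] by (intro card_image_le) simp
    then have "real (card F) \<le> C * D ^ (k - k0)" using count[OF k(3)] by linarith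
    then have le: "real (card F) * r k powr s \<le> C * D ^ (k - k0) * r k powr s" by (rule mult_right_mono) simp
    have "((1 / real M) ^ k) powr s = (1 / real M powr s) ^ k"
      using M by (simp add: powr_realpow[symmetric] powr_powr powr_divide mult.commute del: powr_realpow)
    then have "r k powr s = (2 * real CARD('d)) powr s * (1 / real M powr s) ^ k"
      using M by (simp add: r_def powr_mult)
    also have "(1 / real M powr s) ^ k = (1 / real M powr s) ^ k0 * (1 / real M powr s) ^ (k - k0)"
      using k(3) by (simp flip: power_add)
    finally have "C * D ^ (k - k0) * r k powr s = C' * \<rho> ^ (k - k0)"
      by (simp add: C'_def \<rho>_def power_divide)
    then show ?thesis using le k(2) by linarith
  qed
  ultimately show "\<exists>F r. finite F \<and> r \<le> \<delta> \<and> S \<subseteq> \<Union>F \<and> (\<forall>U\<in>F. bounded U \<and> diameter U \<le> r) \<and> real (card F) * r powr s < e"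
    using k(1) by (intro exI[of _ F] exI[of _ "r k"] conjI ballI) (auto intro: less_imp_le)
qed

text \<open>The trivial bound, from the tree with step 2 in which every cube keeps at most all of
  its 2^d children.\<close>

lemma hausdorff_dim_le_card:
  fixes E :: "(real ^ 'd::finite) set"
  shows "hausdorff_dim E \<le> ereal (real CARD('d))"
proof (rule hausdorff_dim_leI)
  fix s assume s: "real CARD('d) < s"
  have "hausdorff_measure s (E \<inter> cball 0 (real i)) = 0" for i
  proof (rule hausdorff_measure_corner_eq_0)
    let ?S = "E \<inter> cball 0 (real i)"
    have bd: "bounded ?S" by (intro bounded_Int) simp
    show "finite (corner 2 k ` ?S) \<and> real (card (corner 2 k ` ?S)) \<le> real (card (corner 2 0 ` ?S)) * (2 ^ CARD('d)) ^ (k - 0)" for k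
    proof (induction k)
      case 0
      then show ?case using finite_corner_0[OF bd] by simp
    next
      case (Suc k)
      let ?Y = "(\<lambda>(t, j). t + (1 / real 2 ^ k) *\<^sub>R grid_pt 2 j) ` (corner 2 k ` ?S \<times> grid 2)"
      have sub: "corner 2 (Suc k) ` ?S \<subseteq> ?Y"
      proof
        fix t assume "t \<in> corner 2 (Suc k) ` ?S"
        then obtain x where x: "x \<in> ?S" "t = corner 2 (Suc k) x" by blast
        obtain j where "j \<in> grid 2" "corner 2 (Suc k) x = corner 2 k x + (1 / real 2 ^ k) *\<^sub>R grid_pt 2 j"
          by (rule corner_Suc[of 2 k x]) auto
        then show "t \<in> ?Y" using x by force
      qed
      have fin: "finite (corner 2 k ` ?S \<times> (grid 2 :: ('d \<Rightarrow> nat) set))" using Suc finite_grid by blast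
      have "card (corner 2 (Suc k) ` ?S) \<le> card ?Y" using fin sub by (intro card_mono) auto
      also have "\<dots> \<le> card (corner 2 k ` ?S \<times> (grid 2 :: ('d \<Rightarrow> nat) set))" by (rule card_image_le[OF fin])
      also have "\<dots> = card (corner 2 k ` ?S) * 2 ^ CARD('d)" by (simp add: card_cartesian_product card_grid)
      finally have "real (card (corner 2 (Suc k) ` ?S)) \<le> real (card (corner 2 k ` ?S)) * 2 ^ CARD('d)"
        by (metis of_nat_le_iff of_nat_mult of_nat_numeral of_nat_power)
      also have "\<dots> \<le> real (card (corner 2 0 ` ?S)) * (2 ^ CARD('d)) ^ (k - 0) * 2 ^ CARD('d)"
        using Suc by (intro mult_right_mono) auto
      finally show ?case using finite_subset[OF sub] fin by (simp add: mult_ac)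
    qed
    have "2 ^ CARD('d) = (2::real) powr real CARD('d)" by (simp add: powr_realpow)
    also have "\<dots> < 2 powr s" using s by simp
    finally show "(2::real) ^ CARD('d) < real 2 powr s" by simp
  qed (use s in auto)
  then have "hausdorff_measure s (\<Union>i. E \<inter> cball 0 (real i)) = 0" by (rule hausdorff_measure_UN_eq_0)
  moreover have "E \<subseteq> (\<Union>i. E \<inter> cball 0 (real i))" using real_arch_simple by auto
  ultimately show "hausdorff_measure s E = 0" by (rule hausdorff_measure_mono_0)
qed simp

context slice
begin

section \<open>Finiteness of the summed height and choice of the step\<close>

lemma height_scale_ge_1: "1 \<le> height_scale M"
  unfolding height_scale_def by (simp add: mult_nonneg_nonneg)

text \<open>A lower bound for single vectors bounds all products from below. On the first piece of
  the weight, \<open>i * \<beta>\<close> equals \<open>(1 + p) / \<theta>\<close> for every rank; on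
  the second it is \<open>i / (N - i) * (d - p) / \<theta>\<close>, worst at
  \<open>i = N - 1\<close>. The two hypotheses \<open>q\<close> express these two
  thresholds.\<close>

lemma lat_height_central_le:
  assumes K: "1 \<le> K" and c: "0 < c" "c \<le> 1" and \<nu>: "0 \<le> \<nu>"
    and lower: "\<And>v. v \<in> L \<Longrightarrow> v \<noteq> 0 \<Longrightarrow> c * 2 powr (- (real l * \<nu>)) \<le> infnorm (central l v)"
    and q: "\<nu> * (1 + p) \<le> q * \<theta>" "real (N - 1) * \<nu> * (real d - p) \<le> q * \<theta>"
  shows "lat_height K (central l \<circ> id) \<le> ennreal (c powr (- (real N * b)) * 2 powr (real l * q))"
  unfolding lat_height_def
proof (rule SUP_least, clarify)
  fix I :: "('d option + 'm) set" and w assume t: "indep_tuple I w"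
  define i where "i = card I"
  define \<beta> where "\<beta> = 1 / \<phi> i"
  have i: "0 < i" "i < N" using indep_tuple_card[OF t] by (simp_all add: i_def N_def)
  note \<phi>i = \<phi>_bounds[OF i]
  have \<beta>: "0 < \<beta>" "\<beta> \<le> b" using \<phi>i by (simp_all add: \<beta>_def)
  have rate: "real i * \<beta> * \<nu> \<le> q"
  proof -
    have cancel: "x \<le> q" if "x * \<theta> \<le> q * \<theta>" for x using that \<theta>(1) by simp
    have "\<phi> i = real i * \<theta> / (1 + p) \<or> \<phi> i = (real d + 1 - real i * \<theta>) / (real d - p)"
      unfolding \<phi>_eq min_def by simp
    then show ?thesis
    proof
      assume "\<phi> i = real i * \<theta> / (1 + p)"
      then have "real i * \<beta> * \<theta> = 1 + p" using i \<theta>(1) p by (simp add: \<beta>_def)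
      then have "real i * \<beta> * \<nu> * \<theta> = \<nu> * (1 + p)" by (metis mult.assoc mult.commute)
      then show ?thesis using q(1) by (intro cancel) (simp only:)
    next
      assume e: "\<phi> i = (real d + 1 - real i * \<theta>) / (real d - p)"
      define r where "r = real N - real i"
      have r: "1 \<le> r" "real i \<le> real (N - 1)" using i by (auto simp: r_def)
      have "\<phi> i = r * \<theta> / (real d - p)" unfolding e \<theta>(2)[symmetric] r_def by (simp add: algebra_simps)
      then have "real i * \<beta> * \<nu> * \<theta> = real i * \<nu> * (real d - p) / r" using r \<theta>(1) p' by (simp add: \<beta>_def)
      also have "\<dots> \<le> real i * \<nu> * (real d - p) / 1"
        using r \<nu> p' by (intro divide_left_mono mult_nonneg_nonneg) auto
      also have "\<dots> \<le> real (N - 1) * \<nu> * (real d - p)"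
        using r \<nu> p' by (simp add: mult_right_mono)
      finally show ?thesis using q(2) by (intro cancel) (rule order_trans)
    qed
  qed
  define \<mu> where "\<mu> = c * 2 powr (- (real l * \<nu>))"
  have \<mu>: "0 < \<mu>" using c by (simp add: \<mu>_def)
  have comp: "\<mu> \<le> infnorm ((central l \<circ> id \<circ> w) k)" if k: "k \<in> I" for k
  proof -
    have "0 < (\<Prod>k\<in>I. infnorm (w k))" using t by (intro prod_infnorm_pos) (simp add: indep_tuple_def)
    then have "infnorm (w k) \<noteq> 0" using k by (metis finite prod_zero_iff less_irrefl)
    then have "w k \<noteq> 0" by (metis infnorm_0)
    moreover have "w k \<in> L" using t k by (simp add: indep_tuple_def)
    ultimately show ?thesis using lower by (simp add: \<mu>_def)
  qed
  have "\<mu> ^ i = (\<Prod>k\<in>I. \<mu>)" by (simp add: i_def)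
  also have "\<dots> \<le> (\<Prod>k\<in>I. infnorm ((central l \<circ> id \<circ> w) k))"
    using \<mu> comp by (intro prod_mono) auto
  also have "\<dots> \<le> K ^ (card I * (CARD('d option + 'm) - card I)) * (\<Prod>k\<in>I. infnorm ((central l \<circ> id \<circ> w) k))"
    using mult_right_mono[OF one_le_power[OF K], of "\<Prod>k\<in>I. infnorm ((central l \<circ> id \<circ> w) k)" "card I * (CARD('d option + 'm) - card I)"]
    by (simp add: prod_nonneg infnorm_pos_le del: card_sum)
  finally have "tuple_height K I (central l \<circ> id \<circ> w) \<le> (\<mu> ^ i) powr (- \<beta>)"
    using \<mu> \<beta> unfolding tuple_height_def i_def[symmetric] \<beta>_def[symmetric]
    by (intro powr_mono2') auto
  also have "\<dots> = \<mu> powr (- (real i * \<beta>))"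
    using \<mu> by (simp add: powr_realpow[symmetric] powr_powr del: powr_realpow)
  also have "\<dots> = c powr (- (real i * \<beta>)) * 2 powr (real l * (real i * \<beta> * \<nu>))"
    using c by (simp add: \<mu>_def powr_mult powr_powr algebra_simps)
  also have "\<dots> \<le> c powr (- (real N * b)) * 2 powr (real l * q)"
  proof (intro mult_mono)
    have "real i * \<beta> \<le> real N * b" using i \<beta> by (intro mult_mono) auto
    then show "c powr (- (real i * \<beta>)) \<le> c powr (- (real N * b))" using c by (intro powr_mono') auto
    show "2 powr (real l * (real i * \<beta> * \<nu>)) \<le> 2 powr (real l * q)" using rate by (simp add: mult_left_mono)
  qed auto
  finally show "ennreal (tuple_height K I (central l \<circ> id \<circ> w)) \<le> ennreal (c powr (- (real N * b)) * 2 powr (real l * q))"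
    by (rule ennreal_leI)
qed

text \<open>The heights along the group grow at most at rate \<open>q'\<close>, which lies below the
  discount \<open>q\<close>.\<close>

lemma total_height_finite:
  assumes K: "1 \<le> K" and c: "0 < c" "c \<le> 1" and \<nu>: "0 \<le> \<nu>"
    and lower: "\<And>l v. v \<in> L \<Longrightarrow> v \<noteq> 0 \<Longrightarrow> c * 2 powr (- (real l * \<nu>)) \<le> infnorm (central l v)"
    and q: "\<nu> * (1 + p) \<le> q' * \<theta>" "real (N - 1) * \<nu> * (real d - p) \<le> q' * \<theta>" "q' < q"
  shows "total_height K q id < top"
proof -
  let ?C = "c powr (- (real N * b))"
  have "total_height K q id \<le> (\<Sum>l. ennreal ?C * ennreal (2 powr (- (real l * (q - q')))))"
    unfolding total_height_def
  proof (rule suminf_le)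
    fix l
    have "ennreal (2 powr (- (real l * q))) * lat_height K (central l \<circ> id)
      \<le> ennreal (2 powr (- (real l * q))) * ennreal (?C * 2 powr (real l * q'))"
      by (intro mult_left_mono lat_height_central_le[OF K c \<nu> lower q(1,2)]) auto
    also have "\<dots> = ennreal ?C * ennreal (2 powr (- (real l * (q - q'))))"
    proof -
      have "2 powr (- (real l * (q - q'))) = 2 powr (- (real l * q)) * 2 powr (real l * q')"
        unfolding powr_add[symmetric] right_diff_distrib by simp
      then have "2 powr (- (real l * q)) * (?C * 2 powr (real l * q')) = ?C * 2 powr (- (real l * (q - q')))"
        by (simp only: mult_ac)
      then show ?thesis by (simp only: ennreal_mult[symmetric] mult_nonneg_nonneg powr_ge_zero)
    qed
    finally show "ennreal (2 powr (- (real l * q))) * lat_height K (central l \<circ> id) \<le> ennreal ?C * ennreal (2 powr (- (real l * (q - q'))))" .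
  qed auto
  also have "\<dots> = ennreal ?C * ennreal (geom (q - q'))"
    using suminf_geom[of "q - q'"] q(3) by (simp only: ennreal_suminf_cmult diff_gt_0_iff_gt)
  also have "\<dots> < top" by (simp add: ennreal_mult_less_top)
  finally show ?thesis .
qed

text \<open>Up to a constant \<open>mult_const M\<close> is \<open>logf M * M powr dim_exp\<close>,
  and the logarithm loses against the excess \<open>\<sigma> - dim_exp\<close>.\<close>

lemma exists_contracting_step:
  assumes "dim_exp < \<sigma>" "0 \<le> C"
  obtains M where "2 \<le> M" "C * mult_const M < real M powr \<sigma>"
proof -
  define \<tau> where "\<tau> = \<sigma> - dim_exp"
  have \<tau>: "0 < \<tau>" using assms by (simp add: \<tau>_def)
  define c0 where "c0 = C * (real N * (2 * fact N powr b) * 3 powr (real N * real N * b) * avg_const)"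
  define c1 where "c1 = log 2 ((1 + real N)\<^sup>2) + 1"
  have lim0: "(\<lambda>M. real M powr (- \<tau>)) \<longlonglongrightarrow> 0"
    using \<tau> by (intro tendsto_neg_powr filterlim_real_sequentially) auto
  have "(\<lambda>M. c0 * (c1 * real M powr (- \<tau>) + ln (real M) / (real M powr \<tau>) / ln 2)) \<longlonglongrightarrow> c0 * (c1 * 0 + 0 / ln 2)"
    by (intro tendsto_intros lim0 lim_ln_over_power \<tau>) auto
  then have "eventually (\<lambda>M. c0 * (c1 * real M powr (- \<tau>) + ln (real M) / (real M powr \<tau>) / ln 2) < 1) sequentially"
    by (intro order_tendstoD) auto
  then have "eventually (\<lambda>M. c0 * (c1 * real M powr (- \<tau>) + ln (real M) / (real M powr \<tau>) / ln 2) < 1 \<and> 2 \<le> M) sequentially"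
    using eventually_ge_at_top[of "2::nat"] by (rule eventually_conj)
  then obtain M :: nat where M: "c0 * (c1 * real M powr (- \<tau>) + ln (real M) / (real M powr \<tau>) / ln 2) < 1" "2 \<le> M"
    by (auto simp: eventually_sequentially)
  have "logf M = c1 + ln (real M) / ln 2"
    using M(2) by (simp add: logf_def c1_def log_mult log_def[of 2 "real M"])
  then have "logf M * real M powr (- \<tau>) = c1 * real M powr (- \<tau>) + ln (real M) / (real M powr \<tau>) / ln 2"
    by (simp add: powr_minus divide_inverse algebra_simps)
  then have "c0 * (logf M * real M powr (- \<tau>)) < 1" using M(1) by simp
  moreover have "0 < real M powr \<sigma>" using M(2) by simp
  ultimately have "c0 * (logf M * real M powr (- \<tau>)) * real M powr \<sigma> < 1 * real M powr \<sigma>"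
    by (rule mult_strict_right_mono)
  also have "c0 * (logf M * real M powr (- \<tau>)) * real M powr \<sigma> = c0 * (logf M * (real M powr (- \<tau>) * real M powr \<sigma>))"
    by (simp only: mult.assoc)
  also have "real M powr (- \<tau>) * real M powr \<sigma> = real M powr dim_exp"
    unfolding powr_add[symmetric] by (simp add: \<tau>_def)
  also have "c0 * (logf M * real M powr dim_exp) = C * mult_const M"
    by (simp add: c0_def mult_const_def mult_ac)
  finally show thesis using that M(2) by simp
qed

text \<open>As \<open>q\<close>, and with it \<open>geom (p - q)\<close>, is fixed before
  \<open>M\<close>, the growth of the count can be made smaller than \<open>M powr \<sigma>\<close>.
  The set is cut into countably many pieces, each bounded and with a common starting time
  \<open>k0\<close>, to which the count applies.\<close>

lemma hausdorff_measure_short_eq_0: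
  assumes c: "0 < c" "c \<le> 1" and \<nu>: "0 \<le> \<nu>"
    and lower: "\<And>l v. v \<in> L \<Longrightarrow> v \<noteq> 0 \<Longrightarrow> c * 2 powr (- (real l * \<nu>)) \<le> infnorm (central l v)"
    and rate: "\<nu> * (1 + p) < p * \<theta>" "real (N - 1) * \<nu> * (real d - p) < p * \<theta>"
    and \<sigma>: "dim_exp < \<sigma>"
    and short: "\<And>s M \<epsilon>. s \<in> S \<Longrightarrow> 2 \<le> M \<Longrightarrow> 0 < \<epsilon> \<Longrightarrow> \<exists>k0. \<forall>k\<ge>k0. \<exists>v\<in>L. v \<noteq> 0 \<and> infnorm (flow M k s v) \<le> \<epsilon>"
  shows "hausdorff_measure \<sigma> S = 0"
proof -
  define q' where "q' = max (\<nu> * (1 + p) / \<theta>) (real (N - 1) * \<nu> * (real d - p) / \<theta>)"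
  have q': "\<nu> * (1 + p) \<le> q' * \<theta>" "real (N - 1) * \<nu> * (real d - p) \<le> q' * \<theta>"
    using \<theta>(1) by (simp_all add: q'_def pos_divide_le_eq[symmetric])
  have "q' < p" using rate \<theta>(1) by (simp add: q'_def pos_divide_less_eq)
  moreover have "0 \<le> q'" using \<nu> p \<theta>(1) by (simp add: q'_def le_max_iff_disj)
  ultimately obtain q where q: "q' < q" "q < p" "0 < q" using dense[of q' p] by auto
  define G where "G = 2 * geom (p - q)"
  have G: "0 < G" using geom_pos[of "p - q"] q by (simp add: G_def)
  obtain M where M: "2 \<le> M" "G * mult_const M < real M powr \<sigma>"
    using exists_contracting_step[OF \<sigma>, of G] G by auto
  have M1: "1 \<le> M" using M by simp
  have \<sigma>0: "0 < \<sigma>"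
  proof -
    have "(real d - p) / (real d + 1) \<le> real d"
    proof -
      have "real d - p \<le> real d * (real d + 1)" using p by (simp add: algebra_simps)
      then show ?thesis by (simp add: pos_divide_le_eq)
    qed
    then show ?thesis using \<sigma> by (simp add: dim_exp_def)
  qed
  have fin: "total_height (height_scale M) q id < top"
    by (rule total_height_finite[OF height_scale_ge_1 c \<nu> lower q' q(1)])
  obtain \<epsilon> where \<epsilon>: "0 < \<epsilon>"
    "\<forall>S k0. bounded S \<longrightarrow> (\<forall>s\<in>S. \<forall>k\<ge>k0. \<exists>v\<in>L. v \<noteq> 0 \<and> infnorm (flow M k s v) \<le> \<epsilon>) \<longrightarrow>
      (\<exists>C. \<forall>k\<ge>k0. finite (corner M k ` S) \<and> real (card (corner M k ` S)) \<le> C * (2 * (mult_const M * geom (p - q))) ^ (k - k0))"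
    by (rule cover_count[OF M1 q(3,2) fin])
  define T where "T i k0 = {s \<in> S \<inter> cball 0 (real i). \<forall>k\<ge>k0. \<exists>v\<in>L. v \<noteq> 0 \<and> infnorm (flow M k s v) \<le> \<epsilon>}" for i k0
  have "hausdorff_measure \<sigma> (T i k0) = 0" for i k0
  proof -
    have "bounded (T i k0)" by (rule bounded_subset[of "cball 0 (real i)"]) (auto simp: T_def)
    moreover have "\<forall>s\<in>T i k0. \<forall>k\<ge>k0. \<exists>v\<in>L. v \<noteq> 0 \<and> infnorm (flow M k s v) \<le> \<epsilon>" by (simp add: T_def)
    ultimately have "\<exists>C. \<forall>k\<ge>k0. finite (corner M k ` T i k0) \<and>
        real (card (corner M k ` T i k0)) \<le> C * (2 * (mult_const M * geom (p - q))) ^ (k - k0)"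
      by (rule \<epsilon>(2)[THEN spec, THEN spec, THEN mp, THEN mp])
    then obtain C where C: "\<forall>k\<ge>k0. finite (corner M k ` T i k0) \<and>
        real (card (corner M k ` T i k0)) \<le> C * (2 * (mult_const M * geom (p - q))) ^ (k - k0)" by (rule exE)
    show ?thesis
    proof (rule hausdorff_measure_corner_eq_0[OF \<sigma>0 M(1)])
      show "0 < 2 * (mult_const M * geom (p - q))" using mult_const_pos[OF M1] geom_pos[of "p - q"] q by simp
      show "2 * (mult_const M * geom (p - q)) < real M powr \<sigma>" using M(2) by (simp add: G_def mult_ac)
    qed (use C in blast)
  qed
  then have "hausdorff_measure \<sigma> (\<Union>i. \<Union>k0. T i k0) = 0" by (intro hausdorff_measure_UN_eq_0)
  moreover have "S \<subseteq> (\<Union>i. \<Union>k0. T i k0)"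
  proof
    fix s assume s: "s \<in> S"
    obtain i where "norm s \<le> real i" using real_arch_simple by blast
    moreover obtain k0 where "\<forall>k\<ge>k0. \<exists>v\<in>L. v \<noteq> 0 \<and> infnorm (flow M k s v) \<le> \<epsilon>"
      using short[OF s M(1) \<epsilon>(1)] by blast
    ultimately have "s \<in> T i k0" using s by (simp add: T_def)
    then show "s \<in> (\<Union>i. \<Union>k0. T i k0)" by blast
  qed
  ultimately show ?thesis by (rule hausdorff_measure_mono_0)
qed

end

subsection \<open>The lattice of a system of linear forms\<close>

definition form_vec :: "real ^ 'm ^ 'd option \<Rightarrow> int ^ 'm \<Rightarrow> int ^ 'd option \<Rightarrow> real ^ ('d::finite option + 'm::finite)" where
  "form_vec A y P = (\<chi> r. case r of Inl i \<Rightarrow> (A *v of_int_vec y - of_int_vec P) $ i | Inr k \<Rightarrow> of_int (y $ k))"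

definition form_lattice :: "real ^ 'm ^ 'd option \<Rightarrow> (real ^ ('d::finite option + 'm::finite)) set" where
  "form_lattice A = {form_vec A y P | y P. True}"

text \<open>It maps \<open>(A y - P, y)\<close> to the integer vector \<open>(- P, y)\<close> and
  has determinant 1, so determinants of tuples from the lattice are integers.\<close>

definition untwist :: "real ^ 'm ^ 'd option \<Rightarrow> real ^ ('d::finite option + 'm::finite) \<Rightarrow> real ^ ('d option + 'm)" where
  "untwist A x = (\<chi> r. case r of Inl i \<Rightarrow> x $ Inl i - (\<Sum>k\<in>UNIV. A $ i $ k * x $ Inr k) | Inr k \<Rightarrow> x $ Inr k)"

lemma form_vec_add:
  "form_vec A y P + of_int z *\<^sub>R form_vec A y' P' = form_vec A (\<chi> i. y $ i + z * y' $ i) (\<chi> i. P $ i + z * P' $ i)"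
proof -
  have "(form_vec A y P + of_int z *\<^sub>R form_vec A y' P') $ r
    = form_vec A (\<chi> i. y $ i + z * y' $ i) (\<chi> i. P $ i + z * P' $ i) $ r" for r
    by (cases r) (simp_all add: form_vec_def of_int_vec_def matrix_vector_mult_def algebra_simps sum.distrib sum_distrib_left)
  then show ?thesis by (simp add: vec_eq_iff)
qed

lemma form_lattice_closed: "x \<in> form_lattice A \<Longrightarrow> y \<in> form_lattice A \<Longrightarrow> x + of_int z *\<^sub>R y \<in> form_lattice A"
  unfolding form_lattice_def using form_vec_add by blast

lemma linear_untwist: "linear (untwist A)"
proof (rule linearI)
  show "untwist A (x + y) = untwist A x + untwist A y" for x y
  proof -
    have "untwist A (x + y) $ r = (untwist A x + untwist A y) $ r" for r
      by (cases r) (simp_all add: untwist_def algebra_simps sum.distrib)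
    then show ?thesis by (simp add: vec_eq_iff)
  qed
  show "untwist A (c *\<^sub>R x) = c *\<^sub>R untwist A x" for c x
  proof -
    have "untwist A (c *\<^sub>R x) $ r = (c *\<^sub>R untwist A x) $ r" for r
      by (cases r) (simp_all add: untwist_def algebra_simps sum_distrib_left)
    then show ?thesis by (simp add: vec_eq_iff)
  qed
qed

lemma rowdet_untwist:
  fixes A :: "real ^ 'm::finite ^ 'd::finite option"
  shows "rowdet (\<lambda>r. untwist A (axis r 1)) = 1"
proof -
  let ?e = "\<lambda>r :: 'd option + 'm. axis r (1::real)"
  let ?x = "\<lambda>r. \<Sum>i\<in>UNIV. (- A $ i $ projr r) *\<^sub>R ?e (Inl i)"
  have "untwist A (?e r) = (if r \<in> range Inr then ?e r + ?x r else ?e r)" for r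
  proof -
    have "untwist A (?e r) $ r' = (if r \<in> range Inr then ?e r + ?x r else ?e r) $ r'" for r'
      by (cases r; cases r') (auto simp: untwist_def axis_def sum_negf if_distrib[of "\<lambda>x. _ * x"] cong: if_cong)
    then show ?thesis by (simp add: vec_eq_iff)
  qed
  then have "rowdet (\<lambda>r. untwist A (?e r)) = rowdet (\<lambda>r. if r \<in> range Inr then ?e r + ?x r else ?e r)" by simp
  also have "\<dots> = rowdet ?e"
  proof (rule rowdet_span_set)
    fix r :: "'d option + 'm"
    show "?x r \<in> span (?e ` (- range Inr))"
      by (intro span_sum span_scale span_base) auto
  qed
  finally show ?thesis by (simp add: rowdet_axis)
qed

lemma form_lattice_covol:
  fixes A :: "real ^ 'm::finite ^ 'd::finite option"
  assumes v: "\<And>k. v k \<in> form_lattice A" and det: "rowdet v \<noteq> 0"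
  shows "1 \<le> \<bar>rowdet v\<bar>"
proof -
  have eq: "rowdet (\<lambda>k. untwist A (v k)) = rowdet v"
    using rowdet_linear[OF linear_untwist, of A v] by (simp only: rowdet_untwist mult_1_right)
  have "rowdet (\<lambda>k. untwist A (v k)) \<in> \<int>"
  proof (rule rowdet_Ints)
    fix k r
    obtain y P where "v k = form_vec A y P" using v[of k] by (auto simp: form_lattice_def)
    then show "untwist A (v k) $ r \<in> \<int>"
      by (cases r) (auto simp: untwist_def form_vec_def of_int_vec_def matrix_vector_mult_def)
  qed
  then obtain z where z: "rowdet v = of_int z" unfolding eq by (rule Ints_cases)
  then show ?thesis using det by simp
qed

section \<open>Lower bounds for lattice vectors from the Diophantine exponent\<close>

lemma of_int_vec_infnorm_ge_1:
  assumes "y \<noteq> 0"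
  shows "1 \<le> infnorm (of_int_vec y)"
proof -
  obtain i where "y $ i \<noteq> 0" using assms by (auto simp: vec_eq_iff)
  then have "1 \<le> \<bar>of_int_vec y $ i\<bar>" by (simp add: of_int_vec_def)
  then show ?thesis using component_le_infnorm_cart[of "of_int_vec y" i] by (rule order_trans)
qed

text \<open>For \<open>w\<close> above the exponent only finitely many pairs satisfy the defining
  inequality. None of them makes the left side vanish, since the multiples of such a pair would be
  infinitely many further solutions. So \<open>c\<close> can be a minimum over a finite set of
  positive numbers.\<close>

lemma dioph_exponent_lower_bound:
  fixes A :: "real ^ 'm::finite ^ 'r::finite"
  assumes "dioph_exponent A < ereal w"
  obtains c where "0 < c" "c \<le> 1"
    "\<forall>y P. y \<noteq> 0 \<longrightarrow> c * infnorm (of_int_vec y) powr (- w) \<le> infnorm (A *v of_int_vec y - of_int_vec P)"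
proof -
  let ?n = "\<lambda>y P. infnorm (A *v of_int_vec y - of_int_vec P)"
  define X where "X = {(y :: int ^ 'm, P :: int ^ 'r). y \<noteq> 0 \<and> ?n y P \<le> infnorm (of_int_vec y) powr (- w)}"
  have fin: "finite X"
  proof (rule ccontr)
    assume "infinite X"
    then have "ereal w \<le> dioph_exponent A" unfolding dioph_exponent_def X_def by (intro Sup_upper) blast
    then show False using assms by simp
  qed
  have pos: "0 < ?n y P" if y: "y \<noteq> 0" for y P
  proof (rule ccontr)
    assume "\<not> 0 < ?n y P"
    then have "?n y P = 0" using infnorm_pos_le[of "A *v of_int_vec y - of_int_vec P"] by linarith
    then have z: "A *v of_int_vec y = of_int_vec P" by (simp add: infnorm_eq_0)
    \<comment> \<open>Multiples by \<open>j + 1\<close>, so that the first component is never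
      zero.\<close>
    let ?f = "\<lambda>j :: nat. ((\<chi> i. (int j + 1) * y $ i) :: int ^ 'm, (\<chi> i. (int j + 1) * P $ i) :: int ^ 'r)"
    obtain i where i: "y $ i \<noteq> 0" using y by (auto simp: vec_eq_iff)
    have "inj ?f"
    proof (rule injI)
      fix j j' assume "?f j = ?f j'"
      then have "fst (?f j) $ i = fst (?f j') $ i" by (simp only:)
      then have "(int j + 1) * y $ i = (int j' + 1) * y $ i" by simp
      then show "j = j'" using i by simp
    qed
    moreover have "range ?f \<subseteq> X"
    proof clarify
      fix j :: nat
      have sc: "of_int_vec (\<chi> i. (int j + 1) * u $ i) = (real j + 1) *\<^sub>R of_int_vec u" for u :: "int ^ 'a"
        by (simp add: of_int_vec_def vec_eq_iff algebra_simps)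
      have "(\<chi> i. (int j + 1) * y $ i) \<noteq> 0" using i by (auto simp: vec_eq_iff)
      moreover have "?n (\<chi> i. (int j + 1) * y $ i) (\<chi> i. (int j + 1) * P $ i) = 0"
        unfolding sc by (simp add: matrix_vector_mult_scaleR z infnorm_0)
      ultimately show "?f j \<in> X" unfolding X_def by simp
    qed
    ultimately have "infinite X" using finite_subset range_inj_infinite by blast
    then show False using fin by simp
  qed
  define g where "g = (\<lambda>(y, P). ?n y P * infnorm (of_int_vec y) powr w)"
  define c where "c = Min (insert 1 (g ` X))"
  have "c \<in> insert 1 (g ` X)" unfolding c_def using fin by (intro Min_in) auto
  moreover have "0 < g x" if "x \<in> X" for x
    using that pos of_int_vec_infnorm_ge_1 by (force simp: X_def g_def intro!: mult_pos_pos)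
  ultimately have c0: "0 < c" by auto
  have c1: "c \<le> 1" unfolding c_def using fin by (intro Min_le) auto
  show thesis
  proof (rule that[OF c0 c1], intro allI impI)
    fix y :: "int ^ 'm" and P :: "int ^ 'r" assume y: "y \<noteq> 0"
    have y0: "0 < infnorm (of_int_vec y)" using of_int_vec_infnorm_ge_1[OF y] by linarith
    show "c * infnorm (of_int_vec y) powr (- w) \<le> ?n y P"
    proof (cases "(y, P) \<in> X")
      case True
      then have "c \<le> g (y, P)" unfolding c_def using fin by (intro Min_le) auto
      then have "c * infnorm (of_int_vec y) powr (- w) \<le> g (y, P) * infnorm (of_int_vec y) powr (- w)"
        by (rule mult_right_mono) simp
      also have "\<dots> = ?n y P" using y0 by (simp add: g_def powr_minus)
      finally show ?thesis .
    next
      case False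
      then have "infnorm (of_int_vec y) powr (- w) \<le> ?n y P" using y by (simp add: X_def)
      moreover have "c * infnorm (of_int_vec y) powr (- w) \<le> 1 * infnorm (of_int_vec y) powr (- w)"
        using c1 by (rule mult_right_mono) simp
      ultimately show ?thesis by simp
    qed
  qed
qed

text \<open>The blocks of the dilated vector balance when the norm of \<open>y\<close> is
  \<open>t\<close>, where \<open>t powr (1 + w) = 2 ^ l\<close>. Beyond \<open>t\<close> the block
  \<open>y\<close> is long enough, and below it the block \<open>A y - P\<close> dilated by
  \<open>2 ^ l\<close> is. With the scalar of \<open>central\<close> this gives the rate
  \<open>\<theta> - 1 / (1 + w)\<close>.\<close>

lemma central_form_lattice_ge:
  fixes A :: "real ^ 'm::finite ^ 'd::finite option"
  assumes c: "0 < c" "c \<le> 1"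
    "\<forall>y P. y \<noteq> 0 \<longrightarrow> c * infnorm (of_int_vec y) powr (- w) \<le> infnorm (A *v of_int_vec y - of_int_vec P)"
    and w: "0 \<le> w" and v: "v \<in> form_lattice A" "v \<noteq> 0"
  shows "c * 2 powr (- (real l * (real (CARD('d) + 1) / real CARD('d option + 'm) - 1 / (1 + w)))) \<le> infnorm (central l v)"
proof -
  define \<theta> where "\<theta> = real (CARD('d) + 1) / real CARD('d option + 'm)"
  define t where "t = 2 powr (real l * (1 / (1 + w)))"
  have t: "0 < t" by (simp add: t_def)
  obtain y P where yP: "v = form_vec A y P" using v(1) by (auto simp: form_lattice_def)
  define u where "u = ydil (2 ^ l) v"
  have uL: "u $ Inl i = 2 ^ l * (A *v of_int_vec y - of_int_vec P) $ i" and uR: "u $ Inr k = of_int_vec y $ k" for i k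
    by (simp_all add: u_def yP ydil_def diag_map_def form_vec_def of_int_vec_def)
  have Y: "2 ^ l * infnorm (A *v of_int_vec y - of_int_vec P) \<le> infnorm u"
  proof -
    have "infnorm (A *v of_int_vec y - of_int_vec P) \<le> infnorm u / 2 ^ l"
      unfolding infnorm_le_iff
    proof
      fix i
      have "2 ^ l * \<bar>(A *v of_int_vec y - of_int_vec P) $ i\<bar> \<le> infnorm u"
        using component_le_infnorm_cart[of u "Inl i"] unfolding uL abs_mult by simp
      then show "\<bar>(A *v of_int_vec y - of_int_vec P) $ i\<bar> \<le> infnorm u / 2 ^ l"
        by (simp add: pos_le_divide_eq mult.commute)
    qed
    then show ?thesis by (simp add: pos_le_divide_eq mult.commute)
  qed
  have X: "infnorm (of_int_vec y) \<le> infnorm u"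
    unfolding infnorm_le_iff using component_le_infnorm_cart[of u] uR by metis
  have main: "c * t \<le> infnorm u"
  proof (cases "y = 0")
    case True
    have y0: "A *v of_int_vec y = 0" unfolding True by (simp add: of_int_vec_def matrix_vector_mult_def vec_eq_iff)
    have "P \<noteq> 0"
    proof
      assume "P = 0"
      then have "v $ r = 0" for r
        using True y0 by (cases r) (simp_all add: yP form_vec_def of_int_vec_def)
      then show False using v(2) by (simp add: vec_eq_iff)
    qed
    have "t \<le> 2 powr (real l * 1)"
      unfolding t_def using w by (intro powr_mono mult_left_mono) auto
    also have "\<dots> = 2 ^ l * 1" by (simp add: powr_realpow)
    also have "\<dots> \<le> 2 ^ l * infnorm (of_int_vec P)"
      by (intro mult_left_mono of_int_vec_infnorm_ge_1 \<open>P \<noteq> 0\<close>) simp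
    also have "infnorm (of_int_vec P) = infnorm (A *v of_int_vec y - of_int_vec P)"
      unfolding y0 by (simp add: infnorm_neg)
    finally have "t \<le> infnorm u" using Y by (rule order_trans)
    moreover have "c * t \<le> 1 * t" using c t by (intro mult_right_mono) auto
    ultimately show ?thesis by simp
  next
    case False
    define x where "x = infnorm (of_int_vec y)"
    have x: "1 \<le> x" unfolding x_def by (rule of_int_vec_infnorm_ge_1[OF False])
    show ?thesis
    proof (cases "t \<le> x")
      case True
      moreover have "c * t \<le> 1 * t" using c t by (intro mult_right_mono) auto
      ultimately show ?thesis using X unfolding x_def by linarith
    next
      case False2: False
      have "t = 2 powr (real l) * t powr (- w)"
      proof -
        have "1 / (1 + w) = 1 - 1 / (1 + w) * w" using w by (simp add: field_simps)
        then have "real l * (1 / (1 + w)) = real l + real l * (1 / (1 + w)) * (- w)"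
          by (metis (no_types, opaque_lifting) diff_conv_add_uminus distrib_left mult.assoc mult.right_neutral mult_minus_right)
        then show ?thesis unfolding t_def powr_powr powr_add[symmetric] by (rule arg_cong)
      qed
      also have "\<dots> \<le> 2 powr (real l) * x powr (- w)"
        using False2 x w by (intro mult_left_mono powr_mono2') auto
      finally have "c * t \<le> c * (2 ^ l * x powr (- w))" using c by (simp add: powr_realpow)
      also have "\<dots> = 2 ^ l * (c * x powr (- w))" by simp
      also have "\<dots> \<le> 2 ^ l * infnorm (A *v of_int_vec y - of_int_vec P)"
        unfolding x_def by (intro mult_left_mono c(3)[rule_format] False) simp
      finally show ?thesis using Y by (rule order_trans)
    qed
  qed
  have "c * 2 powr (- (real l * (\<theta> - 1 / (1 + w)))) = 2 powr (- (real l * \<theta>)) * (c * t)"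
  proof -
    have "- (real l * (\<theta> - 1 / (1 + w))) = - (real l * \<theta>) + real l * (1 / (1 + w))"
      unfolding right_diff_distrib by simp
    then show ?thesis unfolding t_def by (simp only: powr_add mult_ac)
  qed
  also have "\<dots> \<le> 2 powr (- (real l * \<theta>)) * infnorm u" using main by (rule mult_left_mono) simp
  also have "\<dots> = infnorm (central l v)"
    by (simp add: central_def \<theta>_def u_def infnorm_mul del: card_sum)
  finally show ?thesis unfolding \<theta>_def .
qed

subsection \<open>Singular vectors give short lattice vectors\<close>

lemma sum_UNIV_option: "(\<Sum>i\<in>(UNIV :: 'a::finite option set). f i) = f None + (\<Sum>a\<in>UNIV. f (Some a))"
  unfolding UNIV_option_conv by (subst sum.insert) (auto simp: sum.reindex)

lemma sum_UNIV_sum: "(\<Sum>r\<in>(UNIV :: ('a::finite + 'b::finite) set). f r) = (\<Sum>a\<in>UNIV. f (Inl a)) + (\<Sum>b\<in>UNIV. f (Inr b))"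
  unfolding UNIV_Plus_UNIV[symmetric] by (subst sum.Plus) (auto simp: o_def)

text \<open>So \<open>\<bar>q \<bullet> x - p\<bar>\<close> is the top coordinate, after the shear by \<open>s\<close>, of a lattice vector whose other
  coordinates are controlled by \<open>q\<close>.\<close>

lemma shear_form_vec_top:
  fixes A :: "real ^ 'm::finite ^ 'd::finite option" and z :: "int ^ ('d + 'm)"
  shows "shear s (form_vec A (\<chi> k. z $ Inr k) (\<chi> i. case i of None \<Rightarrow> P | Some a \<Rightarrow> - z $ Inl a)) $ top_row
    = of_int_vec z \<bullet> vec_append s (tilde s v* A) - of_int P"
proof -
  define y where "y = (of_int_vec (\<chi> k. z $ Inr k) :: real ^ 'm)"
  have "of_int_vec z \<bullet> vec_append s (tilde s v* A)
    = (\<Sum>a\<in>UNIV. of_int (z $ Inl a) * s $ a) + (tilde s v* A) \<bullet> y"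
    by (simp add: inner_vec_def sum_UNIV_sum vec_append_def of_int_vec_def y_def mult.commute)
  also have "(tilde s v* A) \<bullet> y = (A *v y) $ None + (\<Sum>a\<in>UNIV. s $ a * (A *v y) $ Some a)"
    unfolding dot_lmul_matrix by (simp add: inner_vec_def sum_UNIV_option tilde_def)
  finally show ?thesis
    by (simp add: shear_top form_vec_def of_int_vec_def[of "\<chi> i. case i of None \<Rightarrow> P | Some a \<Rightarrow> - z $ Inl a"] y_def[symmetric]
      algebra_simps sum.distrib)
qed

text \<open>With \<open>R = M powr (k / N)\<close>, the flow multiplies the sheared top coordinate
  by \<open>R ^ n\<close> and the other coordinates by \<open>1 / R\<close>. Singularity at a bound
  \<open>Q\<close> close to \<open>\<epsilon>1 * R\<close> makes all of them at most
  \<open>\<epsilon>\<close>; \<open>a0\<close> accounts for the entries of \<open>A\<close>.\<close>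

lemma Sing_short:
  fixes A :: "real ^ 'm::finite ^ 'd::finite option"
  assumes s: "s \<in> Sing A" and M: "2 \<le> M" and \<epsilon>: "0 < \<epsilon>"
  shows "\<exists>k0. \<forall>k\<ge>k0. \<exists>v\<in>form_lattice A. v \<noteq> 0 \<and> infnorm (flow M k s v) \<le> \<epsilon>"
proof -
  define n where "n = CARD('d + 'm)"
  define N where "N = CARD('d option + 'm)"
  have N: "N = Suc n" by (simp add: N_def n_def card_option)
  define a0 where "a0 = 1 + (\<Sum>i\<in>UNIV. \<Sum>k\<in>UNIV. \<bar>A $ i $ k\<bar>)"
  have a0: "1 \<le> a0" by (simp add: a0_def sum_nonneg)
  define \<epsilon>1 where "\<epsilon>1 = \<epsilon> / a0"
  have \<epsilon>1: "0 < \<epsilon>1" "\<epsilon>1 * a0 = \<epsilon>" using \<epsilon> a0 by (simp_all add: \<epsilon>1_def)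
  \<comment> \<open>The halved \<open>\<epsilon>1\<close> appears because rounding only guarantees
    that \<open>Q\<close> is at least \<open>\<epsilon>1 / 2 * R\<close>.\<close>
  define \<epsilon>2 where "\<epsilon>2 = \<epsilon> * (\<epsilon>1 / 2) ^ n"
  have \<epsilon>2: "0 < \<epsilon>2" using \<epsilon> \<epsilon>1 by (simp add: \<epsilon>2_def)
  define r where "r = real M powr (1 / real N)"
  have r: "1 < r" unfolding r_def using M N by simp
  have rN: "r ^ N = real M"
  proof -
    have "real N \<noteq> 0" using N by simp
    then have "r powr real N = real M" unfolding r_def powr_powr using M by simp
    then show ?thesis using r by (simp add: powr_realpow)
  qed
  have rinv: "real M powr (- (1 / real N)) = 1 / r" unfolding r_def by (simp add: powr_minus_divide)
  obtain N0 where N0: "\<forall>Q\<ge>N0. \<exists>(z :: int ^ ('d + 'm)) (P :: int). z \<noteq> 0 \<and>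
      \<bar>of_int_vec z \<bullet> vec_append s (tilde s v* A) - real_of_int P\<bar> \<le> \<epsilon>2 * real Q powr (- real n) \<and>
      infnorm (of_int_vec z) \<le> real Q"
    using s \<epsilon>2 unfolding Sing_def singular_vec_def n_def by blast
  \<comment> \<open>The summand 2 keeps \<open>Q\<close> above \<open>N0\<close> and makes the
    rounding error at most half of \<open>\<epsilon>1 * R\<close>.\<close>
  obtain k0 where k0: "(real N0 + 2) / \<epsilon>1 < r ^ k0" using real_arch_pow[OF r] by blast
  have "\<exists>v\<in>form_lattice A. v \<noteq> 0 \<and> infnorm (flow M k s v) \<le> \<epsilon>" if k: "k0 \<le> k" for k
  proof -
    define R where "R = r ^ k"
    have "r ^ k0 \<le> R" unfolding R_def using r k by (intro power_increasing) auto
    then have "(real N0 + 2) / \<epsilon>1 \<le> R" using k0 by linarith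
    then have big: "real N0 + 2 \<le> \<epsilon>1 * R" using \<epsilon>1(1) by (simp add: pos_divide_le_eq mult.commute)
    have R: "0 < R" using r by (simp add: R_def)
    define Q where "Q = nat \<lfloor>\<epsilon>1 * R\<rfloor>"
    have Q: "real Q \<le> \<epsilon>1 * R" "\<epsilon>1 * R - 1 < real Q" using big by (simp_all add: Q_def)
    have Q2: "N0 \<le> Q" "\<epsilon>1 / 2 * R \<le> real Q" using Q big by linarith+
    have Q0: "0 < real Q" using Q2(2) \<epsilon>1(1) R by (meson divide_pos_pos less_le_trans mult_pos_pos zero_less_numeral)
    obtain z :: "int ^ ('d + 'm)" and P :: int where z: "z \<noteq> 0"
      "\<bar>of_int_vec z \<bullet> vec_append s (tilde s v* A) - real_of_int P\<bar> \<le> \<epsilon>2 * real Q powr (- real n)"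
      "infnorm (of_int_vec z) \<le> real Q" using N0 Q2(1) by blast
    define y where "y = (\<chi> k. z $ Inr k)"
    define P' where "P' = (\<chi> i. case i of None \<Rightarrow> P | Some a \<Rightarrow> - z $ Inl a)"
    define v where "v = form_vec A y P'"
    have zle: "\<bar>of_int (z $ j)\<bar> \<le> real Q" for j
      using order_trans[OF component_le_infnorm_cart[of "of_int_vec z" j] z(3)] by (simp add: of_int_vec_def)
    have vR: "v $ Inr k = of_int (z $ Inr k)" for k by (simp add: v_def form_vec_def y_def)
    have vS: "v $ Inl (Some a) = (\<Sum>k\<in>UNIV. A $ Some a $ k * of_int (z $ Inr k)) + of_int (z $ Inl a)" for a
      by (simp add: v_def form_vec_def y_def P'_def of_int_vec_def matrix_vector_mult_def)
    have "v \<noteq> 0"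
    proof
      assume v0: "v = 0"
      have zR: "z $ Inr k = 0" for k using vR[of k] v0 by simp
      have zL: "z $ Inl a = 0" for a using vS[of a] v0 zR by simp
      have "z $ j = 0" for j by (cases j) (simp_all add: zR zL)
      then show False using z(1) by (simp add: vec_eq_iff)
    qed
    moreover have "v \<in> form_lattice A" by (auto simp: v_def form_lattice_def)
    moreover have "infnorm (flow M k s v) \<le> \<epsilon>"
      unfolding infnorm_le_iff
    proof
      fix j
      have M1: "1 \<le> M" using M by simp
      have fl: "flow M k s v $ j = (1 / R) * (if j = top_row then real M ^ k * shear s v $ j else v $ j)"
        unfolding flow_nth[OF M1] N_def[symmetric] rinv by (simp add: R_def power_one_over)
      show "\<bar>flow M k s v $ j\<bar> \<le> \<epsilon>"
      proof (cases "j = top_row")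
        case True
        have "shear s v $ top_row = of_int_vec z \<bullet> vec_append s (tilde s v* A) - real_of_int P"
          unfolding v_def y_def P'_def by (rule shear_form_vec_top)
        then have sh: "\<bar>shear s v $ top_row\<bar> \<le> \<epsilon>2 * real Q powr (- real n)" using z(2) by simp
        have "real Q powr (- real n) \<le> (\<epsilon>1 / 2 * R) powr (- real n)"
          using Q2(2) \<epsilon>1(1) R by (intro powr_mono2') auto
        also have "\<dots> = 1 / ((\<epsilon>1 / 2) ^ n * R ^ n)"
          unfolding power_mult_distrib[symmetric] using \<epsilon>1(1) R by (simp add: powr_minus_divide powr_realpow)
        finally have "\<epsilon>2 * real Q powr (- real n) \<le> \<epsilon>2 * (1 / ((\<epsilon>1 / 2) ^ n * R ^ n))"
          using \<epsilon>2 by (intro mult_left_mono) auto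
        also have "\<dots> = \<epsilon> / R ^ n" using \<epsilon>1(1) by (simp add: \<epsilon>2_def)
        finally have sh2: "\<bar>shear s v $ top_row\<bar> \<le> \<epsilon> / R ^ n" using sh by linarith
        have "real M ^ k = R ^ N" unfolding R_def rN[symmetric] by (simp add: power_mult[symmetric] mult.commute)
        then have "flow M k s v $ j = R ^ n * shear s v $ top_row" unfolding fl using R True by (simp add: N)
        then have "\<bar>flow M k s v $ j\<bar> = R ^ n * \<bar>shear s v $ top_row\<bar>" using R by (simp add: abs_mult)
        also have "\<dots> \<le> R ^ n * (\<epsilon> / R ^ n)" using R sh2 by (intro mult_left_mono) auto
        finally show ?thesis using R by simp
      next
        case False
        have "\<bar>v $ j\<bar> \<le> a0 * real Q"
        proof (cases j)
          case (Inl i)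
          then obtain a where i: "i = Some a" using False by (cases i) auto
          have "\<bar>v $ j\<bar> \<le> \<bar>\<Sum>k\<in>UNIV. A $ Some a $ k * of_int (z $ Inr k)\<bar> + real Q"
            unfolding Inl i vS using zle[of "Inl a"] by linarith
          also have "\<bar>\<Sum>k\<in>UNIV. A $ Some a $ k * of_int (z $ Inr k)\<bar> \<le> (\<Sum>k\<in>UNIV. \<bar>A $ Some a $ k\<bar> * real Q)"
            by (rule order_trans[OF sum_abs], rule sum_mono) (simp add: abs_mult mult_left_mono zle)
          also have "\<dots> = (\<Sum>k\<in>UNIV. \<bar>A $ Some a $ k\<bar>) * real Q" by (simp add: sum_distrib_right)
          also have "\<dots> \<le> (\<Sum>i\<in>UNIV. \<Sum>k\<in>UNIV. \<bar>A $ i $ k\<bar>) * real Q"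
            by (intro mult_right_mono member_le_sum) (auto simp: sum_nonneg)
          finally show ?thesis by (simp add: a0_def algebra_simps)
        next
          case (Inr k)
          have "1 * real Q \<le> a0 * real Q" using a0 by (intro mult_right_mono) auto
          then show ?thesis unfolding Inr vR using zle[of "Inr k"] by linarith
        qed
        also have "\<dots> \<le> a0 * (\<epsilon>1 * R)" using Q(1) a0 by (intro mult_left_mono) auto
        finally have "\<bar>v $ j\<bar> \<le> \<epsilon> * R" using \<epsilon>1(2) by (simp add: mult_ac)
        then have "\<bar>v $ j\<bar> / R \<le> \<epsilon>" using R by (simp add: pos_divide_le_eq)
        then show ?thesis using R False by (simp add: fl)
      qed
    qed
    ultimately show ?thesis by blast
  qed
  then show ?thesis by blast
qed


subsection \<open>The dimension bound\<close>

text \<open>In terms of \<open>\<delta>\<close> the rate of the shortest vectors is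
  \<open>\<nu> = \<delta> / ((n + 1) * (1 + w))\<close>, and the two rate conditions become the two
  inequalities between \<open>\<delta>\<close> and \<open>p\<close>.\<close>

lemma hausdorff_measure_Sing_eq_0:
  fixes A :: "real ^ 'm::finite ^ 'd::finite option"
  defines "d \<equiv> real CARD('d)" and "m \<equiv> real CARD('m)"
  defines "n \<equiv> d + m"
  assumes w: "dioph_exponent A < ereal w" and p: "0 < p" "p < d"
    and \<delta>: "\<delta> = (d + 1) * w - m" "0 \<le> \<delta>" "\<delta> < p * (n + 1)" "n * d * \<delta> < p * (n + 1) * (1 + \<delta>)"
    and \<sigma>: "(d\<^sup>2 + p) / (d + 1) < \<sigma>"
  shows "hausdorff_measure \<sigma> (Sing A) = 0"
proof -
  have d0: "0 \<le> d" and m0: "0 \<le> m" by (simp_all add: d_def m_def)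
  have w0: "0 \<le> w"
  proof -
    have "0 \<le> (d + 1) * w" using \<delta> m0 by simp
    then show ?thesis using d0 by (simp add: zero_le_mult_iff)
  qed
  interpret S: slice "form_lattice A" p
  proof
    show "x + of_int z *\<^sub>R y \<in> form_lattice A" if "x \<in> form_lattice A" "y \<in> form_lattice A" for x y z
      by (rule form_lattice_closed[OF that])
    show "1 \<le> \<bar>rowdet v\<bar>" if "\<And>k. v k \<in> form_lattice A" "rowdet v \<noteq> 0" for v
      by (rule form_lattice_covol[OF that])
    show "0 < p" "p < real CARD('d)" using p by (simp_all add: d_def)
  qed
  have Sd: "real S.d = d" by (simp add: S.d_def d_def)
  have SN: "real S.N = n + 1" "real (S.N - 1) = n" by (simp_all add: S.N_def n_def d_def m_def card_option)
  have S\<theta>: "S.\<theta> = (d + 1) / (n + 1)" unfolding S.\<theta>_def SN(1)[symmetric] by (simp add: Sd)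
  define \<nu> where "\<nu> = S.\<theta> - 1 / (1 + w)"
  obtain c where c: "0 < c" "c \<le> 1"
    "\<forall>y P. y \<noteq> 0 \<longrightarrow> c * infnorm (of_int_vec y) powr (- w) \<le> infnorm (A *v of_int_vec y - of_int_vec P)"
    by (rule dioph_exponent_lower_bound[OF w])
  have n0: "0 \<le> n" "0 < n + 1" "0 < 1 + w" using d0 m0 w0 by (simp_all add: n_def)
  have key: "(d + 1) * (1 + w) = n + 1 + \<delta>" by (simp add: \<delta>(1) n_def algebra_simps)
  have \<nu>: "\<nu> = \<delta> / ((n + 1) * (1 + w))"
  proof -
    have "\<nu> = ((d + 1) * (1 + w) - (n + 1)) / ((n + 1) * (1 + w))"
      unfolding \<nu>_def S\<theta> using n0 by (simp add: divide_simps)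
    then show ?thesis unfolding key by simp
  qed
  have p\<theta>: "p * S.\<theta> = p * (n + 1 + \<delta>) / ((n + 1) * (1 + w))"
    unfolding S\<theta> key[symmetric] using n0 by simp
  show ?thesis
  proof (rule S.hausdorff_measure_short_eq_0[OF c(1,2)])
    show "0 \<le> \<nu>" unfolding \<nu> using \<delta> n0 by simp
    show "c * 2 powr (- (real l * \<nu>)) \<le> infnorm (central l v)" if "v \<in> form_lattice A" "v \<noteq> 0" for l v
      using central_form_lattice_ge[OF c w0 that, of l] unfolding \<nu>_def S.\<theta>_def S.d_def S.N_def .
    have "\<delta> * (1 + p) < p * (n + 1 + \<delta>)" using \<delta>(3) by (simp add: algebra_simps)
    then show "\<nu> * (1 + p) < p * S.\<theta>" unfolding \<nu> p\<theta> using n0 by (simp add: divide_strict_right_mono)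
    have "n * \<delta> * (d - p) < p * (n + 1 + \<delta>)" using \<delta>(4) by (simp add: algebra_simps)
    then have "n * \<delta> * (d - p) / ((n + 1) * (1 + w)) < p * (n + 1 + \<delta>) / ((n + 1) * (1 + w))"
      using n0 by (intro divide_strict_right_mono) auto
    then show "real (S.N - 1) * \<nu> * (real S.d - p) < p * S.\<theta>" unfolding \<nu> p\<theta> Sd SN by simp
    have "d - (d - p) / (d + 1) = (d\<^sup>2 + p) / (d + 1)" using d0 by (simp add: field_simps power2_eq_square)
    then show "S.dim_exp < \<sigma>" using \<sigma> by (simp add: S.dim_exp_def Sd)
  qed (rule Sing_short)
qed

text \<open>A limiting argument: \<open>p\<close> is taken slightly above \<open>p0\<close> and
  \<open>w'\<close> slightly above the exponent, which makes all inequalities strict;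
  \<open>\<eta>\<close> is the resulting increase of \<open>\<delta>\<close>.\<close>

lemma hausdorff_dim_Sing_le:
  fixes A :: "real ^ 'm::finite ^ 'd::finite option"
  defines "d \<equiv> real CARD('d)" and "m \<equiv> real CARD('m)"
  defines "n \<equiv> d + m"
  assumes w: "dioph_exponent A = ereal w" and \<delta>: "\<delta> = (d + 1) * w - m" "0 \<le> \<delta>" "\<delta> < d * (n + 1)"
    and p0: "\<delta> \<le> p0 * (n + 1)" "n * d * \<delta> \<le> p0 * ((n + 1) * (1 + \<delta>))" "p0 < d"
  shows "hausdorff_dim (Sing A) \<le> ereal ((d\<^sup>2 + p0) / (d + 1))"
proof (rule hausdorff_dim_leI)
  have d1: "1 \<le> d" and n0: "0 < n" by (simp_all add: d_def m_def n_def add_pos_pos Suc_leI)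
  have p00: "0 \<le> p0" using order_trans[OF \<delta>(2) p0(1)] n0 by (simp add: zero_le_mult_iff)
  then show "0 \<le> (d\<^sup>2 + p0) / (d + 1)" using d1 by simp
  fix \<sigma> assume \<sigma>: "(d\<^sup>2 + p0) / (d + 1) < \<sigma>"
  then have "p0 < \<sigma> * (d + 1) - d\<^sup>2" using d1 by (simp add: pos_divide_less_eq)
  then obtain p where p: "p0 < p" "p < min d (\<sigma> * (d + 1) - d\<^sup>2)" using dense[of p0 "min d (\<sigma> * (d + 1) - d\<^sup>2)"] p0(3) by auto
  define g1 where "g1 = p * (n + 1) - \<delta>"
  define g2 where "g2 = p * ((n + 1) * (1 + \<delta>)) - n * d * \<delta>"
  have "p0 * (n + 1) < p * (n + 1)" "p0 * ((n + 1) * (1 + \<delta>)) < p * ((n + 1) * (1 + \<delta>))"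
    using p(1) n0 \<delta>(2) by (auto intro!: mult_strict_right_mono mult_pos_pos)
  then have g1: "0 < g1" and g2: "0 < g2" unfolding g1_def g2_def using p0(1,2) by linarith+
  have nd: "0 < n * d" using n0 d1 by simp
  \<comment> \<open>The margins \<open>g1\<close> and \<open>g2\<close> belong to the two
    thresholds. Raising \<open>\<delta>\<close> by \<open>\<eta>\<close> raises the left side of the
    second one by \<open>n * d * \<eta>\<close>, hence the quotient.\<close>
  have "0 < min g1 (g2 / (n * d))" using g1 g2 nd by simp
  then obtain \<eta> where "0 < \<eta>" "\<eta> < min g1 (g2 / (n * d))" using dense by blast
  then have \<eta>: "0 < \<eta>" "\<eta> < g1" "\<eta> < g2 / (n * d)" by simp_all
  have \<eta>2: "n * d * \<eta> < g2" using \<eta>(3) nd by (simp add: pos_less_divide_eq mult.commute)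
  define w' where "w' = w + \<eta> / (d + 1)"
  have \<delta>': "\<delta> + \<eta> = (d + 1) * w' - m" using d1 by (simp add: w'_def \<delta>(1) distrib_left)
  show "hausdorff_measure \<sigma> (Sing A) = 0"
  proof (rule hausdorff_measure_Sing_eq_0[where w = w' and p = p and \<delta> = "\<delta> + \<eta>" and A = A,
      folded d_def m_def, folded n_def])
    show "dioph_exponent A < ereal w'" using \<eta>(1) d1 by (simp add: w w'_def)
    show "0 < p" "p < d" using p p00 by auto
    show "\<delta> + \<eta> = (d + 1) * w' - m" by (rule \<delta>')
    show "0 \<le> \<delta> + \<eta>" using \<delta>(2) \<eta>(1) by simp
    show "\<delta> + \<eta> < p * (n + 1)" using \<eta>(2) by (simp add: g1_def)
    have "0 \<le> p * ((n + 1) * \<eta>)" using p p00 n0 \<eta>(1) by simp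
    moreover have "n * d * (\<delta> + \<eta>) = n * d * \<delta> + n * d * \<eta>"
      "p * (n + 1) * (1 + (\<delta> + \<eta>)) = p * ((n + 1) * (1 + \<delta>)) + p * ((n + 1) * \<eta>)" by (simp_all add: algebra_simps)
    ultimately show "n * d * (\<delta> + \<eta>) < p * (n + 1) * (1 + (\<delta> + \<eta>))" using \<eta>2 unfolding g2_def by linarith
    show "(d\<^sup>2 + p) / (d + 1) < \<sigma>" using p(2) d1 by (simp add: pos_divide_less_eq)
  qed
qed

theorem theorem1p1:
  fixes n d :: nat
    and A :: "real ^ 'm::finite ^ 'd::finite option"
  assumes "n \<ge> 2" and "1 \<le> d" and "d < n"
    and "CARD('d) = d" and "CARD('m) = n - d"
  defines "\<omega> \<equiv> dioph_exponent A"
    and "w \<equiv> real_of_ereal (dioph_exponent A)"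
    and "\<omega>\<^sub>0 \<equiv> (real n - real d) / (real d + 1)"
  shows
    "(ereal \<omega>\<^sub>0 \<le> \<omega> \<and> \<omega> < ereal (real n - 1) \<longrightarrow>
        hausdorff_dim (Sing A) \<le> ereal
          ((real d)\<^sup>2 / (real d + 1) +
           real n * real d * (w - \<omega>\<^sub>0) /
             ((1 + (real d + 1) * w - (real n - real d)) * (real n + 1)))) \<and>
     (ereal (real n - 1) \<le> \<omega> \<and> \<omega> < ereal (real n) \<longrightarrow>
        hausdorff_dim (Sing A) \<le> ereal
          ((real d)\<^sup>2 / (real d + 1) + 1 / (real n + 1) * (w - \<omega>\<^sub>0))) \<and>
     (ereal (real n) \<le> \<omega> \<longrightarrow> hausdorff_dim (Sing A) \<le> ereal (real d))"
proof (intro conjI impI)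
  define D where "D = real d"
  define M where "M = real n"
  \<comment> \<open>Equal to \<open>(D + 1) * (w - \<omega>\<^sub>0)\<close>. The exponent is
    \<open>n - 1\<close> when \<open>\<delta> = D * M - 1\<close>, where the two thresholds for
    \<open>p0\<close> coincide, and it is \<open>n\<close> when
    \<open>\<delta> = D * (M + 1)\<close>, where \<open>p0\<close> reaches \<open>D\<close>.\<close>
  define \<delta> where "\<delta> = (D + 1) * w - (M - D)"
  have D: "1 \<le> D" "D + 1 \<le> M" using assms(2,3) by (simp_all add: D_def M_def)
  have card: "real CARD('d) = D" "real CARD('m) = M - D" using assms(3-5) by (simp_all add: D_def M_def)
  have \<delta>w: "w - \<omega>\<^sub>0 = \<delta> / (D + 1)" using D by (simp add: \<delta>_def \<omega>\<^sub>0_def D_def M_def diff_divide_distrib)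
  have bound: "hausdorff_dim (Sing A) \<le> ereal ((D\<^sup>2 + p0) / (D + 1))"
    if "\<omega> = ereal w" "0 \<le> \<delta>" "\<delta> < D * (M + 1)" "\<delta> \<le> p0 * (M + 1)" "M * D * \<delta> \<le> p0 * ((M + 1) * (1 + \<delta>))" "p0 < D" for p0
    using hausdorff_dim_Sing_le[where A = A and w = w and \<delta> = \<delta> and ?p0.0 = p0, unfolded card] that
    by (simp add: \<omega>_def \<delta>_def)
  have le_\<delta>: "(D + 1) * x - (M - D) \<le> \<delta>" if "\<omega> = ereal w" "ereal x \<le> \<omega>" for x
    using that D mult_left_mono[of x w "D + 1"] by (simp add: \<delta>_def)
  have less_\<delta>: "\<delta> < (D + 1) * x - (M - D)" if "\<omega> = ereal w" "\<omega> < ereal x" for x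
    using that D mult_strict_left_mono[of w x "D + 1"] by (simp add: \<delta>_def)
  have fin: "\<omega> = ereal w" if "ereal x \<le> \<omega>" "\<omega> < ereal y" for x y
    using that by (cases \<omega>) (auto simp: w_def \<omega>_def)
  {
    assume a: "ereal \<omega>\<^sub>0 \<le> \<omega> \<and> \<omega> < ereal (real n - 1)"
    note w = fin[OF conjunct1[OF a] conjunct2[OF a]]
    have \<delta>0: "0 \<le> \<delta>" using le_\<delta>[OF w conjunct1[OF a]] D by (simp add: \<omega>\<^sub>0_def D_def[symmetric] M_def[symmetric])
    have \<delta>1: "\<delta> < D * M - 1" using less_\<delta>[OF w conjunct2[OF a]] by (simp add: M_def[symmetric] algebra_simps)
    \<comment> \<open>The second threshold; it is at least the first one because
      \<open>1 + \<delta> < D * M\<close>.\<close>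
    define p0 where "p0 = M * D * \<delta> / ((M + 1) * (1 + \<delta>))"
    have pos: "0 < (M + 1) * (1 + \<delta>)" using D \<delta>0 by simp
    have "hausdorff_dim (Sing A) \<le> ereal ((D\<^sup>2 + p0) / (D + 1))"
    proof (rule bound[OF w \<delta>0])
      show "\<delta> < D * (M + 1)" using \<delta>1 D by (simp add: distrib_left)
      have "\<delta> * (1 + \<delta>) \<le> \<delta> * (M * D)" using \<delta>0 \<delta>1 by (intro mult_left_mono) (auto simp: mult.commute)
      then have "\<delta> \<le> M * D * \<delta> / (1 + \<delta>)" using \<delta>0 by (simp add: pos_le_divide_eq mult_ac)
      also have "\<dots> = p0 * (M + 1)" using D by (simp add: p0_def)
      finally show "\<delta> \<le> p0 * (M + 1)" .
      have "p0 * ((M + 1) * (1 + \<delta>)) = M * D * \<delta>"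
        using p0_def unfolding nonzero_eq_divide_eq[OF less_imp_neq[OF pos, THEN not_sym]] .
      then show "M * D * \<delta> \<le> p0 * ((M + 1) * (1 + \<delta>))" by simp
      have "M * \<delta> < (M + 1) * (1 + \<delta>)" using D \<delta>0 by (simp add: algebra_simps add_pos_nonneg)
      then have "D * (M * \<delta>) < D * ((M + 1) * (1 + \<delta>))" using D by (intro mult_strict_left_mono) auto
      then show "p0 < D" unfolding p0_def using pos by (simp add: pos_divide_less_eq mult_ac)
    qed
    also have "(D\<^sup>2 + p0) / (D + 1) = D\<^sup>2 / (D + 1) + M * D * (w - \<omega>\<^sub>0) / ((1 + (D + 1) * w - (M - D)) * (M + 1))"
    proof -
      have "1 + (D + 1) * w - (M - D) = 1 + \<delta>" by (simp add: \<delta>_def)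
      then show ?thesis unfolding \<delta>w p0_def by (simp add: add_divide_distrib mult_ac)
    qed
    finally show "hausdorff_dim (Sing A) \<le> ereal ((real d)\<^sup>2 / (real d + 1) +
           real n * real d * (w - \<omega>\<^sub>0) / ((1 + (real d + 1) * w - (real n - real d)) * (real n + 1)))"
      unfolding D_def M_def .
  }
  {
    assume a: "ereal (real n - 1) \<le> \<omega> \<and> \<omega> < ereal (real n)"
    note w = fin[OF conjunct1[OF a] conjunct2[OF a]]
    have \<delta>1: "D * M - 1 \<le> \<delta>" using le_\<delta>[OF w conjunct1[OF a]] by (simp add: M_def[symmetric] algebra_simps)
    have "1 * 1 \<le> D * M" using D by (intro mult_mono) auto
    then have \<delta>0: "0 \<le> \<delta>" using \<delta>1 by simp
    have \<delta>2: "\<delta> < D * (M + 1)" using less_\<delta>[OF w conjunct2[OF a]] by (simp add: M_def[symmetric] algebra_simps)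
    \<comment> \<open>Now \<open>1 + \<delta> \<ge> D * M\<close>, and the first threshold is the
      larger one.\<close>
    define p0 where "p0 = \<delta> / (M + 1)"
    have "hausdorff_dim (Sing A) \<le> ereal ((D\<^sup>2 + p0) / (D + 1))"
    proof (rule bound[OF w \<delta>0 \<delta>2])
      show "\<delta> \<le> p0 * (M + 1)" using D by (simp add: p0_def)
      have "M * D * \<delta> \<le> (1 + \<delta>) * \<delta>" using \<delta>0 \<delta>1 by (intro mult_right_mono) (auto simp: mult.commute)
      also have "\<dots> = p0 * ((M + 1) * (1 + \<delta>))" using D by (simp add: p0_def)
      finally show "M * D * \<delta> \<le> p0 * ((M + 1) * (1 + \<delta>))" .
      show "p0 < D" using \<delta>2 D by (simp add: p0_def pos_divide_less_eq)
    qed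
    also have "(D\<^sup>2 + p0) / (D + 1) = D\<^sup>2 / (D + 1) + 1 / (M + 1) * (w - \<omega>\<^sub>0)"
      unfolding \<delta>w p0_def by (simp add: add_divide_distrib mult_ac)
    finally show "hausdorff_dim (Sing A) \<le> ereal ((real d)\<^sup>2 / (real d + 1) + 1 / (real n + 1) * (w - \<omega>\<^sub>0))"
      unfolding D_def M_def .
  }
  show "hausdorff_dim (Sing A) \<le> ereal (real d)"
    using hausdorff_dim_le_card[of "Sing A"] assms(4) by simp
qed

end
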